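(* Let $\Omega\subset\mathbb{R}^d$ be a bounded open set with $C^{1,1}$ boundary and let $X=(X_t)_{t\ge0}$ be a translation invariant isotropic process on $\mathbb{R}^d$ with càdlàg paths. Write $\overline{X}^{(1)}_t=\sup_{0\le s\le t}X^{(1)}_s$. Assume that for some $T>0$ and $p>1$, $$\mathbb{E}_0\Big[\big(\overline{X}^{(1)}_T\big)^p\Big]<\infty\qquad\text{and}\qquad \lim_{t\downarrow0}\frac{\mathbb{E}_0\big[(\overline{X}^{(1)}_t)^p\big]}{\mathbb{E}_0\big[\overline{X}^{(1)}_t\big]}=0.$$ Then $$\lim_{t\downarrow0}\frac{\mathrm{Vol}(\Omega)-Q^X_\Omega(t)}{\mathbb{E}_0\big[\overline{X}^{(1)}_t\big]}=\mathrm{Per}(\Omega).$$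
   Context: $X=(X_t)_{t\ge0}$, $X_t=(X^{(1)}_t,\dots,X^{(d)}_t)$, is an $\mathbb{R}^d$-valued stochastic process with càdlàg paths; $\mathbb{P}_x$ (expectation $\mathbb{E}_x$) denotes the probability measure when $X_0=x$. Translation invariant isotropic means: for any $t\ge0$, $x\in\mathbb{R}^d$ and Borel set $A\subset\mathbb{R}^d$, $\mathbb{P}_x(X_t\in A)=\mathbb{P}_0(X_t+x\in A)$ and $\mathbb{P}_0(X_t\in A)=\mathbb{P}_0(UX_t\in A)$ for all $d\times d$ orthogonal matrices $U$. The spectral heat content of a bounded open set $\Omega\subset\mathbb{R}^d$ is $Q^X_\Omega(t)=\int_\Omega\mathbb{P}_x(\tau^X_\Omega>t)\,dx$, where $\tau^X_\Omega=\inf\{t\ge0:X_t\notin\Omega\}$. $\mathrm{Vol}(\Omega)$ is the volume of $\Omega$. The perimeter is $\mathrm{Per}(\Omega)=\sup\{\int_\Omega\sum_{i=1}^dD_i\varphi_i\,dx:\ \varphi_i\in C_c^\infty(\mathbb{R}^d),\ \sum_{i=1}^d\varphi_i^2\le1\}$ (equal to the $(d-1)$-dimensional Hausdorff measure of $\partial\Omega$ when $\partial\Omega$ is $C^1$). A function $f$ is $C^{1,\kappa}$ ($\kappa>0$) if it is $C^1$ and there is $L>0$ with $|\nabla f(x)-\nabla f(y)|\le L|x-y|^\kappa$ for all $x,y$. $\Omega$ has $C^{1,\kappa}$ boundary if for every $x\in\partial\Omega$ there are a neighborhood $V_x$ of $x$ and a $C^{1,\kappa}$ function $\gamma:\mathbb{R}^{d-1}\to\mathbb{R}$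 such that, in suitable orthonormal coordinates (depending on $x$), $\Omega\cap V_x=\{(y_1,\dots,y_d):y_d>\gamma(y_1,\dots,y_{d-1})\}\cap V_x$.
   Formalization: Translation invariance and isotropy are required of all finite-dimensional distributions of X, not only of each single X_t (with single times the claim is false), and the expected running supremum is assumed nonzero for all small t > 0 so that the ratios are defined. *)

theory Defs
  imports "HOL-Probability.Probability"
begin

section \<open>Smoothness, domains, perimeter\<close>

definition partial_deriv :: "'n \<Rightarrow> (real^'n \<Rightarrow> real) \<Rightarrow> real^'n \<Rightarrow> real" where
  "partial_deriv i f x = frechet_derivative f (at x) (axis i 1)"

definition gradient :: "(real^'n \<Rightarrow> real) \<Rightarrow> real^'n \<Rightarrow> real^'n" where
  "gradient f x = (\<chi> i. partial_deriv i f x)"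

primrec C_diff :: "nat \<Rightarrow> (real^'n \<Rightarrow> real) \<Rightarrow> bool" where
  "C_diff 0 f \<longleftrightarrow> continuous_on UNIV f"
| "C_diff (Suc m) f \<longleftrightarrow> (\<forall>x. f differentiable (at x)) \<and> (\<forall>i. C_diff m (partial_deriv i f))"

definition C_inf_compact_support :: "(real^'n \<Rightarrow> real) \<Rightarrow> bool" where
  "C_inf_compact_support f \<longleftrightarrow> (\<forall>m. C_diff m f) \<and> compact (closure {x. f x \<noteq> 0})"

definition C1_holder :: "real \<Rightarrow> (real^'n \<Rightarrow> real) \<Rightarrow> bool" where
  "C1_holder \<kappa> f \<longleftrightarrow> C_diff 1 f \<and>
     (\<exists>L>0. \<forall>x y. norm (gradient f x - gradient f y) \<le> L * norm (x - y) powr \<kappa>)"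

text \<open>A function of the \<open>d - 1\<close> coordinates other than the \<open>k\<close>-th is represented as a function on
  \<open>d\<close>-dimensional space that does not depend on the \<open>k\<close>-th coordinate.  Its gradient then has
  vanishing \<open>k\<close>-th component, so being \<open>C\<^sup>1\<^sup>,\<^sup>\<kappa>\<close> (with the same constant) means the same for both.
  This also covers \<open>d = 1\<close>, where such functions are constants.\<close>

definition independent_of_coord :: "'n \<Rightarrow> (real^'n \<Rightarrow> real) \<Rightarrow> bool" where
  "independent_of_coord k \<gamma> \<longleftrightarrow> (\<forall>y s. \<gamma> (y + s *\<^sub>R axis k 1) = \<gamma> y)"

text \<open>The orthonormal coordinates of \<open>z\<close> are \<open>y = U z\<close> with \<open>U\<close> orthogonal; moving the origin
  only changes \<open>\<gamma>\<close>, and the role of the last coordinate is played by some index \<open>k\<close>.\<close>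

definition C1_holder_boundary :: "real \<Rightarrow> (real^'n) set \<Rightarrow> bool" where
  "C1_holder_boundary \<kappa> \<Omega> \<longleftrightarrow>
     (\<forall>x\<in>frontier \<Omega>. \<exists>V U k \<gamma>. open V \<and> x \<in> V \<and> orthogonal_matrix U \<and>
        C1_holder \<kappa> \<gamma> \<and> independent_of_coord k \<gamma> \<and>
        \<Omega> \<inter> V = {z. \<gamma> (U *v z) < (U *v z) $ k} \<inter> V)"

definition divergence :: "(real^'n \<Rightarrow> real^'n) \<Rightarrow> real^'n \<Rightarrow> real" where
  "divergence \<phi> x = (\<Sum>i\<in>UNIV. partial_deriv i (\<lambda>y. \<phi> y $ i) x)"

definition perimeter :: "(real^'n) set \<Rightarrow> ereal" where
  "perimeter \<Omega> =
     (SUP \<phi> \<in> {\<phi>. (\<forall>i. C_inf_compact_support (\<lambda>x. \<phi> x $ i)) \<and> (\<forall>x. (\<Sum>i\<in>UNIV. (\<phi> x $ i)\<^sup>2) \<le> 1)}.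
        ereal (LINT x:\<Omega>|lebesgue. divergence \<phi> x))"

section \<open>Processes\<close>

definition cadlag :: "(real \<Rightarrow> 'a::topological_space) \<Rightarrow> bool" where
  "cadlag f \<longleftrightarrow> (\<forall>t\<ge>0. (f \<longlongrightarrow> f t) (at_right t)) \<and> (\<forall>t>0. \<exists>l. (f \<longlongrightarrow> l) (at_left t))"

text \<open>\<open>P x\<close> is the probability measure under which the process starts at \<open>x\<close>; all of them live on one
  measurable space.  Only times \<open>t \<ge> 0\<close> are relevant.\<close>

definition cadlag_process :: "(real^'n \<Rightarrow> 'w measure) \<Rightarrow> (real \<Rightarrow> 'w \<Rightarrow> real^'n) \<Rightarrow> bool" where
  "cadlag_process P X \<longleftrightarrow>
     (\<forall>x. prob_space (P x)) \<and>
     (\<forall>x. sets (P x) = sets (P 0)) \<and>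
     (\<forall>t\<ge>0. X t \<in> borel_measurable (P 0)) \<and>
     (\<forall>\<omega>\<in>space (P 0). cadlag (\<lambda>t. X t \<omega>)) \<and>
     (\<forall>x. AE \<omega> in P x. X 0 \<omega> = x)"

text \<open>Equality in law is required of the process, i.e. of all its finite-dimensional distributions;
  \<open>J = {t}\<close> gives the identities for a single time.  The single-time identities alone would leave
  the joint law over different times, and hence the law of exit times and running suprema, under
  \<open>P x\<close> unrelated to that under \<open>P 0\<close>: take Brownian motion under \<open>P 0\<close>, but
  \<open>x + sqrt t *\<^sub>R Z\<close> with one fixed standard Gaussian vector \<open>Z\<close> under \<open>P x\<close> for \<open>x \<noteq> 0\<close>.\<close>

definition translation_invariant :: "(real^'n \<Rightarrow> 'w measure) \<Rightarrow> (real \<Rightarrow> 'w \<Rightarrow> real^'n) \<Rightarrow> bool" where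
  "translation_invariant P X \<longleftrightarrow>
     (\<forall>x J A. finite J \<longrightarrow> J \<subseteq> {0..} \<longrightarrow> (\<forall>t\<in>J. A t \<in> sets borel) \<longrightarrow>
        measure (P x) {\<omega> \<in> space (P x). \<forall>t\<in>J. X t \<omega> \<in> A t} =
        measure (P 0) {\<omega> \<in> space (P 0). \<forall>t\<in>J. X t \<omega> + x \<in> A t})"

definition isotropic :: "(real^'n \<Rightarrow> 'w measure) \<Rightarrow> (real \<Rightarrow> 'w \<Rightarrow> real^'n) \<Rightarrow> bool" where
  "isotropic P X \<longleftrightarrow>
     (\<forall>U J A. orthogonal_matrix U \<longrightarrow> finite J \<longrightarrow> J \<subseteq> {0..} \<longrightarrow> (\<forall>t\<in>J. A t \<in> sets borel) \<longrightarrow>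
        measure (P 0) {\<omega> \<in> space (P 0). \<forall>t\<in>J. X t \<omega> \<in> A t} =
        measure (P 0) {\<omega> \<in> space (P 0). \<forall>t\<in>J. U *v X t \<omega> \<in> A t})"

definition running_sup :: "(real \<Rightarrow> 'w \<Rightarrow> real^'n) \<Rightarrow> 'n \<Rightarrow> real \<Rightarrow> 'w \<Rightarrow> real" where
  "running_sup X k t \<omega> = (SUP s\<in>{0..t}. X s \<omega> $ k)"

text \<open>The exit time is \<open>\<infinity>\<close> if the path never leaves \<open>\<Omega>\<close>.\<close>

definition exit_time :: "(real \<Rightarrow> 'w \<Rightarrow> real^'n) \<Rightarrow> (real^'n) set \<Rightarrow> 'w \<Rightarrow> ereal" where
  "exit_time X \<Omega> \<omega> = Inf {ereal t |t. 0 \<le> t \<and> X t \<omega> \<notin> \<Omega>}"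

text \<open>Exit times of right-continuous processes need not be measurable with respect to an uncompleted
  \<open>\<sigma>\<close>-algebra, and \<open>measure\<close> vanishes on non-measurable sets; hence the completions, of \<open>P x\<close> and of
  Lebesgue--Borel measure.\<close>

definition spectral_heat_content ::
    "(real^'n \<Rightarrow> 'w measure) \<Rightarrow> (real \<Rightarrow> 'w \<Rightarrow> real^'n) \<Rightarrow> (real^'n) set \<Rightarrow> real \<Rightarrow> real" where
  "spectral_heat_content P X \<Omega> t =
     (LINT x:\<Omega>|lebesgue. measure (completion (P x)) {\<omega> \<in> space (P x). ereal t < exit_time X \<Omega> \<omega>})"

end

theory Submission
  imports Defs
begin

text \<open>
  For a path that starts at the origin and occupies the set \<open>R\<close> of positions up to time \<open>t\<close>, a
  starting point \<open>x \<in> \<Omega>\<close> is lost if \<open>x + y \<notin> \<Omega>\<close> for some \<open>y \<in> R\<close>. Translation invariance and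
  Fubini's theorem turn the heat loss into an expected volume,
  \<open>Vol \<Omega> - Q t = E [Vol (lost \<Omega> R)]\<close> (\<open>heat_loss_eq_expected_lost_volume\<close>). If \<open>R\<close> is contained in a
  small ball of radius \<open>\<rho>\<close> about the origin, then the lost points form a boundary layer whose thickness at a boundary
  point with outer normal \<open>\<nu>\<close> is \<open>sup {y \<bullet> \<nu> | y \<in> R}\<close> up to \<open>o(\<rho>)\<close>; by isotropy the expectation of this
  supremum is that of the running supremum of one coordinate, whatever \<open>\<nu>\<close> is. Integration over the
  boundary gives the perimeter. Large values of \<open>\<rho>\<close> are absorbed by \<open>C * \<rho> powr p\<close>, whose expectation
  is negligible by the assumption on the \<open>p\<close>-th moment.

  Surface measure and Hausdorff measure are avoided. The surface integral of \<open>f (\<nu> \<bullet> v)\<close> is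
  represented by \<open>flux \<Omega> f v\<close>, the integral over \<open>\<Omega>\<close> of the derivative of \<open>f\<close> along \<open>v\<close>, and this
  is the first order term of the integral of \<open>f x * (1\<^sub>\<Omega> x - 1\<^sub>\<Omega> (x + v))\<close>
  (\<open>shift_loss_approx_flux\<close>). The regularity of the boundary enters only through the uniform cone
  condition \<open>outer_cone\<close>: near a boundary point, with outer normal \<open>u\<close> there, a point outside \<open>\<Omega>\<close>
  stays outside if it is moved slightly along a vector whose angle with \<open>u\<close> is below some bound
  close to a right angle. So for \<open>f \<ge> 0\<close> supported there, \<open>flux \<Omega> f\<close> is nonnegative on a cone that is nearly a
  half-space, hence nearly vanishes on vectors orthogonal to \<open>u\<close>, and is compared with \<open>flux \<Omega> f u\<close>
  in all directions.

  Take a smooth partition of unity \<open>\<zeta> i\<close> near the boundary, with a unit vector \<open>u i\<close> for each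
  patch and cone parameter \<open>\<epsilon>\<close> (\<open>boundary_patches\<close>), and let \<open>S\<close> be the sum of the numbers
  \<open>flux \<Omega> (\<zeta> i) (u i)\<close>. Comparing shifts of \<open>\<Omega>\<close> on each patch bounds the difference between
  \<open>Vol (lost \<Omega> R)\<close> and the sum of \<open>(sup {y \<bullet> u i | y \<in> R}) * flux \<Omega> (\<zeta> i) (u i)\<close> by a multiple of
  \<open>\<epsilon> * \<rho>\<close> (\<open>lost_patch_estimate\<close>, \<open>measure_lost_estimate\<close>), so that the quotient in question is
  within a multiple of \<open>\<epsilon>\<close> of \<open>S\<close> in the limit. On the other hand, the sum of the \<open>\<zeta> i *\<^sub>R u i\<close> is an
  admissible test field whose divergence integrates to \<open>S\<close>, and the divergence of any other test
  field integrates to at most \<open>(1 + O(\<epsilon>)) * S\<close>; hence \<open>S\<close> tends to the perimeter as \<open>\<epsilon>\<close> tends to 0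
  (\<open>total_flux_le_perimeter\<close>, \<open>perimeter_le_total_flux\<close>).

  The event that the exit time exceeds \<open>t\<close> involves uncountably many times and need not be measurable.
  It lies between two measurable events that only refer to a countable dense set of times: that the
  path stays in \<open>\<Omega>\<close>, and that it keeps a positive distance from the complement. For a fixed path, the
  starting points at which these differ form a null set, because moving such a point along \<open>u\<close>
  by a small amount pushes the path out of \<open>\<Omega>\<close>, so that infinitely many translates of a set of
  such points are disjoint (\<open>touching_translates_null\<close>). So the two events have the same
  probability for almost every starting point.
\<close>

section \<open>Smooth bump functions\<close>

lemma partial_deriv_has_derivative:
  assumes "(f has_derivative f') (at x)"
  shows "partial_deriv i f x = f' (axis i 1)"
  using frechet_derivative_at[OF assms] by (simp add: partial_deriv_def)

lemma C_diff_const: "C_diff m (\<lambda>x::real^'n. c)"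
proof (induction m arbitrary: c)
  case (Suc m)
  have "partial_deriv i (\<lambda>x::real^'n. c) = (\<lambda>x. 0)" for i
    by (rule ext) (simp add: partial_deriv_def frechet_derivative_const)
  with Suc show ?case by simp
qed simp

lemma C_diff_Suc_D: "C_diff (Suc m) f \<Longrightarrow> C_diff m f"
proof (induction m arbitrary: f)
  case 0
  then show ?case
    by (auto intro!: differentiable_imp_continuous_on simp: differentiable_on_def)
next
  case (Suc m)
  then show ?case by (metis C_diff.simps(2))
qed

lemma C_diff_linear:
  assumes "bounded_linear f"
  shows "C_diff m f"
proof (cases m)
  case 0
  then show ?thesis using assms by (simp add: linear_continuous_on)
next
  case (Suc m')
  have d: "(f has_derivative f) (at x)" for x
    using assms by (rule bounded_linear_imp_has_derivative)
  have "partial_deriv i f = (\<lambda>x. f (axis i 1))" for i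
    by (rule ext) (rule partial_deriv_has_derivative[OF d])
  then show ?thesis using Suc d by (auto simp: C_diff_const differentiable_def)
qed

lemma C_diff_add:
  assumes "C_diff m f" "C_diff m g"
  shows "C_diff m (\<lambda>x. f x + g x)"
  using assms
proof (induction m arbitrary: f g)
  case (Suc m)
  have d: "((\<lambda>x. f x + g x) has_derivative
      (\<lambda>h. frechet_derivative f (at x) h + frechet_derivative g (at x) h)) (at x)" for x
    using Suc.prems by (intro has_derivative_add) (auto simp: frechet_derivative_works)
  have "partial_deriv i (\<lambda>x. f x + g x) = (\<lambda>x. partial_deriv i f x + partial_deriv i g x)" for i
    by (rule ext, subst partial_deriv_has_derivative[OF d]) (simp add: partial_deriv_def)
  moreover have "(\<lambda>x. f x + g x) differentiable (at x)" for x using d by (rule differentiableI)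
  ultimately show ?case using Suc by simp
qed (simp add: continuous_on_add)

lemma C_diff_mult:
  assumes "C_diff m f" "C_diff m g"
  shows "C_diff m (\<lambda>x. f x * g x)"
  using assms
proof (induction m arbitrary: f g)
  case (Suc m)
  have d: "((\<lambda>x. f x * g x) has_derivative
      (\<lambda>h. f x * frechet_derivative g (at x) h + frechet_derivative f (at x) h * g x)) (at x)" for x
    using Suc.prems by (intro has_derivative_mult) (auto simp: frechet_derivative_works)
  have "partial_deriv i (\<lambda>x. f x * g x) =
      (\<lambda>x. f x * partial_deriv i g x + partial_deriv i f x * g x)" for i
    by (rule ext, subst partial_deriv_has_derivative[OF d]) (simp add: partial_deriv_def)
  moreover have "(\<lambda>x. f x * g x) differentiable (at x)" for x using d by (rule differentiableI)
  moreover have "C_diff m f" "C_diff m g" using Suc.prems by (auto intro: C_diff_Suc_D)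
  ultimately show ?case using Suc by (auto intro!: C_diff_add)
qed (simp add: continuous_on_mult)

lemma C_diff_diff:
  assumes "C_diff m f" "C_diff m g"
  shows "C_diff m (\<lambda>x. f x - g x)"
  using C_diff_add[OF assms(1) C_diff_mult[OF C_diff_const[of m "-1"] assms(2)]] by simp

lemma C_diff_sum:
  "(\<And>i. i \<in> I \<Longrightarrow> C_diff m (f i)) \<Longrightarrow> C_diff m (\<lambda>x. \<Sum>i\<in>I. f i x)"
  by (induction I rule: infinite_finite_induct) (auto simp: C_diff_const C_diff_add)

lemma C_diff_prod:
  "(\<And>i. i \<in> I \<Longrightarrow> C_diff m (f i)) \<Longrightarrow> C_diff m (\<lambda>x. \<Prod>i\<in>I. f i x)"
  by (induction I rule: infinite_finite_induct) (auto simp: C_diff_const C_diff_mult)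

text \<open>Composition with a function of one variable, given together with all its derivatives.\<close>

lemma C_diff_compose:
  assumes h: "\<And>n x. (h n has_real_derivative h (Suc n) x) (at x)" and "C_diff m F"
  shows "C_diff m (\<lambda>x. h n (F x))"
  using assms(2)
proof (induction m arbitrary: n)
  case 0
  have "continuous_on UNIV (h n)"
    using h by (meson DERIV_isCont continuous_at_imp_continuous_on)
  with 0 show ?case by (auto intro: continuous_on_compose2)
next
  case (Suc m)
  have d: "((\<lambda>x. h n (F x)) has_derivative
      (\<lambda>v. h (Suc n) (F x) * frechet_derivative F (at x) v)) (at x)" for x
    using has_derivative_compose[of F "frechet_derivative F (at x)" x UNIV "h n" "(*) (h (Suc n) (F x))"]
      Suc.prems h[of n "F x"] by (simp add: frechet_derivative_works has_field_derivative_def)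
  have "partial_deriv i (\<lambda>x. h n (F x)) = (\<lambda>x. h (Suc n) (F x) * partial_deriv i F x)" for i
    by (rule ext, subst partial_deriv_has_derivative[OF d]) (simp add: partial_deriv_def)
  moreover have "(\<lambda>x. h n (F x)) differentiable (at x)" for x using d by (rule differentiableI)
  moreover have "C_diff m F" using Suc.prems by (rule C_diff_Suc_D)
  ultimately show ?case using Suc by (auto intro!: C_diff_mult)
qed

text \<open>The functions \<open>q (1 / x) * exp (- 1 / x)\<close> with a polynomial \<open>q\<close>, extended by 0 to \<open>x \<le> 0\<close>.
  This family is closed under differentiation, which makes its members smooth.\<close>

definition flat :: "real poly \<Rightarrow> real \<Rightarrow> real" where
  "flat q x = (if x > 0 then poly q (1 / x) * exp (- 1 / x) else 0)"

lemma poly_over_exp_tendsto_0: "((\<lambda>y::real. poly q y / exp y) \<longlongrightarrow> 0) at_top"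
proof -
  have "((\<lambda>y::real. \<Sum>i\<le>degree q. coeff q i * (y ^ i / exp y)) \<longlongrightarrow> (\<Sum>i\<le>degree q. coeff q i * 0)) at_top"
    by (intro tendsto_intros tendsto_power_div_exp_0)
  then show ?thesis by (simp add: poly_altdef sum_divide_distrib)
qed

lemma flat_has_derivative:
  "(flat q has_real_derivative flat ([:0, 0, 1:] * (q - pderiv q)) x) (at x)"
proof (cases x "0 :: real" rule: linorder_cases)
  case less
  have "\<forall>\<^sub>F y in nhds x. y < 0" using less by (rule eventually_nhds_in_open[OF open_lessThan, simplified])
  then have "\<forall>\<^sub>F y in nhds x. flat q y = 0" by eventually_elim (simp add: flat_def)
  then have "(flat q has_real_derivative 0) (at x)"
    using DERIV_cong_ev[of x x "flat q" "\<lambda>_. 0" 0 0] by simp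
  then show ?thesis using less by (simp add: flat_def)
next
  case equal
  \<comment> \<open>with \<open>y = 1 / h\<close>, the difference quotient \<open>flat q h / h\<close> equals \<open>y * q y / exp y\<close>\<close>
  have "((\<lambda>y. poly ([:0, 1:] * q) y / exp y) \<longlongrightarrow> 0) at_top" by (rule poly_over_exp_tendsto_0)
  then have "((\<lambda>h. poly ([:0, 1:] * q) (inverse h) / exp (inverse h)) \<longlongrightarrow> 0) (at_right 0)"
    by (rule filterlim_compose[OF _ filterlim_inverse_at_top_right])
  moreover have "\<forall>\<^sub>F h in at_right 0. poly ([:0, 1:] * q) (inverse h) / exp (inverse h) = flat q h / h"
    unfolding eventually_at_right_field
    by (rule exI[of _ 1]) (auto simp: flat_def exp_minus field_simps)
  ultimately have r: "((\<lambda>h. flat q h / h) \<longlongrightarrow> 0) (at_right 0)"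
    by (rule Lim_transform_eventually)
  have "\<forall>\<^sub>F h in at_left 0. (0::real) = flat q h / h"
    unfolding eventually_at_left_field by (rule exI[of _ "-1"]) (auto simp: flat_def)
  then have "((\<lambda>h. flat q h / h) \<longlongrightarrow> 0) (at_left 0)"
    by (rule Lim_transform_eventually[OF tendsto_const])
  with r have "((\<lambda>h. flat q h / h) \<longlongrightarrow> 0) (at 0)" by (simp add: filterlim_split_at)
  then show ?thesis unfolding equal by (simp add: DERIV_def flat_def)
next
  case greater
  have "((\<lambda>y. poly q (1 / y) * exp (- 1 / y)) has_real_derivative
      flat ([:0, 0, 1:] * (q - pderiv q)) x) (at x)"
    using greater
    by (auto intro!: derivative_eq_intros DERIV_chain2[OF poly_DERIV] simp: flat_def field_simps power2_eq_square)
  moreover have "\<forall>\<^sub>F y in nhds x. y > 0"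
    using greater by (rule eventually_nhds_in_open[OF open_greaterThan, simplified])
  then have "\<forall>\<^sub>F y in nhds x. flat q y = poly q (1 / y) * exp (- 1 / y)"
    by eventually_elim (simp add: flat_def)
  ultimately show ?thesis by (subst DERIV_cong_ev[OF refl _ refl])
qed

lemma C_diff_flat:
  assumes "C_diff m F"
  shows "C_diff m (\<lambda>x. flat q (F x))"
proof -
  define h where "h n = flat (((\<lambda>q. [:0, 0, 1:] * (q - pderiv q)) ^^ n) q)" for n
  have "(h n has_real_derivative h (Suc n) x) (at x)" for n x
    using flat_has_derivative by (simp add: h_def)
  from C_diff_compose[of h, OF this assms, of 0] show ?thesis by (simp add: h_def)
qed

lemma flat_1_mono: "x \<le> y \<Longrightarrow> flat 1 x \<le> flat 1 y"
  by (auto simp: flat_def divide_simps)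

lemma C_diff_power2_dist: "C_diff m (\<lambda>x. (dist x z)\<^sup>2)"
proof -
  have "(\<lambda>x. (dist x z)\<^sup>2) = (\<lambda>x. \<Sum>i\<in>UNIV. (x $ i - z $ i) * (x $ i - z $ i))"
    by (rule ext) (simp add: dist_norm norm_vec_def L2_set_def sum_nonneg power2_eq_square)
  then show ?thesis
    by (simp only:) (intro C_diff_sum C_diff_mult C_diff_diff C_diff_const C_diff_linear
        bounded_linear_vec_nth)
qed

text \<open>A plateau is obtained by composing \<open>flat 1\<close> with itself: with \<open>s\<close> the squared distance and
  \<open>c = flat 1 (b - a)\<close>, the function \<open>flat 1 (c - flat 1 (b - s))\<close> vanishes for \<open>s \<le> a\<close> and is
  constant for \<open>s \<ge> b\<close>.\<close>

lemma smooth_bump_exists: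
  fixes z :: "real^'n"
  assumes "r > 0"
  shows "\<exists>b. (\<forall>m. C_diff m b) \<and> (\<forall>x. 0 \<le> b x \<and> b x \<le> 1) \<and>
    (\<forall>x. dist x z \<le> r / 4 \<longrightarrow> b x = 1) \<and> (\<forall>x. r / 2 \<le> dist x z \<longrightarrow> b x = 0)"
proof -
  define c where "c = flat 1 ((r / 2)\<^sup>2 - (r / 4)\<^sup>2)"
  define b :: "real^'n \<Rightarrow> real"
    where "b x = 1 - flat 1 (c - flat 1 ((r / 2)\<^sup>2 - (dist x z)\<^sup>2)) * inverse (flat 1 c)" for x
  have nonneg: "0 \<le> flat 1 x" for x by (simp add: flat_def)
  have "(r / 4)\<^sup>2 < (r / 2)\<^sup>2" using assms by (intro power_strict_mono) auto
  then have c: "c > 0" by (simp add: c_def flat_def)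
  then have fc: "flat 1 c > 0" by (simp add: flat_def)
  have "flat 1 (c - flat 1 ((r / 2)\<^sup>2 - (dist x z)\<^sup>2)) \<le> flat 1 c" for x
    using nonneg by (intro flat_1_mono) auto
  then have "0 \<le> b x \<and> b x \<le> 1" for x
    using fc nonneg by (auto simp: b_def field_simps)
  moreover have "C_diff m b" for m
    unfolding b_def
    by (intro C_diff_diff C_diff_const C_diff_mult C_diff_flat C_diff_power2_dist)
  moreover have "b x = 1" if "dist x z \<le> r / 4" for x
  proof -
    have "c \<le> flat 1 ((r / 2)\<^sup>2 - (dist x z)\<^sup>2)"
      unfolding c_def using that by (intro flat_1_mono) (auto intro!: power_mono)
    then show ?thesis by (simp add: b_def flat_def)
  qed
  moreover have "b x = 0" if "r / 2 \<le> dist x z" for x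
  proof -
    have "(r / 2)\<^sup>2 \<le> (dist x z)\<^sup>2" using that assms by (intro power_mono) auto
    then have "flat 1 ((r / 2)\<^sup>2 - (dist x z)\<^sup>2) = 0" by (simp add: flat_def)
    then show ?thesis using fc by (simp add: b_def)
  qed
  ultimately show ?thesis by blast
qed

section \<open>The flux through the boundary\<close>

lemma C1_has_derivative:
  assumes "C_diff 1 f"
  shows "(f has_derivative (\<lambda>v. gradient f x \<bullet> v)) (at x)"
proof -
  have d: "(f has_derivative frechet_derivative f (at x)) (at x)"
    using assms by (simp add: frechet_derivative_works)
  have "frechet_derivative f (at x) v = gradient f x \<bullet> v" for v
  proof -
    interpret bounded_linear "frechet_derivative f (at x)" using d by (rule has_derivative_bounded_linear)
    have "frechet_derivative f (at x) v = frechet_derivative f (at x) (\<Sum>i\<in>UNIV. (v $ i) *\<^sub>R axis i 1)"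
      using basis_expansion[of v] by (simp add: scalar_mult_eq_scaleR)
    also have "\<dots> = gradient f x \<bullet> v"
      by (simp add: sum scaleR inner_vec_def gradient_def partial_deriv_def mult.commute)
    finally show ?thesis .
  qed
  then have "frechet_derivative f (at x) = (\<lambda>v. gradient f x \<bullet> v)" by (rule ext)
  with d show ?thesis by simp
qed

lemma gradient_unique:
  assumes "(f has_derivative (\<lambda>v. g \<bullet> v)) (at x)"
  shows "gradient f x = g"
  by (simp add: gradient_def vec_eq_iff partial_deriv_has_derivative[OF assms] inner_axis)

lemma continuous_gradient: "C_diff 1 f \<Longrightarrow> continuous_on S (gradient f)"
  unfolding gradient_def
  by (intro continuous_on_vec_lambda) (auto intro: continuous_on_subset)

lemma C1_continuous: "C_diff 1 f \<Longrightarrow> continuous_on S f"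
  using C_diff_Suc_D[of 0 f] by (auto intro: continuous_on_subset)

lemma C1_mean_value:
  assumes f: "C_diff 1 f"
  obtains y where "y \<in> closed_segment a b" "f b - f a = gradient f y \<bullet> (b - a)"
proof -
  have dg: "((\<lambda>s. f (a + s *\<^sub>R (b - a))) has_derivative
      (\<lambda>h. gradient f (a + s *\<^sub>R (b - a)) \<bullet> (h *\<^sub>R (b - a)))) (at s within {0..1})" for s :: real
    by (rule has_derivative_compose[OF _ C1_has_derivative[OF f]])
      (auto intro!: derivative_eq_intros)
  then obtain s where s: "s \<in> {0<..<1::real}"
    and "f b - f a = gradient f (a + s *\<^sub>R (b - a)) \<bullet> (b - a)"
    using mvt_simple[of 0 1, OF _ dg] by force
  moreover have "a + s *\<^sub>R (b - a) \<in> closed_segment a b"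
    using s by (auto simp: in_segment algebra_simps intro!: exI[of _ s])
  ultimately show ?thesis using that by blast
qed

lemma integrable_on_bounded_open:
  fixes g :: "'a::euclidean_space \<Rightarrow> real"
  assumes "open \<Omega>" "bounded \<Omega>" "continuous_on UNIV g"
  shows "set_integrable lborel \<Omega> g"
proof -
  have "set_integrable lborel (closure \<Omega>) g"
    unfolding set_integrable_def using assms
    by (intro borel_integrable_compact) (auto simp: compact_closure intro: continuous_on_subset)
  then show ?thesis
    using assms by (rule_tac set_integrable_subset) (auto intro: closure_subset[THEN subsetD])
qed

text \<open>The integral over \<open>\<Omega>\<close> of the derivative of \<open>f\<close> along \<open>v\<close>. By the divergence theorem, this is
  the integral over the boundary of \<open>f\<close> times the component of the outer normal along \<open>v\<close>.\<close>

definition flux :: "(real^'n) set \<Rightarrow> (real^'n \<Rightarrow> real) \<Rightarrow> real^'n \<Rightarrow> real" where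
  "flux \<Omega> f v = (LINT x:\<Omega>|lborel. gradient f x \<bullet> v)"

text \<open>The mass, with density \<open>f\<close>, of the points of \<open>\<Omega>\<close> that leave \<open>\<Omega>\<close> under the shift by \<open>v\<close>, minus
  the mass of those that enter it.\<close>

definition shift_loss :: "(real^'n) set \<Rightarrow> (real^'n \<Rightarrow> real) \<Rightarrow> real^'n \<Rightarrow> real" where
  "shift_loss \<Omega> f v = (LINT x|lborel. f x * (indicator \<Omega> x - indicator \<Omega> (x + v)))"

context
  fixes \<Omega> :: "(real^'n) set"
  assumes op: "open \<Omega>" and bd: "bounded \<Omega>"
begin

lemma integrable_directional_deriv:
  "C_diff 1 f \<Longrightarrow> set_integrable lborel \<Omega> (\<lambda>x. gradient f x \<bullet> v)"
  by (intro integrable_on_bounded_open op bd continuous_intros continuous_gradient)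

lemma flux_add: "C_diff 1 f \<Longrightarrow> flux \<Omega> f (v + w) = flux \<Omega> f v + flux \<Omega> f w"
  unfolding flux_def by (simp add: inner_add_right integrable_directional_deriv set_integral_add)

lemma flux_scaleR: "flux \<Omega> f (c *\<^sub>R v) = c * flux \<Omega> f v"
  unfolding flux_def by simp

lemma flux_fun_add:
  assumes "C_diff 1 f" "C_diff 1 g"
  shows "flux \<Omega> (\<lambda>x. f x + g x) v = flux \<Omega> f v + flux \<Omega> g v"
proof -
  have "gradient (\<lambda>x. f x + g x) x = gradient f x + gradient g x" for x
    using has_derivative_add[OF C1_has_derivative[OF assms(1)] C1_has_derivative[OF assms(2)], of x]
    by (intro gradient_unique) (simp add: inner_add_left)
  then show ?thesis
    unfolding flux_def using assms
    by (simp add: inner_add_left integrable_directional_deriv set_integral_add)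
qed

lemma flux_fun_cmult:
  assumes "C_diff 1 f"
  shows "flux \<Omega> (\<lambda>x. c * f x) v = c * flux \<Omega> f v"
proof -
  have "gradient (\<lambda>x. c * f x) x = c *\<^sub>R gradient f x" for x
    using has_derivative_mult_right[OF C1_has_derivative[OF assms(1)], of c x]
    by (intro gradient_unique) simp
  then show ?thesis unfolding flux_def by simp
qed

lemma flux_fun_diff:
  assumes "C_diff 1 f" "C_diff 1 g"
  shows "flux \<Omega> (\<lambda>x. f x - g x) v = flux \<Omega> f v - flux \<Omega> g v"
  using flux_fun_add[OF assms(1) C_diff_mult[OF C_diff_const[of 1 "-1"] assms(2)], of v]
    flux_fun_cmult[OF assms(2), of "-1" v] by simp

lemma flux_fun_sum:
  assumes "finite I" "\<And>i. i \<in> I \<Longrightarrow> C_diff 1 (f i)"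
  shows "flux \<Omega> (\<lambda>x. \<Sum>i\<in>I. f i x) v = (\<Sum>i\<in>I. flux \<Omega> (f i) v)"
  using assms
proof (induction I)
  case empty
  show ?case using flux_fun_cmult[OF C_diff_const[of 1 0], of 0 v] by simp
next
  case (insert i I)
  then show ?case by (simp add: flux_fun_add C_diff_sum del: One_nat_def)
qed

lemma flux_sum:
  assumes "finite I" "C_diff 1 f"
  shows "flux \<Omega> f (\<Sum>i\<in>I. v i) = (\<Sum>i\<in>I. flux \<Omega> f (v i))"
  using assms
proof (induction I)
  case empty
  show ?case using flux_scaleR[of f 0 0] by simp
qed (simp add: flux_add)

lemma set_integral_shift_diff:
  fixes f :: "real^'n \<Rightarrow> real"
  assumes f: "continuous_on UNIV f"
  shows "(LINT x:\<Omega>|lborel. f x - f (x - v)) = shift_loss \<Omega> f v"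
    and "integrable lborel (\<lambda>x. f x * (indicator \<Omega> x - indicator \<Omega> (x + v)))"
proof -
  have i1: "set_integrable lborel \<Omega> f"
    using op bd f by (rule integrable_on_bounded_open)
  have i2: "set_integrable lborel \<Omega> (\<lambda>x. f (x - v))"
    using op bd f by (intro integrable_on_bounded_open continuous_on_compose2[OF f] continuous_intros) auto
  have d: "lborel = distr lborel borel ((+) v)" by (simp add: lborel_distr_plus)
  have m: "(\<lambda>x. indicator \<Omega> x *\<^sub>R f (x - v)) \<in> borel_measurable borel"
    using op by (intro borel_measurable_scaleR borel_measurable_indicator
      borel_measurable_continuous_onI continuous_on_compose2[OF f] continuous_intros) auto
  have i2': "integrable lborel (\<lambda>x. f x * indicator \<Omega> (x + v))"
  proof -
    have "integrable (distr lborel borel ((+) v)) (\<lambda>x. indicator \<Omega> x *\<^sub>R f (x - v))"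
      using i2 by (simp add: set_integrable_def lborel_distr_plus)
    from integrable_distr[OF _ this] show ?thesis by (simp add: add.commute mult.commute)
  qed
  have "(LINT x:\<Omega>|lborel. f (x - v)) = (LINT x|lborel. f x * indicator \<Omega> (x + v))"
    unfolding set_lebesgue_integral_def
    using m by (subst d, subst integral_distr) (auto simp: add.commute mult.commute)
  then show "(LINT x:\<Omega>|lborel. f x - f (x - v)) = shift_loss \<Omega> f v"
    using i1 i2 i2'
    by (simp add: set_integral_diff shift_loss_def right_diff_distrib set_integrable_def
        set_lebesgue_integral_def mult.commute Bochner_Integration.integral_diff)
  show "integrable lborel (\<lambda>x. f x * (indicator \<Omega> x - indicator \<Omega> (x + v)))"
    using i1 i2' by (simp add: right_diff_distrib set_integrable_def mult.commute)
qed

text \<open>The flux is the derivative of \<open>shift_loss\<close> at 0, uniformly in the direction.\<close>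

lemma shift_loss_approx_flux:
  assumes f: "C_diff 1 f" and eta: "\<eta> > 0"
  shows "\<exists>\<delta>>0. \<forall>v. norm v \<le> \<delta> \<longrightarrow> \<bar>shift_loss \<Omega> f v - flux \<Omega> f v\<bar> \<le> \<eta> * norm v"
proof -
  define m where "m = measure lborel \<Omega>"
  define e where "e = \<eta> / (m + 1)"
  have m0: "m \<ge> 0" by (simp add: m_def)
  have e0: "e > 0" using eta m0 by (simp add: e_def)
  have em: "e * m \<le> \<eta>" using eta m0 by (simp add: e_def field_simps)
  obtain a where a: "\<Omega> \<subseteq> ball 0 a" using bd by (meson bounded_subset_ballD)
  have "uniformly_continuous_on (cball 0 (a + 1)) (gradient f)"
    using f by (intro compact_uniformly_continuous continuous_gradient) auto
  then obtain d where d: "d > 0" and du: "\<And>x y. x \<in> cball 0 (a + 1) \<Longrightarrow> y \<in> cball 0 (a + 1) \<Longrightarrow>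
      dist y x < d \<Longrightarrow> dist (gradient f y) (gradient f x) < e"
    using e0 unfolding uniformly_continuous_on_def by metis
  define \<delta> where "\<delta> = min 1 (d / 2)"
  have "\<bar>shift_loss \<Omega> f v - flux \<Omega> f v\<bar> \<le> \<eta> * norm v" if v: "norm v \<le> \<delta>" for v
  proof -
    have pt: "\<bar>(f x - f (x - v)) - gradient f x \<bullet> v\<bar> \<le> e * norm v" if x: "x \<in> \<Omega>" for x
    proof -
      obtain y where y: "y \<in> closed_segment (x - v) x" and "f x - f (x - v) = gradient f y \<bullet> (x - (x - v))"
        using C1_mean_value[OF f] by blast
      then have e1: "f x - f (x - v) = gradient f y \<bullet> v" by simp
      have yx: "norm (y - x) \<le> norm v"
        using segment_bound(2)[OF y] by (simp add: norm_minus_commute)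
      have "norm x < a" using a x by auto
      moreover have "norm y \<le> norm x + norm (y - x)" by (metis add.commute diff_add_cancel norm_triangle_ineq)
      ultimately have "dist (gradient f y) (gradient f x) < e"
        using yx v d by (intro du) (auto simp: dist_norm \<delta>_def)
      then have "\<bar>(gradient f y - gradient f x) \<bullet> v\<bar> \<le> e * norm v"
        by (intro order_trans[OF Cauchy_Schwarz_ineq2] mult_right_mono) (auto simp: dist_norm)
      then show ?thesis by (simp add: e1 inner_diff_left)
    qed
    have ct: "continuous_on UNIV (\<lambda>x. f x - f (x - v))"
      using C1_continuous[OF f] by (intro continuous_intros continuous_on_compose2[OF C1_continuous[OF f, of UNIV]]) auto
    have ig: "set_integrable lborel \<Omega> (\<lambda>x. f x - f (x - v))"
      using op bd ct by (rule integrable_on_bounded_open)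
    have ic: "set_integrable lborel \<Omega> (\<lambda>x. e * norm v)"
      using op bd by (rule integrable_on_bounded_open) auto
    note id = integrable_directional_deriv[OF f, of v]
    have "\<bar>shift_loss \<Omega> f v - flux \<Omega> f v\<bar> =
        \<bar>LINT x:\<Omega>|lborel. (f x - f (x - v)) - gradient f x \<bullet> v\<bar>"
      using ig id set_integral_shift_diff(1)[OF C1_continuous[OF f], of v]
      by (simp add: flux_def)
    also have "\<dots> \<le> (LINT x:\<Omega>|lborel. \<bar>(f x - f (x - v)) - gradient f x \<bullet> v\<bar>)"
      unfolding set_lebesgue_integral_def
      by (rule order_trans[OF integral_abs_bound]) (auto simp: abs_mult)
    also have "\<dots> \<le> (LINT x:\<Omega>|lborel. e * norm v)"
      using pt by (intro set_integral_mono set_integrable_abs set_integral_diff(1) ig id ic) auto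
    also have "\<dots> = e * m * norm v"
      using op by (simp add: m_def set_lebesgue_integral_def)
    also have "\<dots> \<le> \<eta> * norm v" using em by (intro mult_right_mono) auto
    finally show ?thesis .
  qed
  then show ?thesis using d by (intro exI[of _ \<delta>]) (auto simp: \<delta>_def)
qed

lemma flux_nonneg_if_shift_loss_nonneg:
  assumes f: "C_diff 1 f" and r: "r > 0"
    and nonneg: "\<And>s. 0 < s \<Longrightarrow> norm (s *\<^sub>R v) < r \<Longrightarrow> shift_loss \<Omega> f (s *\<^sub>R v) \<ge> 0"
  shows "flux \<Omega> f v \<ge> 0"
proof (rule ccontr)
  assume neg: "\<not> flux \<Omega> f v \<ge> 0"
  then have v: "v \<noteq> 0" using flux_scaleR[of f 0 0] by auto
  define \<eta> where "\<eta> = - flux \<Omega> f v / (2 * norm v)"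
  have "\<eta> > 0" using neg v by (simp add: \<eta>_def divide_neg_pos)
  from shift_loss_approx_flux[OF f this] obtain \<delta> where \<delta>: "\<delta> > 0"
    and b: "\<And>v. norm v \<le> \<delta> \<Longrightarrow> \<bar>shift_loss \<Omega> f v - flux \<Omega> f v\<bar> \<le> \<eta> * norm v" by blast
  define s where "s = min \<delta> (r / 2) / norm v"
  have s: "s > 0" using \<delta> r v by (simp add: s_def)
  have ns: "norm (s *\<^sub>R v) = min \<delta> (r / 2)" using v \<delta> r by (simp add: s_def)
  have "shift_loss \<Omega> f (s *\<^sub>R v) \<ge> 0" using s ns r by (intro nonneg) auto
  moreover have "\<bar>shift_loss \<Omega> f (s *\<^sub>R v) - s * flux \<Omega> f v\<bar> \<le> \<eta> * norm (s *\<^sub>R v)"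
    using b[of "s *\<^sub>R v"] ns by (simp add: flux_scaleR)
  moreover have "\<eta> * norm (s *\<^sub>R v) = - s * flux \<Omega> f v / 2"
    using v s by (simp add: \<eta>_def)
  moreover have "s * flux \<Omega> f v < 0" using s neg by (simp add: mult_pos_neg)
  ultimately show False by linarith
qed

end

section \<open>Domains with the cone property\<close>

text \<open>On \<open>ball z r\<close>, the complement of \<open>\<Omega>\<close> is preserved by the vectors whose component along the unit
  vector \<open>u\<close> is at least \<open>\<epsilon>\<close> times their norm. For small \<open>\<epsilon>\<close> this cone is nearly a half-space, and
  \<open>u\<close> is an approximate outer normal.\<close>

definition outer_cone :: "(real^'n) set \<Rightarrow> real \<Rightarrow> real^'n \<Rightarrow> real \<Rightarrow> real^'n \<Rightarrow> bool" where
  "outer_cone \<Omega> \<epsilon> z r u \<longleftrightarrow> 0 < r \<and> norm u = 1 \<and>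
     (\<forall>x v. x \<in> ball z r \<longrightarrow> x + v \<in> ball z r \<longrightarrow> \<epsilon> * norm v \<le> v \<bullet> u \<longrightarrow> x \<notin> \<Omega> \<longrightarrow> x + v \<notin> \<Omega>)"

lemma outer_coneD:
  "outer_cone \<Omega> \<epsilon> z r u \<Longrightarrow> x \<in> ball z r \<Longrightarrow> x + v \<in> ball z r \<Longrightarrow> \<epsilon> * norm v \<le> v \<bullet> u \<Longrightarrow>
    x \<notin> \<Omega> \<Longrightarrow> x + v \<notin> \<Omega>"
  unfolding outer_cone_def by blast

lemma gradient_independent_of_coord:
  assumes f: "C_diff 1 f" and i: "independent_of_coord k f"
  shows "gradient f x \<bullet> axis k 1 = 0"
proof -
  have "((\<lambda>s. f (x + s *\<^sub>R axis k 1)) has_derivative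
      (\<lambda>h. gradient f (x + 0 *\<^sub>R axis k 1) \<bullet> (h *\<^sub>R axis k 1))) (at (0::real))"
    by (rule has_derivative_compose[OF _ C1_has_derivative[OF f]])
      (auto intro!: derivative_eq_intros)
  moreover have "((\<lambda>s. f (x + s *\<^sub>R axis k 1)) has_derivative (\<lambda>h. 0)) (at (0::real))"
    using i by (simp add: independent_of_coord_def)
  ultimately have "(\<lambda>h::real. gradient f (x + 0 *\<^sub>R axis k 1) \<bullet> (h *\<^sub>R axis k 1)) = (\<lambda>h. 0)"
    by (rule has_derivative_unique)
  from fun_cong[OF this, of 1] show ?thesis by simp
qed

lemma outer_cone_exists:
  fixes \<Omega> :: "(real^'n) set"
  assumes bdry: "C1_holder_boundary \<kappa> \<Omega>" and z: "z \<in> frontier \<Omega>" and eps: "\<epsilon> > 0"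
  shows "\<exists>r u. outer_cone \<Omega> \<epsilon> z r u"
proof -
  obtain V U k \<gamma> where V: "open V" "z \<in> V" and U: "orthogonal_matrix U"
    and g: "C_diff 1 \<gamma>" and ind: "independent_of_coord k \<gamma>"
    and loc: "\<Omega> \<inter> V = {z. \<gamma> (U *v z) < (U *v z) $ k} \<inter> V"
    using bdry z unfolding C1_holder_boundary_def C1_holder_def by meson
  have nU: "norm (U *v x) = norm x" for x
    using U by (simp add: orthogonal_transformation_matrix orthogonal_transformation_norm)
  \<comment> \<open>\<open>\<Omega>\<close> is locally the set where \<open>g y = \<gamma> (U *v y) - (U *v y) $ k\<close> is negative, and \<open>N\<close> is the
    gradient of \<open>g\<close> at \<open>z\<close>. It does not vanish, since the component of \<open>a\<close> along \<open>axis k 1\<close> is -1.\<close>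
  define a where "a = gradient \<gamma> (U *v z) - axis k 1"
  define N where "N = a v* U"
  have N: "N \<bullet> v = a \<bullet> (U *v v)" for v by (simp add: N_def dot_lmul_matrix)
  have "a \<bullet> axis k 1 = -1"
    using gradient_independent_of_coord[OF g ind] by (simp add: a_def inner_diff_left)
  then have "1 \<le> norm a"
    using Cauchy_Schwarz_ineq2[of a "axis k 1"] by simp
  moreover have "norm N = norm a"
    using U norm_eq_sqrt_inner orthogonal_transformation_norm[of "(*v) (transpose U)" a]
    by (simp add: N_def orthogonal_transformation_matrix flip: transpose_matrix_vector)
  ultimately have N1: "norm N \<ge> 1" by simp
  then have N0: "norm N \<noteq> 0" by linarith
  have "continuous_on UNIV (gradient \<gamma>)" using g by (rule continuous_gradient)
  then have "isCont (gradient \<gamma>) (U *v z)" by (simp add: continuous_on_eq_continuous_at)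
  then obtain d where d: "d > 0" "\<And>y. dist y (U *v z) < d \<Longrightarrow> dist (gradient \<gamma> y) (gradient \<gamma> (U *v z)) < \<epsilon>"
    using eps unfolding continuous_at_eps_delta by metis
  obtain e where e: "e > 0" "ball z e \<subseteq> V" using V open_contains_ball by blast
  define r where "r = min d e"
  define u where "u = N /\<^sub>R norm N"
  have "x + v \<notin> \<Omega>" if x: "x \<in> ball z r" "x + v \<in> ball z r" and c: "\<epsilon> * norm v \<le> v \<bullet> u" and xO: "x \<notin> \<Omega>" for x v
  proof -
    have xV: "x \<in> V" "x + v \<in> V" using x e by (auto simp: r_def)
    obtain y where y: "y \<in> closed_segment (U *v x) (U *v (x + v))"
      and mv: "\<gamma> (U *v (x + v)) - \<gamma> (U *v x) = gradient \<gamma> y \<bullet> (U *v (x + v) - U *v x)"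
      using C1_mean_value[OF g] by blast
    have "U *v x \<in> ball (U *v z) d" "U *v (x + v) \<in> ball (U *v z) d"
      using x nU[of "z - x"] nU[of "z - (x + v)"]
      by (auto simp: dist_norm r_def simp flip: matrix_vector_mult_diff_distrib)
    then have "y \<in> ball (U *v z) d" using y closed_segment_subset[of _ "ball (U *v z) d"] by blast
    then have "norm (gradient \<gamma> y - gradient \<gamma> (U *v z)) \<le> \<epsilon>"
      using d(2)[of y] by (simp add: dist_norm norm_minus_commute)
    then have "\<bar>(gradient \<gamma> y - gradient \<gamma> (U *v z)) \<bullet> (U *v v)\<bar> \<le> \<epsilon> * norm v"
      by (intro order_trans[OF Cauchy_Schwarz_ineq2]) (simp add: nU mult_right_mono)
    moreover have "\<epsilon> * norm v \<le> N \<bullet> v"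
    proof -
      have "\<epsilon> * norm v \<le> norm N * (\<epsilon> * norm v)"
        using N1 eps mult_right_mono[of 1 "norm N" "\<epsilon> * norm v"] by simp
      also have "\<dots> \<le> norm N * (v \<bullet> u)" using c by (intro mult_left_mono) auto
      also have "\<dots> = N \<bullet> v"
        unfolding u_def inner_scaleR_right using N0 by (simp add: inner_commute[of v N])
      finally show ?thesis .
    qed
    moreover have "\<gamma> (U *v (x + v)) - \<gamma> (U *v x) - (U *v v) $ k =
        (gradient \<gamma> y - gradient \<gamma> (U *v z)) \<bullet> (U *v v) + N \<bullet> v"
      unfolding mv N a_def by (simp add: matrix_vector_right_distrib inner_diff_left inner_axis')
    moreover have "x \<notin> {z. \<gamma> (U *v z) < (U *v z) $ k} \<inter> V"
      unfolding loc[symmetric] using xO by blast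
    then have "\<gamma> (U *v x) \<ge> (U *v x) $ k" using xV(1) by (simp add: not_less)
    ultimately have "\<gamma> (U *v (x + v)) \<ge> (U *v (x + v)) $ k"
      by (simp add: matrix_vector_right_distrib)
    then have "x + v \<notin> {z. \<gamma> (U *v z) < (U *v z) $ k} \<inter> V" by (simp add: not_less)
    then show ?thesis using xV(2) unfolding loc[symmetric] by blast
  qed
  moreover have "norm u = 1" using N0 by (simp add: u_def)
  ultimately have "outer_cone \<Omega> \<epsilon> z r u" using d e by (simp add: outer_cone_def r_def)
  then show ?thesis by blast
qed

lemma exit_near_frontier:
  fixes x :: "'a::real_normed_vector"
  assumes "x \<in> \<Omega>" "x + v \<notin> \<Omega>"
  obtains y where "y \<in> frontier \<Omega>" "dist x y \<le> norm v"
proof -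
  have "closed_segment x (x + v) \<inter> frontier \<Omega> \<noteq> {}"
    using assms by (intro connected_Int_frontier) auto
  then obtain y where "y \<in> closed_segment x (x + v)" "y \<in> frontier \<Omega>" by blast
  with that segment_bound(1)[of y x "x + v"] show ?thesis by (auto simp: dist_norm norm_minus_commute)
qed

text \<open>The points of \<open>\<Omega>\<close> that some element of \<open>R\<close> moves out of \<open>\<Omega>\<close>.\<close>

definition lost :: "'a set \<Rightarrow> 'a set \<Rightarrow> ('a::real_normed_vector) set" where
  "lost \<Omega> R = {x \<in> \<Omega>. \<exists>y\<in>R. x + y \<notin> \<Omega>}"

lemma lost_borel:
  fixes \<Omega> :: "('a::euclidean_space) set"
  assumes "open \<Omega>" "countable R"
  shows "lost \<Omega> R \<in> sets borel"
proof -
  have "open ((\<lambda>x. x + y) -` \<Omega>)" for y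
    using assms by (intro open_vimage continuous_intros)
  then have "open {x. x + y \<in> \<Omega>}" for y by (simp add: vimage_def)
  moreover have "lost \<Omega> R = \<Omega> \<inter> (\<Union>y\<in>R. - {x. x + y \<in> \<Omega>})" by (auto simp: lost_def)
  ultimately show ?thesis using assms by (auto intro!: sets.Int sets.countable_UN')
qed

context
  fixes \<Omega> :: "(real^'n) set"
  assumes op: "open \<Omega>" and bd: "bounded \<Omega>"
begin

lemma flux_zero_near_frontier:
  assumes f: "C_diff 1 f" and d: "\<delta> > 0" and z: "\<And>x y. y \<in> frontier \<Omega> \<Longrightarrow> dist x y < \<delta> \<Longrightarrow> f x = 0"
  shows "flux \<Omega> f v = 0"
proof -
  have z0: "shift_loss \<Omega> f v = 0" if v: "norm v < \<delta>" for v
  proof -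
    have "f x * (indicator \<Omega> x - indicator \<Omega> (x + v)) = 0" for x
    proof (cases "f x = 0")
      case False
      have "x \<in> \<Omega> \<longleftrightarrow> x + v \<in> \<Omega>"
      proof (rule ccontr)
        assume "\<not> (x \<in> \<Omega> \<longleftrightarrow> x + v \<in> \<Omega>)"
        then consider "x \<in> \<Omega>" "x + v \<notin> \<Omega>" | "x \<in> - \<Omega>" "x + v \<notin> - \<Omega>" by blast
        then obtain y where "y \<in> frontier \<Omega>" "dist x y \<le> norm v"
          by cases (metis exit_near_frontier frontier_complement)+
        with z[of y x] v False show False by simp
      qed
      then show ?thesis by (auto simp: indicator_def)
    qed simp
    then show ?thesis unfolding shift_loss_def by (simp only: Bochner_Integration.integral_zero)
  qed
  have "flux \<Omega> f w \<ge> 0" for w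
    using z0 by (intro flux_nonneg_if_shift_loss_nonneg[OF op bd f d]) auto
  from this[of v] this[of "- v"] show ?thesis
    using flux_scaleR[OF op bd, of f "-1" v] by simp
qed

lemma shift_loss_nonneg:
  assumes "outer_cone \<Omega> \<epsilon> z r u" "\<And>x. 0 \<le> f x" "\<And>x. f x \<noteq> 0 \<Longrightarrow> x \<in> ball z (r / 2)"
    and "norm v < r / 2" "\<epsilon> * norm v \<le> v \<bullet> u"
  shows "shift_loss \<Omega> f v \<ge> 0"
  unfolding shift_loss_def
proof (rule Bochner_Integration.integral_nonneg)
  fix x
  show "0 \<le> f x * (indicator \<Omega> x - indicator \<Omega> (x + v))"
  proof (cases "f x = 0")
    case False
    then have x: "dist z x < r / 2" using assms(3) by auto
    have xr: "dist z x < r" using x zero_le_dist[of z x] by linarith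
    have "dist z (x + v) \<le> dist z x + norm v"
      by (metis add.commute add_diff_cancel_left' dist_norm dist_triangle norm_minus_commute)
    then have "x \<notin> \<Omega> \<Longrightarrow> x + v \<notin> \<Omega>"
      using assms x xr by (intro outer_coneD[OF assms(1)]) auto
    then show ?thesis using assms(2)[of x] by (auto simp: indicator_def)
  qed simp
qed

lemma flux_cone_nonneg:
  assumes "outer_cone \<Omega> \<epsilon> z r u" "C_diff 1 f" "\<And>x. 0 \<le> f x" "\<And>x. f x \<noteq> 0 \<Longrightarrow> x \<in> ball z (r / 2)"
    and "\<epsilon> * norm v \<le> v \<bullet> u"
  shows "flux \<Omega> f v \<ge> 0"
proof (rule flux_nonneg_if_shift_loss_nonneg[OF op bd assms(2), of "r / 2"])
  show "r / 2 > 0" using assms(1) by (simp add: outer_cone_def)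
next
  fix s :: real assume s: "0 < s" "norm (s *\<^sub>R v) < r / 2"
  have "s * (\<epsilon> * norm v) \<le> s * (v \<bullet> u)" using s assms(5) by (intro mult_left_mono) auto
  then show "shift_loss \<Omega> f (s *\<^sub>R v) \<ge> 0"
    using s by (intro shift_loss_nonneg[OF assms(1,3,4)]) (auto simp: algebra_simps)
qed

text \<open>The flux along \<open>w\<close> orthogonal to the approximate normal \<open>u\<close> is small relative to the flux along \<open>u\<close>.
  The reason is that the vectors \<open>a *\<^sub>R u - w\<close> and \<open>a *\<^sub>R u + w\<close> with \<open>a = 2 * \<epsilon> * norm w\<close> lie in the
  cone, so that the flux of \<open>g + f\<close> along the first and that of \<open>g - f\<close> along the second are
  nonnegative; their sum gives the claim.\<close>

lemma flux_orthogonal_le: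
  assumes cone: "outer_cone \<Omega> \<epsilon> z r u" and eps: "0 < \<epsilon>" "\<epsilon> \<le> 1 / 2" and C1: "C_diff 1 f" "C_diff 1 g"
    and fg: "\<And>x. \<bar>f x\<bar> \<le> g x" and supp: "\<And>x. g x \<noteq> 0 \<Longrightarrow> x \<in> ball z (r / 2)" and w: "w \<bullet> u = 0"
  shows "flux \<Omega> f w \<le> 2 * \<epsilon> * norm w * flux \<Omega> g u"
proof -
  define a where "a = 2 * \<epsilon> * norm w"
  have u: "norm u = 1" "u \<bullet> u = 1" using cone by (auto simp: outer_cone_def norm_eq_1)
  have a: "0 \<le> a" "a \<le> norm w" using eps mult_right_mono[of "2 * \<epsilon>" 1 "norm w"] by (auto simp: a_def)
  have cone': "\<epsilon> * norm (a *\<^sub>R u + t) \<le> (a *\<^sub>R u + t) \<bullet> u" if t: "t \<bullet> u = 0" "norm t = norm w" for t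
  proof -
    have "norm (a *\<^sub>R u + t) \<le> 2 * norm w"
      using norm_triangle_ineq[of "a *\<^sub>R u" t] a u t by simp
    then have "\<epsilon> * norm (a *\<^sub>R u + t) \<le> \<epsilon> * (2 * norm w)" using eps by (intro mult_left_mono) auto
    then show ?thesis using t u by (simp add: inner_add_left a_def)
  qed
  have C: "C_diff 1 (\<lambda>x. g x + f x)" "C_diff 1 (\<lambda>x. g x - f x)"
    using C1 by (auto intro: C_diff_add C_diff_diff simp del: One_nat_def)
  have s: "x \<in> ball z (r / 2)" if "g x + f x \<noteq> 0 \<or> g x - f x \<noteq> 0" for x
    using supp[of x] fg[of x] that by (cases "g x = 0") auto
  have n: "0 \<le> g x + f x" "0 \<le> g x - f x" for x using fg[of x] by auto
  have "0 \<le> flux \<Omega> (\<lambda>x. g x + f x) (a *\<^sub>R u + - w)"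
    using s n w by (intro flux_cone_nonneg[OF cone C(1)] cone') auto
  moreover have "0 \<le> flux \<Omega> (\<lambda>x. g x - f x) (a *\<^sub>R u + w)"
    using s n w by (intro flux_cone_nonneg[OF cone C(2)] cone') auto
  moreover have "flux \<Omega> k (- w) = - flux \<Omega> k w" for k
    using flux_scaleR[OF op bd, of k "-1" w] by simp
  ultimately have "0 \<le> a * flux \<Omega> g u + a * flux \<Omega> g u - 2 * flux \<Omega> f w"
    unfolding flux_fun_add[OF op bd C1(2,1)] flux_fun_diff[OF op bd C1(2,1)]
      flux_add[OF op bd C1(1)] flux_add[OF op bd C1(2)] flux_scaleR[OF op bd]
    by (simp add: algebra_simps)
  then show ?thesis by (simp add: a_def)
qed

text \<open>With density \<open>\<zeta>\<close> supported in one patch, the lost mass is the flux along \<open>u\<close> times the extent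
  of \<open>R\<close> in direction \<open>u\<close>, up to a multiple of \<open>\<epsilon> * \<rho>\<close> and an arbitrarily small multiple of \<open>\<rho>\<close>. From below, every \<open>y \<in> R\<close> alone
  causes a loss of at least \<open>shift_loss \<Omega> \<zeta> y\<close>. From above, a slightly larger multiple of \<open>u\<close> moves
  every lost point out of \<open>\<Omega>\<close>.\<close>

lemma lost_patch_estimate:
  assumes cone: "outer_cone \<Omega> \<epsilon> z r u" and eps: "0 < \<epsilon>" "\<epsilon> \<le> 1 / 2" and C1: "C_diff 1 \<zeta>"
    and pos: "\<And>x. 0 \<le> \<zeta> x" and supp: "\<And>x. \<zeta> x \<noteq> 0 \<Longrightarrow> x \<in> ball z (r / 2)" and eta: "\<eta> > 0"
  shows "\<exists>\<delta>>0. \<forall>R \<rho>. countable R \<longrightarrow> 0 \<in> R \<longrightarrow> R \<subseteq> cball 0 \<rho> \<longrightarrow> \<rho> \<le> \<delta> \<longrightarrow>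
    \<bar>(LINT x:lost \<Omega> R|lborel. \<zeta> x) - (SUP y\<in>R. y \<bullet> u) * flux \<Omega> \<zeta> u\<bar>
      \<le> 2 * \<epsilon> * \<rho> * flux \<Omega> \<zeta> u + \<eta> * \<rho>"
proof -
  define c where "c = flux \<Omega> \<zeta> u"
  have u: "norm u = 1" "u \<bullet> u = 1" and r: "r > 0" using cone by (auto simp: outer_cone_def norm_eq_1)
  have c: "c \<ge> 0" unfolding c_def using eps u by (intro flux_cone_nonneg[OF cone C1 pos supp]) auto
  obtain \<delta>0 where d0: "\<delta>0 > 0"
    and ap: "\<And>v. norm v \<le> \<delta>0 \<Longrightarrow> \<bar>shift_loss \<Omega> \<zeta> v - flux \<Omega> \<zeta> v\<bar> \<le> \<eta> / 2 * norm v"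
    using shift_loss_approx_flux[OF op bd C1, of "\<eta> / 2"] eta by auto
  define \<delta> where "\<delta> = min (\<delta>0 / 2) (r / 8)"
  have "\<bar>(LINT x:lost \<Omega> R|lborel. \<zeta> x) - (SUP y\<in>R. y \<bullet> u) * c\<bar> \<le> 2 * \<epsilon> * \<rho> * c + \<eta> * \<rho>"
    if R: "countable R" "0 \<in> R" "R \<subseteq> cball 0 \<rho>" "\<rho> \<le> \<delta>" for R \<rho>
  proof -
    have rho: "0 \<le> \<rho>" using R by auto
    have Rn: "norm y \<le> \<rho>" if "y \<in> R" for y using R that by auto
    define h where "h = (SUP y\<in>R. y \<bullet> u)"
    define I where "I = (LINT x:lost \<Omega> R|lborel. \<zeta> x)"
    have yu: "\<bar>y \<bullet> u\<bar> \<le> \<rho>" if "y \<in> R" for y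
      using Cauchy_Schwarz_ineq2[of y u] u Rn[OF that] by simp
    have bdd: "bdd_above ((\<lambda>y. y \<bullet> u) ` R)" using yu by (intro bdd_aboveI[of _ \<rho>]) (auto simp: abs_le_iff)
    have hub: "y \<bullet> u \<le> h" if "y \<in> R" for y unfolding h_def using that bdd by (rule cSUP_upper)
    have h0: "0 \<le> h" using hub[OF R(2)] by simp
    have hrho: "h \<le> \<rho>" unfolding h_def using R yu by (intro cSUP_least) (auto simp: abs_le_iff)
    have ct: "continuous_on UNIV \<zeta>" using C1 by (rule C1_continuous)
    have iL: "integrable lborel (\<lambda>x. indicator (lost \<Omega> R) x * \<zeta> x)"
      using set_integrable_subset[OF integrable_on_bounded_open[OF op bd ct], of "lost \<Omega> R"] lost_borel[OF op R(1)]
      by (auto simp: set_integrable_def lost_def)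
    note iS = set_integral_shift_diff(2)[OF op bd ct]
    have I: "I = (LINT x|lborel. indicator (lost \<Omega> R) x * \<zeta> x)"
      by (simp add: I_def set_lebesgue_integral_def)
    have orth: "norm (y - (y \<bullet> u) *\<^sub>R u) \<le> norm y" for y
    proof -
      have sq: "(norm (y - (y \<bullet> u) *\<^sub>R u))\<^sup>2 = (norm y)\<^sup>2 - (y \<bullet> u)\<^sup>2"
        using u unfolding power2_norm_eq_inner
        by (simp add: power2_eq_square inner_diff_left inner_diff_right inner_commute[of u y])
      show ?thesis by (rule power2_le_imp_le) (simp_all add: sq)
    qed
    have low: "(y \<bullet> u) * c \<le> I + (2 * \<epsilon> * \<rho> * c + \<eta> * \<rho>)" if y: "y \<in> R" for y
    proof -
      define w where "w = y - (y \<bullet> u) *\<^sub>R u"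
      have wu: "(- w) \<bullet> u = 0" using u by (simp add: w_def inner_diff_left)
      have "norm w \<le> \<rho>" using orth[of y] Rn[OF y] by (simp add: w_def)
      then have "2 * \<epsilon> * norm (- w) * c \<le> 2 * \<epsilon> * \<rho> * c"
        using eps c by (intro mult_right_mono mult_left_mono) auto
      moreover have "flux \<Omega> \<zeta> (- w) \<le> 2 * \<epsilon> * norm (- w) * c"
        unfolding c_def using pos by (intro flux_orthogonal_le[OF cone eps C1 C1 _ supp wu]) auto
      moreover have "flux \<Omega> \<zeta> y = (y \<bullet> u) * c - flux \<Omega> \<zeta> (- w)"
        using flux_add[OF op bd C1, of "(y \<bullet> u) *\<^sub>R u" w] flux_scaleR[OF op bd, of \<zeta> "-1" w]
        by (simp add: w_def c_def flux_scaleR[OF op bd])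
      moreover have "\<bar>shift_loss \<Omega> \<zeta> y - flux \<Omega> \<zeta> y\<bar> \<le> \<eta> / 2 * norm y"
        using Rn[OF y] R(4) rho d0 by (intro ap) (auto simp: \<delta>_def)
      moreover have "\<eta> / 2 * norm y \<le> \<eta> * \<rho>"
        using Rn[OF y] eta rho by (intro mult_mono) auto
      moreover have "shift_loss \<Omega> \<zeta> y \<le> I"
        unfolding shift_loss_def I using pos y
        by (intro integral_mono iS iL) (auto simp: indicator_def lost_def)
      ultimately show ?thesis by linarith
    qed
    have "h * c \<le> I + (2 * \<epsilon> * \<rho> * c + \<eta> * \<rho>)"
    proof (cases "c = 0")
      case True
      then show ?thesis using low[OF R(2)] by simp
    next
      case False
      then have "h \<le> (I + (2 * \<epsilon> * \<rho> * c + \<eta> * \<rho>)) / c"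
        unfolding h_def using low R(2) c by (intro cSUP_least) (auto simp: pos_le_divide_eq)
      then show ?thesis using False c by (simp add: pos_le_divide_eq)
    qed
    moreover have "I \<le> h * c + (2 * \<epsilon> * \<rho> * c + \<eta> * \<rho>)"
    proof -
      \<comment> \<open>the excess \<open>2 * \<epsilon> * \<rho>\<close> makes \<open>a *\<^sub>R u - y\<close> a vector of the cone for every \<open>y \<in> R\<close>\<close>
      define a where "a = h + 2 * \<epsilon> * \<rho>"
      have "2 * \<epsilon> * \<rho> \<le> 1 * \<rho>" using eps rho by (intro mult_right_mono) auto
      then have a: "0 \<le> a" "a \<le> 2 * \<rho>" using h0 hrho rho eps by (auto simp: a_def)
      then have nv: "norm (a *\<^sub>R u) = a" using u by simp
      have "ind \<le> ind'" if "ind = indicator (lost \<Omega> R) x * \<zeta> x"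
        "ind' = \<zeta> x * (indicator \<Omega> x - indicator \<Omega> (x + a *\<^sub>R u))" for x and ind ind' :: real
      proof (cases "\<zeta> x = 0")
        case False
        then have x: "dist z x < r / 2" using supp by auto
        have xt: "x + t \<in> ball z r" if "norm t < r / 2" for t
        proof -
          have "dist z (x + t) \<le> dist z x + norm t"
            by (metis add.commute add_diff_cancel_left' dist_norm dist_triangle norm_minus_commute)
          then show ?thesis using that x by simp
        qed
        have nva: "norm (a *\<^sub>R u) < r / 2" using nv a R(4) r by (auto simp: \<delta>_def)
        have 1: "x + a *\<^sub>R u \<notin> \<Omega>" if "x \<notin> \<Omega>"
        proof (rule outer_coneD[OF cone _ xt[OF nva] _ that])
          show "\<epsilon> * norm (a *\<^sub>R u) \<le> a *\<^sub>R u \<bullet> u"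
            using nv u a eps mult_right_mono[of \<epsilon> 1 a] by simp
        qed (use x r in auto)
        have 2: "x + a *\<^sub>R u \<notin> \<Omega>" if "x \<in> lost \<Omega> R"
        proof -
          obtain y where y: "y \<in> R" "x + y \<notin> \<Omega>" using \<open>x \<in> lost \<Omega> R\<close> by (auto simp: lost_def)
          define b where "b = a - y \<bullet> u"
          have b: "2 * \<epsilon> * \<rho> \<le> b" using hub[OF y(1)] by (simp add: b_def a_def)
          have eq: "a *\<^sub>R u - y = b *\<^sub>R u + - (y - (y \<bullet> u) *\<^sub>R u)"
            by (simp add: b_def algebra_simps)
          have b0: "0 \<le> b" using b eps rho by (meson mult_nonneg_nonneg less_imp_le order_trans zero_le_numeral)
          have "norm (a *\<^sub>R u - y) \<le> b + \<rho>"
            unfolding eq using norm_triangle_ineq[of "b *\<^sub>R u" "- (y - (y \<bullet> u) *\<^sub>R u)"] orth[of y] Rn[OF y(1)] u b0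
            by (simp add: norm_minus_commute[of y "(y \<bullet> u) *\<^sub>R u"])
          then have "\<epsilon> * norm (a *\<^sub>R u - y) \<le> \<epsilon> * b + \<epsilon> * \<rho>"
            using eps mult_left_mono[of "norm (a *\<^sub>R u - y)" "b + \<rho>" \<epsilon>] by (simp add: algebra_simps)
          moreover have "\<epsilon> * b \<le> 1 / 2 * b" using eps b0 by (intro mult_right_mono) auto
          moreover have "(a *\<^sub>R u - y) \<bullet> u = b" using u by (simp add: b_def inner_diff_left)
          ultimately have "\<epsilon> * norm (a *\<^sub>R u - y) \<le> (a *\<^sub>R u - y) \<bullet> u" using b by linarith
          moreover have "norm y < r / 2" using Rn[OF y(1)] R(4) r by (auto simp: \<delta>_def)
          moreover have "(x + y) + (a *\<^sub>R u - y) \<in> ball z r" using xt[OF nva] by simp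
          ultimately have "(x + y) + (a *\<^sub>R u - y) \<notin> \<Omega>"
            using outer_coneD[OF cone, of "x + y" "a *\<^sub>R u - y"] y xt[of y] by blast
          then show ?thesis by simp
        qed
        show ?thesis
        proof (cases "x \<in> lost \<Omega> R")
          case True
          moreover from True have "x \<in> \<Omega>" by (simp add: lost_def)
          ultimately show ?thesis unfolding that using 2 by simp
        next
          case False
          have "indicator \<Omega> (x + a *\<^sub>R u) \<le> (indicator \<Omega> x :: real)"
            using 1 by (cases "x \<in> \<Omega>") (simp_all add: indicator_def)
          then show ?thesis unfolding that using False pos[of x] by simp
        qed
      qed (simp add: that)
      then have "I \<le> shift_loss \<Omega> \<zeta> (a *\<^sub>R u)"
        unfolding shift_loss_def I by (intro integral_mono iS iL) blast
      moreover have "\<bar>shift_loss \<Omega> \<zeta> (a *\<^sub>R u) - flux \<Omega> \<zeta> (a *\<^sub>R u)\<bar> \<le> \<eta> / 2 * norm (a *\<^sub>R u)"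
        using nv a R(4) by (intro ap) (auto simp: \<delta>_def)
      moreover have "flux \<Omega> \<zeta> (a *\<^sub>R u) = h * c + 2 * \<epsilon> * \<rho> * c"
        unfolding flux_scaleR[OF op bd] c_def[symmetric] by (simp add: a_def algebra_simps)
      moreover have "\<eta> / 2 * norm (a *\<^sub>R u) \<le> \<eta> / 2 * (2 * \<rho>)" unfolding nv using a eta by (intro mult_left_mono) auto
      moreover have "\<eta> / 2 * (2 * \<rho>) = \<eta> * \<rho>" by simp
      ultimately show ?thesis by linarith
    qed
    ultimately show ?thesis unfolding h_def[symmetric] I_def[symmetric] abs_le_iff by linarith
  qed
  then show ?thesis using d0 r unfolding c_def by (intro exI[of _ \<delta>]) (auto simp: \<delta>_def)
qed

end

section \<open>Approximation of the perimeter and of the lost volume\<close>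

lemma set_integral_lebesgue_eq_lborel:
  fixes g :: "'a::euclidean_space \<Rightarrow> real"
  assumes "(\<lambda>x. indicator \<Omega> x *\<^sub>R g x) \<in> borel_measurable borel"
  shows "(LINT x:\<Omega>|lebesgue. g x) = (LINT x:\<Omega>|lborel. g x)"
  unfolding set_lebesgue_integral_def using assms by (intro integral_completion) simp

lemma integral_divergence:
  fixes \<phi> :: "real^'n \<Rightarrow> real^'n"
  assumes "open \<Omega>" "bounded \<Omega>" and C1: "\<And>i. C_diff 1 (\<lambda>x. \<phi> x $ i)"
  shows "(LINT x:\<Omega>|lebesgue. divergence \<phi> x) = (\<Sum>i\<in>UNIV. flux \<Omega> (\<lambda>x. \<phi> x $ i) (axis i 1))"
proof -
  have d: "divergence \<phi> = (\<lambda>x. \<Sum>i\<in>UNIV. gradient (\<lambda>x. \<phi> x $ i) x \<bullet> axis i 1)"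
    by (rule ext) (simp add: divergence_def gradient_def inner_axis)
  have "continuous_on UNIV (divergence \<phi>)"
    unfolding d by (intro continuous_intros continuous_gradient C1)
  then have "(LINT x:\<Omega>|lebesgue. divergence \<phi> x) = (LINT x:\<Omega>|lborel. divergence \<phi> x)"
    using assms(1) by (intro set_integral_lebesgue_eq_lborel borel_measurable_scaleR
        borel_measurable_indicator borel_measurable_continuous_onI) auto
  also have "\<dots> = (\<Sum>i\<in>UNIV. flux \<Omega> (\<lambda>x. \<phi> x $ i) (axis i 1))"
    unfolding flux_def set_lebesgue_integral_def d scaleR_sum_right
    using integrable_directional_deriv[OF assms(1,2) C1]
    by (intro Bochner_Integration.integral_sum) (simp add: set_integrable_def)
  finally show ?thesis .
qed

text \<open>The vector fields over which the supremum in the definition of the perimeter is taken.\<close>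

definition test_field :: "(real^'n \<Rightarrow> real^'n) \<Rightarrow> bool" where
  "test_field \<phi> \<longleftrightarrow>
     (\<forall>i. C_inf_compact_support (\<lambda>x. \<phi> x $ i)) \<and> (\<forall>x. (\<Sum>i\<in>UNIV. (\<phi> x $ i)\<^sup>2) \<le> 1)"

lemma perimeter_eq_SUP_test_field:
  "perimeter \<Omega> = (SUP \<phi>\<in>Collect test_field. ereal (LINT x:\<Omega>|lebesgue. divergence \<phi> x))"
  by (simp add: perimeter_def test_field_def[abs_def])

lemma test_fieldD:
  assumes "test_field \<phi>"
  shows "C_diff m (\<lambda>x. \<phi> x $ i)" "norm (\<phi> x) \<le> 1"
  using assms by (auto simp: test_field_def C_inf_compact_support_def norm_vec_def L2_set_def)

lemma sum_prod_complement:
  fixes b :: "nat \<Rightarrow> real"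
  shows "(\<Sum>i<n. b i * (\<Prod>k<i. 1 - b k)) = 1 - (\<Prod>k<n. 1 - b k)"
  by (induction n) (simp_all add: algebra_simps)

text \<open>Finitely many smooth functions \<open>\<zeta> i\<close> that form a partition of unity on the \<open>\<delta>\<close>-neighbourhood of
  the boundary of \<open>\<Omega>\<close>. On the ball carrying \<open>\<zeta> i\<close>, the vector \<open>u i\<close> is an outer normal of \<open>\<Omega>\<close> up
  to the precision \<open>\<epsilon>\<close>. The support of \<open>\<zeta> i\<close> is confined to half the radius, to leave room for
  small shifts.\<close>

locale boundary_patches =
  fixes \<Omega> :: "(real^'n) set" and \<epsilon> \<delta> :: real and n :: nat
    and \<zeta> :: "nat \<Rightarrow> real^'n \<Rightarrow> real" and z u :: "nat \<Rightarrow> real^'n" and r :: "nat \<Rightarrow> real"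
  assumes op: "open \<Omega>" and bd: "bounded \<Omega>" and eps: "0 < \<epsilon>" "\<epsilon> \<le> 1 / 2" and delta: "0 < \<delta>"
    and cone: "\<And>i. i < n \<Longrightarrow> outer_cone \<Omega> \<epsilon> (z i) (r i) (u i)"
    and smooth: "\<And>i m. i < n \<Longrightarrow> C_diff m (\<zeta> i)"
    and nonneg: "\<And>i x. i < n \<Longrightarrow> 0 \<le> \<zeta> i x"
    and supp: "\<And>i x. i < n \<Longrightarrow> \<zeta> i x \<noteq> 0 \<Longrightarrow> x \<in> ball (z i) (r i / 2)"
    and sum_le_1: "\<And>x. (\<Sum>i<n. \<zeta> i x) \<le> 1"
    and sum_eq_1: "\<And>x y. y \<in> frontier \<Omega> \<Longrightarrow> dist x y < \<delta> \<Longrightarrow> (\<Sum>i<n. \<zeta> i x) = 1"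

lemma boundary_patches_exist:
  fixes \<Omega> :: "(real^'n) set"
  assumes op: "open \<Omega>" and bd: "bounded \<Omega>" and bdry: "C1_holder_boundary \<kappa> \<Omega>"
    and eps: "0 < \<epsilon>" "\<epsilon> \<le> 1 / 2"
  shows "\<exists>\<delta> n \<zeta> z u r. boundary_patches \<Omega> \<epsilon> \<delta> n \<zeta> z u r"
proof -
  obtain r0 u0 where c0: "\<And>z. z \<in> frontier \<Omega> \<Longrightarrow> outer_cone \<Omega> \<epsilon> z (r0 z) (u0 z)"
    using outer_cone_exists[OF bdry _ eps(1)] by metis
  then have r0: "z \<in> frontier \<Omega> \<Longrightarrow> r0 z > 0" for z by (simp add: outer_cone_def)
  have "\<forall>z\<in>frontier \<Omega>. \<exists>b. (\<forall>m. C_diff m b) \<and> (\<forall>x. 0 \<le> b x \<and> b x \<le> 1) \<and>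
    (\<forall>x. dist x z \<le> r0 z / 4 \<longrightarrow> b x = 1) \<and> (\<forall>x. r0 z / 2 \<le> dist x z \<longrightarrow> b x = 0)"
    using r0 by (intro ballI smooth_bump_exists)
  from bchoice[OF this] obtain b where b0: "\<forall>z\<in>frontier \<Omega>. (\<forall>m. C_diff m (b z)) \<and> (\<forall>x. 0 \<le> b z x \<and> b z x \<le> 1) \<and>
    (\<forall>x. dist x z \<le> r0 z / 4 \<longrightarrow> b z x = 1) \<and> (\<forall>x. r0 z / 2 \<le> dist x z \<longrightarrow> b z x = 0)" ..
  then have b: "\<And>z m. z \<in> frontier \<Omega> \<Longrightarrow> C_diff m (b z)"
      "\<And>z x. z \<in> frontier \<Omega> \<Longrightarrow> 0 \<le> b z x" "\<And>z x. z \<in> frontier \<Omega> \<Longrightarrow> b z x \<le> 1"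
      "\<And>z x. z \<in> frontier \<Omega> \<Longrightarrow> dist x z \<le> r0 z / 4 \<Longrightarrow> b z x = 1"
      "\<And>z x. z \<in> frontier \<Omega> \<Longrightarrow> r0 z / 2 \<le> dist x z \<Longrightarrow> b z x = 0"
    by blast+
  have comp: "compact (frontier \<Omega>)" using bd by (rule compact_frontier_bounded)
  obtain C where C: "C \<subseteq> frontier \<Omega>" "finite C" "frontier \<Omega> \<subseteq> (\<Union>z\<in>C. ball z (r0 z / 4))"
  proof (rule compactE_image[OF comp, of "frontier \<Omega>" "\<lambda>z. ball z (r0 z / 4)"])
    show "frontier \<Omega> \<subseteq> (\<Union>z\<in>frontier \<Omega>. ball z (r0 z / 4))" using r0 by force
  qed auto
  obtain zs where zs: "set zs = C" using C(2) finite_list by blast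
  define n z where "n = length zs" and "z = (\<lambda>i. zs ! i)"
  have zF: "z i \<in> frontier \<Omega>" if "i < n" for i using that zs C(1) by (auto simp: n_def z_def)
  have C_ex: "\<exists>i<n. z i = y" if "y \<in> C" for y
    using that zs by (auto simp: n_def z_def in_set_conv_nth)
  obtain \<delta> where d: "0 < \<delta>"
    "\<And>x. x \<in> frontier \<Omega> \<Longrightarrow> \<exists>G\<in>(\<lambda>z. ball z (r0 z / 4)) ` C. ball x \<delta> \<subseteq> G"
    using Heine_Borel_lemma[OF comp C(3)] by auto
  \<comment> \<open>this sums up to 1 wherever one of the bumps equals 1, and no division is needed\<close>
  define \<zeta> where "\<zeta> i x = b (z i) x * (\<Prod>k<i. 1 - b (z k) x)" for i x
  have sum: "(\<Sum>i<n. \<zeta> i x) = 1 - (\<Prod>k<n. 1 - b (z k) x)" for x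
    unfolding \<zeta>_def by (rule sum_prod_complement)
  have "boundary_patches \<Omega> \<epsilon> \<delta> n \<zeta> z (\<lambda>i. u0 (z i)) (\<lambda>i. r0 (z i))"
  proof
    fix i x assume i: "i < n"
    show "0 \<le> \<zeta> i x"
      using i b(2,3) zF unfolding \<zeta>_def by (intro mult_nonneg_nonneg prod_nonneg) auto
    show "x \<in> ball (z i) (r0 (z i) / 2)" if "\<zeta> i x \<noteq> 0"
      using that b(5)[OF zF[OF i], of x] by (force simp: \<zeta>_def dist_commute)
  next
    fix i m assume i: "i < n"
    show "C_diff m (\<zeta> i)" unfolding \<zeta>_def[abs_def]
      using i zF by (intro C_diff_mult C_diff_prod C_diff_diff C_diff_const b(1)) auto
  next
    fix x
    show "(\<Sum>i<n. \<zeta> i x) \<le> 1"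
    proof -
      have "0 \<le> (\<Prod>k<n. 1 - b (z k) x)" using b(3) zF by (intro prod_nonneg) auto
      then show ?thesis unfolding sum by simp
    qed
  next
    fix x y assume "y \<in> frontier \<Omega>" and xy: "dist x y < \<delta>"
    then obtain c where "c \<in> C" "ball y \<delta> \<subseteq> ball c (r0 c / 4)" using d(2) by blast
    moreover then obtain i where i: "i < n" "z i = c" using C_ex by blast
    ultimately have "dist x (z i) \<le> r0 (z i) / 4" using xy by (auto simp: dist_commute subset_iff)
    then have "b (z i) x = 1" using b(4) zF i by blast
    then have "(\<Prod>k<n. 1 - b (z k) x) = 0" using i by (intro prod_zero) auto
    then show "(\<Sum>i<n. \<zeta> i x) = 1" using sum by simp
  qed (use op bd eps d c0 zF in auto)
  then show ?thesis by blast
qed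

context boundary_patches
begin

text \<open>An approximation of the perimeter: the surface integral of the sum of the \<open>\<zeta> i * (\<nu> \<bullet> u i)\<close>, where
  \<open>\<nu>\<close> is the outer normal and is close to \<open>u i\<close> on the support of \<open>\<zeta> i\<close>.\<close>

definition total_flux :: real where
  "total_flux = (\<Sum>i<n. flux \<Omega> (\<zeta> i) (u i))"

lemma norm_u: "i < n \<Longrightarrow> norm (u i) = 1" "i < n \<Longrightarrow> u i \<bullet> u i = 1"
  using cone[of i] by (auto simp: outer_cone_def norm_eq_1)

lemma flux_patch_nonneg: "i < n \<Longrightarrow> 0 \<le> flux \<Omega> (\<zeta> i) (u i)"
  using eps norm_u[of i]
  by (intro flux_cone_nonneg[OF op bd cone smooth nonneg supp]) auto

lemma total_flux_nonneg: "0 \<le> total_flux"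
  unfolding total_flux_def by (intro sum_nonneg flux_patch_nonneg) auto

lemma total_flux_le_perimeter: "ereal total_flux \<le> perimeter \<Omega>"
proof -
  define \<phi> where "\<phi> x = (\<Sum>i<n. \<zeta> i x *\<^sub>R u i)" for x
  have comp: "(\<lambda>x. \<phi> x $ j) = (\<lambda>x. \<Sum>i<n. \<zeta> i x * u i $ j)" for j by (simp add: \<phi>_def)
  have C: "C_diff m (\<lambda>x. \<phi> x $ j)" for j m
    unfolding comp by (intro C_diff_sum C_diff_mult C_diff_const smooth) auto
  have "{x. \<phi> x $ j \<noteq> 0} \<subseteq> (\<Union>i<n. ball (z i) (r i / 2))" for j
  proof
    fix x assume x: "x \<in> {x. \<phi> x $ j \<noteq> 0}"
    have "\<exists>i<n. \<zeta> i x \<noteq> 0"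
    proof (rule ccontr)
      assume "\<not> (\<exists>i<n. \<zeta> i x \<noteq> 0)"
      then have "\<phi> x = 0" by (simp add: \<phi>_def)
      with x show False by simp
    qed
    then show "x \<in> (\<Union>i<n. ball (z i) (r i / 2))" using supp by blast
  qed
  then have "bounded {x. \<phi> x $ j \<noteq> 0}" for j
    by (rule bounded_subset[rotated]) (intro bounded_UN, auto)
  then have cs: "compact (closure {x. \<phi> x $ j \<noteq> 0})" for j by (simp add: compact_closure)
  have "norm (\<phi> x) \<le> 1" for x
  proof -
    have "norm (\<phi> x) \<le> (\<Sum>i<n. norm (\<zeta> i x *\<^sub>R u i))" unfolding \<phi>_def by (rule norm_sum)
    also have "\<dots> = (\<Sum>i<n. \<zeta> i x)" using norm_u nonneg by (intro sum.cong) auto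
    finally show ?thesis using sum_le_1[of x] by simp
  qed
  then have "(\<Sum>i\<in>UNIV. (\<phi> x $ i)\<^sup>2) \<le> 1" for x
    by (simp add: norm_vec_def L2_set_def)
  then have "test_field \<phi>"
    using C cs by (simp add: test_field_def C_inf_compact_support_def)
  moreover have "(LINT x:\<Omega>|lebesgue. divergence \<phi> x) = total_flux"
  proof -
    have s1: "C_diff 1 (\<lambda>x. \<zeta> i x * c)" if "i < n" for i c
      using that by (intro C_diff_mult smooth C_diff_const)
    have "flux \<Omega> (\<lambda>x. \<phi> x $ j) v = (\<Sum>i<n. u i $ j * flux \<Omega> (\<zeta> i) v)" for j v
    proof -
      have "flux \<Omega> (\<lambda>x. \<phi> x $ j) v = (\<Sum>i<n. flux \<Omega> (\<lambda>x. \<zeta> i x * u i $ j) v)"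
        unfolding comp using s1 by (intro flux_fun_sum[OF op bd]) auto
      also have "\<dots> = (\<Sum>i<n. u i $ j * flux \<Omega> (\<zeta> i) v)"
      proof (rule sum.cong)
        fix i assume "i \<in> {..<n}"
        then show "flux \<Omega> (\<lambda>x. \<zeta> i x * u i $ j) v = u i $ j * flux \<Omega> (\<zeta> i) v"
          using flux_fun_cmult[OF op bd smooth, of i "u i $ j" v] by (simp add: mult.commute)
      qed simp
      finally show ?thesis .
    qed
    then have "(LINT x:\<Omega>|lebesgue. divergence \<phi> x) = (\<Sum>j\<in>UNIV. \<Sum>i<n. u i $ j * flux \<Omega> (\<zeta> i) (axis j 1))"
      by (simp add: integral_divergence[OF op bd C])
    also have "\<dots> = (\<Sum>i<n. \<Sum>j\<in>UNIV. flux \<Omega> (\<zeta> i) (u i $ j *\<^sub>R axis j 1))"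
      by (subst sum.swap) (simp add: flux_scaleR[OF op bd])
    also have "\<dots> = (\<Sum>i<n. flux \<Omega> (\<zeta> i) (\<Sum>j\<in>UNIV. u i $ j *\<^sub>R axis j 1))"
      by (intro sum.cong flux_sum[OF op bd, symmetric] smooth) simp_all
    also have "\<dots> = total_flux"
      using basis_expansion[of "u _"] by (simp add: total_flux_def scalar_mult_eq_scaleR)
    finally show ?thesis .
  qed
  ultimately show ?thesis unfolding perimeter_eq_SUP_test_field
    by (metis (mono_tags, lifting) SUP_upper mem_Collect_eq)
qed

text \<open>The part of \<open>\<phi>\<close> away from the boundary contributes nothing. On the patch \<open>i\<close>, the component of
  \<open>\<phi>\<close> along \<open>u i\<close> contributes at most the flux of \<open>\<zeta> i\<close>, because \<open>\<phi> x \<bullet> u i \<le> 1\<close>; the orthogonal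
  components are controlled by \<open>flux_orthogonal_le\<close>.\<close>

lemma integral_divergence_le_total_flux:
  assumes \<phi>: "test_field \<phi>"
  shows "(LINT x:\<Omega>|lebesgue. divergence \<phi> x) \<le> (1 + 2 * real CARD('n) * \<epsilon>) * total_flux"
proof -
  note C = test_fieldD(1)[OF \<phi>] and n1 = test_fieldD(2)[OF \<phi>]
  have comp1: "\<bar>\<phi> x $ j\<bar> \<le> 1" for x j using component_le_norm_cart[of "\<phi> x" j] n1[of x] by linarith
  have s: "C_diff 1 (\<zeta> i)" if "i < n" for i using smooth[OF that] .
  have sp: "C_diff 1 (\<lambda>x. \<zeta> i x * \<phi> x $ j)" if "i < n" for i j
    using that by (intro C_diff_mult smooth C)
  have split: "flux \<Omega> (\<lambda>x. \<phi> x $ j) v = (\<Sum>i<n. flux \<Omega> (\<lambda>x. \<zeta> i x * \<phi> x $ j) v)" for j v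
  proof -
    have cs: "C_diff 1 (\<lambda>x. \<Sum>i<n. \<zeta> i x * \<phi> x $ j)" using sp by (intro C_diff_sum) auto
    have "flux \<Omega> (\<lambda>x. \<phi> x $ j - (\<Sum>i<n. \<zeta> i x * \<phi> x $ j)) v = 0"
    proof (rule flux_zero_near_frontier[OF op bd _ delta])
      show "C_diff 1 (\<lambda>x. \<phi> x $ j - (\<Sum>i<n. \<zeta> i x * \<phi> x $ j))" by (intro C_diff_diff C cs)
    next
      fix x y assume "y \<in> frontier \<Omega>" "dist x y < \<delta>"
      then show "\<phi> x $ j - (\<Sum>i<n. \<zeta> i x * \<phi> x $ j) = 0"
        using sum_eq_1[of y x] by (simp flip: sum_distrib_right)
    qed
    then have "flux \<Omega> (\<lambda>x. \<phi> x $ j) v = flux \<Omega> (\<lambda>x. \<Sum>i<n. \<zeta> i x * \<phi> x $ j) v"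
      using flux_fun_diff[OF op bd C[of 1 j] cs, of v] by simp
    also have "\<dots> = (\<Sum>i<n. flux \<Omega> (\<lambda>x. \<zeta> i x * \<phi> x $ j) v)"
      using sp by (intro flux_fun_sum[OF op bd]) auto
    finally show ?thesis .
  qed
  have patch: "(\<Sum>j\<in>UNIV. flux \<Omega> (\<lambda>x. \<zeta> i x * \<phi> x $ j) (axis j 1)) \<le> (1 + 2 * real CARD('n) * \<epsilon>) * flux \<Omega> (\<zeta> i) (u i)"
    if i: "i < n" for i
  proof -
    define w where "w j = axis j 1 - (u i $ j) *\<^sub>R u i" for j :: 'n
    have wu: "w j \<bullet> u i = 0" for j using norm_u(2)[OF i] by (simp add: w_def inner_diff_left inner_axis')
    have nw: "norm (w j) \<le> 1" for j
    proof -
      have "(norm (w j))\<^sup>2 = 1 - (u i $ j)\<^sup>2"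
        using norm_u(2)[OF i] unfolding power2_norm_eq_inner w_def
        by (simp add: power2_eq_square inner_diff_left inner_diff_right inner_axis inner_axis' inner_axis_axis)
      then have "(norm (w j))\<^sup>2 \<le> 1\<^sup>2" by simp
      then show ?thesis by (rule power2_le_imp_le) simp
    qed
    have "flux \<Omega> (\<lambda>x. \<zeta> i x * \<phi> x $ j) (w j) \<le> 2 * \<epsilon> * flux \<Omega> (\<zeta> i) (u i)" for j
    proof -
      have "\<bar>\<zeta> i x * \<phi> x $ j\<bar> \<le> \<zeta> i x" for x
        using nonneg[OF i, of x] comp1[of x j] by (simp add: abs_mult mult_left_le)
      then have "flux \<Omega> (\<lambda>x. \<zeta> i x * \<phi> x $ j) (w j) \<le> 2 * \<epsilon> * norm (w j) * flux \<Omega> (\<zeta> i) (u i)"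
        using i by (intro flux_orthogonal_le[OF op bd cone[OF i] eps sp s _ supp wu]) auto
      also have "\<dots> \<le> 2 * \<epsilon> * 1 * flux \<Omega> (\<zeta> i) (u i)"
        using nw eps flux_patch_nonneg[OF i] by (intro mult_right_mono mult_left_mono) auto
      finally show ?thesis by simp
    qed
    then have "(\<Sum>j\<in>UNIV. flux \<Omega> (\<lambda>x. \<zeta> i x * \<phi> x $ j) (w j)) \<le> (\<Sum>j::'n\<in>UNIV. 2 * \<epsilon> * flux \<Omega> (\<zeta> i) (u i))"
      by (intro sum_mono)
    moreover have "(\<Sum>j\<in>UNIV. u i $ j * flux \<Omega> (\<lambda>x. \<zeta> i x * \<phi> x $ j) (u i)) \<le> flux \<Omega> (\<zeta> i) (u i)"
    proof -
      have "(\<Sum>j\<in>UNIV. u i $ j * flux \<Omega> (\<lambda>x. \<zeta> i x * \<phi> x $ j) (u i)) =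
          flux \<Omega> (\<lambda>x. \<Sum>j\<in>UNIV. u i $ j * (\<zeta> i x * \<phi> x $ j)) (u i)"
        using sp i
        by (subst flux_fun_sum[OF op bd])
          (simp_all add: flux_fun_cmult[OF op bd sp[OF i]] C_diff_mult[OF C_diff_const sp[OF i]] del: One_nat_def)
      also have "(\<lambda>x. \<Sum>j\<in>UNIV. u i $ j * (\<zeta> i x * \<phi> x $ j)) = (\<lambda>x. \<zeta> i x * (u i \<bullet> \<phi> x))"
        by (auto simp: inner_vec_def sum_distrib_left mult_ac)
      finally have e: "(\<Sum>j\<in>UNIV. u i $ j * flux \<Omega> (\<lambda>x. \<zeta> i x * \<phi> x $ j) (u i)) =
        flux \<Omega> (\<lambda>x. \<zeta> i x * (u i \<bullet> \<phi> x)) (u i)" .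
      have c2: "C_diff 1 (\<lambda>x. \<zeta> i x * (u i \<bullet> \<phi> x))"
        unfolding inner_vec_def inner_real_def by (intro C_diff_mult C_diff_sum C_diff_const smooth i C)
      have "u i \<bullet> \<phi> x \<le> 1" for x
        using norm_cauchy_schwarz[of "u i" "\<phi> x"] norm_u(1)[OF i] n1[of x] by simp
      then have "0 \<le> \<zeta> i x - \<zeta> i x * (u i \<bullet> \<phi> x)" for x
        using nonneg[OF i, of x] by (simp add: mult_left_le)
      moreover have "x \<in> ball (z i) (r i / 2)" if "\<zeta> i x - \<zeta> i x * (u i \<bullet> \<phi> x) \<noteq> 0" for x
        using that by (intro supp[OF i]) auto
      ultimately have "0 \<le> flux \<Omega> (\<lambda>x. \<zeta> i x - \<zeta> i x * (u i \<bullet> \<phi> x)) (u i)"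
        using eps norm_u[OF i] by (intro flux_cone_nonneg[OF op bd cone[OF i] C_diff_diff[OF s[OF i] c2]]) auto
      then show ?thesis unfolding e using flux_fun_diff[OF op bd s[OF i] c2] by simp
    qed
    moreover have "flux \<Omega> (\<lambda>x. \<zeta> i x * \<phi> x $ j) (axis j 1) =
        u i $ j * flux \<Omega> (\<lambda>x. \<zeta> i x * \<phi> x $ j) (u i) + flux \<Omega> (\<lambda>x. \<zeta> i x * \<phi> x $ j) (w j)" for j
      using flux_add[OF op bd sp[OF i], of j "(u i $ j) *\<^sub>R u i" "w j"]
      by (simp add: w_def flux_scaleR[OF op bd])
    ultimately show ?thesis by (simp add: sum.distrib algebra_simps)
  qed
  have "(LINT x:\<Omega>|lebesgue. divergence \<phi> x) = (\<Sum>i<n. \<Sum>j\<in>UNIV. flux \<Omega> (\<lambda>x. \<zeta> i x * \<phi> x $ j) (axis j 1))"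
    unfolding integral_divergence[OF op bd C] split by (rule sum.swap)
  also have "\<dots> \<le> (\<Sum>i<n. (1 + 2 * real CARD('n) * \<epsilon>) * flux \<Omega> (\<zeta> i) (u i))"
    using patch by (intro sum_mono) auto
  finally show ?thesis by (simp add: total_flux_def sum_distrib_left)
qed

lemma perimeter_le_total_flux: "perimeter \<Omega> \<le> ereal ((1 + 2 * real CARD('n) * \<epsilon>) * total_flux)"
  unfolding perimeter_eq_SUP_test_field
  using integral_divergence_le_total_flux by (intro SUP_least) auto

lemma measure_lost_eq_sum:
  assumes R: "countable R" "R \<subseteq> cball 0 \<rho>" "\<rho> < \<delta>"
  shows "measure lborel (lost \<Omega> R) = (\<Sum>i<n. LINT x:lost \<Omega> R|lborel. \<zeta> i x)"
proof -
  have "set_integrable lborel (lost \<Omega> R) (\<zeta> i)" if "i < n" for i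
    using set_integrable_subset[OF integrable_on_bounded_open[OF op bd C1_continuous[OF smooth[OF that]]], of "lost \<Omega> R"]
      lost_borel[OF op R(1)] by (auto simp: lost_def)
  then have "(\<Sum>i<n. LINT x:lost \<Omega> R|lborel. \<zeta> i x) = (LINT x:lost \<Omega> R|lborel. \<Sum>i<n. \<zeta> i x)"
    unfolding set_lebesgue_integral_def scaleR_sum_right
    by (intro Bochner_Integration.integral_sum[symmetric]) (simp add: set_integrable_def)
  also have "\<dots> = (LINT x:lost \<Omega> R|lborel. 1)"
  proof (rule set_lebesgue_integral_cong)
    show "lost \<Omega> R \<in> sets lborel" using lost_borel[OF op R(1)] by simp
    show "\<forall>x. x \<in> lost \<Omega> R \<longrightarrow> (\<Sum>i<n. \<zeta> i x) = 1"
    proof (intro allI impI)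
      fix x assume "x \<in> lost \<Omega> R"
      then obtain y where y: "x \<in> \<Omega>" "y \<in> R" "x + y \<notin> \<Omega>" by (auto simp: lost_def)
      from exit_near_frontier[OF y(1,3)] obtain w where "w \<in> frontier \<Omega>" "dist x w \<le> norm y" .
      moreover have "norm y < \<delta>" using y R by auto
      ultimately show "(\<Sum>i<n. \<zeta> i x) = 1" by (intro sum_eq_1) auto
    qed
  qed
  also have "\<dots> = measure lborel (lost \<Omega> R)"
    using lost_borel[OF op R(1)] by (simp add: set_lebesgue_integral_def)
  finally show ?thesis by simp
qed

lemma measure_lost_estimate_small:
  assumes eta: "\<eta> > 0"
  shows "\<exists>\<delta>'>0. \<forall>R \<rho>. countable R \<longrightarrow> 0 \<in> R \<longrightarrow> R \<subseteq> cball 0 \<rho> \<longrightarrow> \<rho> \<le> \<delta>' \<longrightarrow>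
    \<bar>measure lborel (lost \<Omega> R) - (\<Sum>i<n. (SUP y\<in>R. y \<bullet> u i) * flux \<Omega> (\<zeta> i) (u i))\<bar>
      \<le> 2 * \<epsilon> * \<rho> * total_flux + \<eta> * \<rho>"
proof -
  define \<eta>' where "\<eta>' = \<eta> / (real n + 1)"
  have eta': "\<eta>' > 0" using eta by (simp add: \<eta>'_def)
  have neta: "real n * \<eta>' \<le> \<eta>" using eta by (simp add: \<eta>'_def field_simps)
  have "\<forall>i\<in>{..<n}. \<exists>d>0. \<forall>R \<rho>. countable R \<longrightarrow> 0 \<in> R \<longrightarrow> R \<subseteq> cball 0 \<rho> \<longrightarrow> \<rho> \<le> d \<longrightarrow>
    \<bar>(LINT x:lost \<Omega> R|lborel. \<zeta> i x) - (SUP y\<in>R. y \<bullet> u i) * flux \<Omega> (\<zeta> i) (u i)\<bar>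
      \<le> 2 * \<epsilon> * \<rho> * flux \<Omega> (\<zeta> i) (u i) + \<eta>' * \<rho>"
    using lost_patch_estimate[OF op bd cone eps smooth nonneg supp eta'] by blast
  from bchoice[OF this] obtain d where "\<forall>i\<in>{..<n}. d i > 0 \<and> (\<forall>R \<rho>. countable R \<longrightarrow> 0 \<in> R \<longrightarrow>
    R \<subseteq> cball 0 \<rho> \<longrightarrow> \<rho> \<le> d i \<longrightarrow>
    \<bar>(LINT x:lost \<Omega> R|lborel. \<zeta> i x) - (SUP y\<in>R. y \<bullet> u i) * flux \<Omega> (\<zeta> i) (u i)\<bar>
      \<le> 2 * \<epsilon> * \<rho> * flux \<Omega> (\<zeta> i) (u i) + \<eta>' * \<rho>)" ..
  then have d: "\<And>i. i < n \<Longrightarrow> d i > 0"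
    "\<And>i R \<rho>. i < n \<Longrightarrow> countable R \<Longrightarrow> 0 \<in> R \<Longrightarrow> R \<subseteq> cball 0 \<rho> \<Longrightarrow> \<rho> \<le> d i \<Longrightarrow>
    \<bar>(LINT x:lost \<Omega> R|lborel. \<zeta> i x) - (SUP y\<in>R. y \<bullet> u i) * flux \<Omega> (\<zeta> i) (u i)\<bar>
      \<le> 2 * \<epsilon> * \<rho> * flux \<Omega> (\<zeta> i) (u i) + \<eta>' * \<rho>" by blast+
  define \<delta>' where "\<delta>' = Min (insert (\<delta> / 2) (d ` {..<n}))"
  have dp: "\<delta>' > 0" using d(1) delta by (auto simp: \<delta>'_def)
  have dle: "\<delta>' \<le> \<delta> / 2" "\<And>i. i < n \<Longrightarrow> \<delta>' \<le> d i" unfolding \<delta>'_def by (rule Min_le; simp)+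
  show ?thesis
  proof (intro exI[of _ \<delta>'] conjI allI impI dp)
    fix R :: "(real^'n) set" and \<rho> assume R: "countable R" "0 \<in> R" "R \<subseteq> cball 0 \<rho>" "\<rho> \<le> \<delta>'"
    have rho: "0 \<le> \<rho>" using R by auto
    have "\<rho> < \<delta>" using R dle(1) delta by linarith
    then have "\<bar>measure lborel (lost \<Omega> R) - (\<Sum>i<n. (SUP y\<in>R. y \<bullet> u i) * flux \<Omega> (\<zeta> i) (u i))\<bar> =
      \<bar>\<Sum>i<n. (LINT x:lost \<Omega> R|lborel. \<zeta> i x) - (SUP y\<in>R. y \<bullet> u i) * flux \<Omega> (\<zeta> i) (u i)\<bar>"
      by (simp add: measure_lost_eq_sum[OF R(1,3)] sum_subtractf)
    also have "\<dots> \<le> (\<Sum>i<n. \<bar>(LINT x:lost \<Omega> R|lborel. \<zeta> i x) - (SUP y\<in>R. y \<bullet> u i) * flux \<Omega> (\<zeta> i) (u i)\<bar>)"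
      by (rule sum_abs)
    also have "\<dots> \<le> (\<Sum>i<n. 2 * \<epsilon> * \<rho> * flux \<Omega> (\<zeta> i) (u i) + \<eta>' * \<rho>)"
      using R dle(2) by (intro sum_mono d(2)) (auto intro: order_trans)
    also have "\<dots> = 2 * \<epsilon> * \<rho> * total_flux + real n * \<eta>' * \<rho>"
      by (simp add: sum.distrib total_flux_def sum_distrib_left)
    also have "\<dots> \<le> 2 * \<epsilon> * \<rho> * total_flux + \<eta> * \<rho>"
      using neta rho by (intro add_left_mono mult_right_mono)
    finally show "\<bar>measure lborel (lost \<Omega> R) - (\<Sum>i<n. (SUP y\<in>R. y \<bullet> u i) * flux \<Omega> (\<zeta> i) (u i))\<bar>
      \<le> 2 * \<epsilon> * \<rho> * total_flux + \<eta> * \<rho>" .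
  qed
qed

text \<open>For \<open>\<rho>\<close> bounded away from 0, both terms of the difference are bounded by a multiple of
  \<open>\<rho> powr p\<close>, which removes the restriction to small \<open>\<rho>\<close>.\<close>

lemma measure_lost_estimate:
  assumes p: "p > 1"
  shows "\<exists>C\<ge>0. \<forall>R \<rho>. countable R \<longrightarrow> 0 \<in> R \<longrightarrow> R \<subseteq> cball 0 \<rho> \<longrightarrow>
    \<bar>measure lborel (lost \<Omega> R) - (\<Sum>i<n. (SUP y\<in>R. y \<bullet> u i) * flux \<Omega> (\<zeta> i) (u i))\<bar>
      \<le> 2 * \<epsilon> * (total_flux + 1) * \<rho> + C * \<rho> powr p"
proof -
  have "2 * \<epsilon> > 0" using eps by simp
  from measure_lost_estimate_small[OF this] obtain d where d: "d > 0"
    "\<And>R \<rho>. countable R \<Longrightarrow> 0 \<in> R \<Longrightarrow> R \<subseteq> cball 0 \<rho> \<Longrightarrow> \<rho> \<le> d \<Longrightarrow>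
    \<bar>measure lborel (lost \<Omega> R) - (\<Sum>i<n. (SUP y\<in>R. y \<bullet> u i) * flux \<Omega> (\<zeta> i) (u i))\<bar>
      \<le> 2 * \<epsilon> * \<rho> * total_flux + 2 * \<epsilon> * \<rho>" by auto
  define m where "m = measure lborel \<Omega>"
  define C where "C = m / d powr p + total_flux * (d / d powr p)"
  have m: "m \<ge> 0" by (simp add: m_def)
  have C0: "C \<ge> 0" using m total_flux_nonneg d by (simp add: C_def)
  show ?thesis
  proof (intro exI[of _ C] conjI allI impI C0)
    fix R :: "(real^'n) set" and \<rho> assume R: "countable R" "0 \<in> R" "R \<subseteq> cball 0 \<rho>"
    have rho: "0 \<le> \<rho>" using R by auto
    let ?D = "\<bar>measure lborel (lost \<Omega> R) - (\<Sum>i<n. (SUP y\<in>R. y \<bullet> u i) * flux \<Omega> (\<zeta> i) (u i))\<bar>"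
    show "?D \<le> 2 * \<epsilon> * (total_flux + 1) * \<rho> + C * \<rho> powr p"
    proof (cases "\<rho> \<le> d")
      case True
      have "0 \<le> C * \<rho> powr p" using C0 by simp
      with d(2)[OF R True] show ?thesis by (simp add: algebra_simps)
    next
      case False
      have q: "d powr p \<le> \<rho> powr p" using False d p by (intro powr_mono2) auto
      have q1: "\<rho> \<le> \<rho> powr p * (d / d powr p)"
      proof -
        have "\<rho> powr (1 - p) \<le> d powr (1 - p)" using False d p by (intro powr_mono2') auto
        then have "\<rho> powr p * \<rho> powr (1 - p) \<le> \<rho> powr p * d powr (1 - p)" by (intro mult_left_mono) auto
        then show ?thesis using False d by (simp add: powr_diff)
      qed
      have q2: "m \<le> \<rho> powr p * (m / d powr p)"
        using q m d mult_left_mono[OF q m] by (simp add: field_simps)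
      have SUPn: "\<bar>SUP y\<in>R. y \<bullet> u i\<bar> \<le> \<rho>" if "i < n" for i
      proof -
        have b: "\<bar>y \<bullet> u i\<bar> \<le> \<rho>" if "y \<in> R" for y
          using Cauchy_Schwarz_ineq2[of y "u i"] norm_u(1)[OF \<open>i < n\<close>] R that by auto
        have "bdd_above ((\<lambda>y. y \<bullet> u i) ` R)" using b by (intro bdd_aboveI[of _ \<rho>]) (auto simp: abs_le_iff)
        then have "0 \<le> (SUP y\<in>R. y \<bullet> u i)" using cSUP_upper[OF R(2)] by force
        moreover have "(SUP y\<in>R. y \<bullet> u i) \<le> \<rho>" using R(2) b by (intro cSUP_least) (auto simp: abs_le_iff)
        ultimately show ?thesis by simp
      qed
      have "measure lborel (lost \<Omega> R) \<le> m"
        unfolding m_def using op bd emeasure_bounded_finite[OF bd] lost_borel[OF op R(1)]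
        by (intro measure_mono_fmeasurable fmeasurableI) (auto simp: lost_def)
      moreover have "\<bar>\<Sum>i<n. (SUP y\<in>R. y \<bullet> u i) * flux \<Omega> (\<zeta> i) (u i)\<bar> \<le> (\<Sum>i<n. \<rho> * flux \<Omega> (\<zeta> i) (u i))"
        using SUPn flux_patch_nonneg
        by (intro order_trans[OF sum_abs] sum_mono) (auto simp: abs_mult intro!: mult_right_mono)
      moreover have "(\<Sum>i<n. \<rho> * flux \<Omega> (\<zeta> i) (u i)) = total_flux * \<rho>"
        by (simp add: total_flux_def mult.commute sum_distrib_left)
      moreover have "0 \<le> measure lborel (lost \<Omega> R)" by simp
      ultimately have "?D \<le> m + total_flux * \<rho>" by linarith
      also have "\<dots> \<le> \<rho> powr p * (m / d powr p) + total_flux * (\<rho> powr p * (d / d powr p))"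
        using q1 q2 total_flux_nonneg by (intro add_mono mult_left_mono)
      also have "\<dots> = C * \<rho> powr p" by (simp add: C_def algebra_simps)
      also have "\<dots> \<le> 2 * \<epsilon> * (total_flux + 1) * \<rho> + C * \<rho> powr p"
        using eps total_flux_nonneg rho by simp
      finally show ?thesis .
    qed
  qed
qed

end

section \<open>Translates touching the boundary\<close>

lemma null_if_disjoint_translates:
  fixes N :: "'a::euclidean_space set"
  assumes N: "N \<in> sets borel" "bounded N" and s0: "s0 > 0"
    and disj: "\<And>x s. x \<in> N \<Longrightarrow> 0 < s \<Longrightarrow> s < s0 \<Longrightarrow> x + s *\<^sub>R u \<notin> N"
  shows "N \<in> null_sets lborel"
proof -
  have lN: "N \<in> lmeasurable" using N by (intro bounded_set_imp_lmeasurable) auto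
  obtain a where a: "\<And>x. x \<in> N \<Longrightarrow> norm x \<le> a" using N(2) by (auto simp: bounded_iff)
  define B where "B = measure lebesgue (cball (0::'a) (a + s0 * norm u))"
  have bound: "real n * measure lebesgue N \<le> B" for n
  proof -
    define h where "h = s0 / (real n + 1)"
    have h: "h > 0" using s0 by (simp add: h_def)
    have hs: "real i * h < s0" if "i \<le> n" for i
    proof -
      have "real i * h \<le> real n * h" using that h by simp
      also have "\<dots> < s0" using s0 by (simp add: h_def field_simps)
      finally show ?thesis .
    qed
    let ?T = "\<lambda>i::nat. (+) ((real i * h) *\<^sub>R u) ` N"
    have d1: "?T i \<inter> ?T j = {}" if ij: "i < j" "j < n" for i j
    proof (rule ccontr)
      assume "?T i \<inter> ?T j \<noteq> {}"
      then obtain x y where xy: "x \<in> N" "y \<in> N" "(real i * h) *\<^sub>R u + x = (real j * h) *\<^sub>R u + y" by blast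
      have "y + (real (j - i) * h) *\<^sub>R u = x"
        using xy(3) ij by (simp add: of_nat_diff algebra_simps)
      then show False using disj[OF xy(2), of "real (j - i) * h"] xy(1) ij h hs[of "j - i"] by auto
    qed
    then have "pairwise (\<lambda>i j. disjnt (?T i) (?T j)) {..<n}"
      unfolding pairwise_def disjnt_def by (metis Int_commute lessThan_iff nat_neq_iff)
    then have "measure lebesgue (\<Union>i\<in>{..<n}. ?T i) = (\<Sum>i<n. measure lebesgue (?T i))"
      using lN by (intro measure_UNION') (auto intro: measurable_translation)
    also have "\<dots> = real n * measure lebesgue N" by (simp add: measure_translation)
    finally have "real n * measure lebesgue N = measure lebesgue (\<Union>i\<in>{..<n}. ?T i)" by simp
    also have "\<dots> \<le> B" unfolding B_def
    proof (rule measure_mono_fmeasurable)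
      show "(\<Union>i\<in>{..<n}. ?T i) \<subseteq> cball 0 (a + s0 * norm u)"
      proof clarsimp
        fix i x assume i: "i < n" and x: "x \<in> N"
        have "norm ((real i * h) *\<^sub>R u + x) \<le> real i * h * norm u + norm x"
          using norm_triangle_ineq[of "(real i * h) *\<^sub>R u" x] h by simp
        moreover have "real i * h * norm u \<le> s0 * norm u"
          using hs[of i] i by (intro mult_right_mono) auto
        ultimately show "norm ((real i * h) *\<^sub>R u + x) \<le> a + s0 * norm u" using a[OF x] by linarith
      qed
      show "(\<Union>i\<in>{..<n}. ?T i) \<in> sets lebesgue"
        using lN by (intro sets.finite_UN fmeasurableD measurable_translation) auto
    qed auto
    finally show ?thesis .
  qed
  have "measure lebesgue N = 0"
  proof (rule ccontr)
    assume "measure lebesgue N \<noteq> 0"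
    then have "measure lebesgue N > 0" by (simp add: zero_less_measure_iff)
    then obtain n where "B < real n * measure lebesgue N" using reals_Archimedean3 by blast
    with bound[of n] show False by simp
  qed
  then have "N \<in> null_sets lebesgue"
    using lN by (intro null_setsI fmeasurableD) (simp_all add: emeasure_eq_measure2 del: emeasure_completion)
  then show ?thesis using N(1) by (simp add: null_sets_completion_iff)
qed

text \<open>The points \<open>x\<close> for which \<open>x + R\<close> is contained in \<open>\<Omega>\<close> but not in any compact subset of it form
  a null set. They are covered by sets \<open>N z\<close>, one for each ball of a finite cover of the frontier,
  which contain those \<open>x\<close> for which the closure of \<open>x + R\<close> meets the frontier within the ball.
  Shifting such an \<open>x\<close> along the outer normal \<open>u z\<close> moves some point of \<open>x + R\<close> near the contact
  point out of \<open>\<Omega>\<close>.\<close>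

lemma touching_translates_null:
  fixes \<Omega> :: "(real^'n) set"
  assumes op: "open \<Omega>" and bd: "bounded \<Omega>" and bdry: "C1_holder_boundary \<kappa> \<Omega>"
    and R: "countable R" "bounded R" "R \<noteq> {}"
  shows "\<exists>N\<in>null_sets lborel. \<forall>x. (\<forall>y\<in>R. x + y \<in> \<Omega>) \<longrightarrow>
    (\<forall>m::nat. \<exists>y\<in>R. infdist (x + y) (- \<Omega>) < inverse (real (Suc m))) \<longrightarrow> x \<in> N"
proof -
  obtain r u where c: "\<And>z. z \<in> frontier \<Omega> \<Longrightarrow> outer_cone \<Omega> (1 / 2) z (r z) (u z)"
    using outer_cone_exists[OF bdry, of _ "1 / 2"] by (metis half_gt_zero_iff zero_less_one)
  then have r: "z \<in> frontier \<Omega> \<Longrightarrow> r z > 0" for z by (simp add: outer_cone_def)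
  have comp: "compact (frontier \<Omega>)" using bd by (rule compact_frontier_bounded)
  obtain C where C: "C \<subseteq> frontier \<Omega>" "finite C" "frontier \<Omega> \<subseteq> (\<Union>z\<in>C. ball z (r z / 2))"
  proof (rule compactE_image[OF comp, of "frontier \<Omega>" "\<lambda>z. ball z (r z / 2)"])
    show "frontier \<Omega> \<subseteq> (\<Union>z\<in>frontier \<Omega>. ball z (r z / 2))" using r by force
  qed auto
  define K where "K = closure R"
  have K: "compact K" using R(2) by (simp add: K_def compact_closure)
  have ne: "- \<Omega> \<noteq> {}" using bd not_bounded_UNIV by (metis Compl_UNIV_eq double_complement)
  define N where "N z = {x. \<forall>y\<in>R. x + y \<in> \<Omega>} \<inter>
      {b - y |b y. b \<in> frontier \<Omega> \<inter> cball z (r z / 2) \<and> y \<in> K}" for z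
  have "N z \<in> null_sets lborel" if z: "z \<in> C" for z
  proof (rule null_if_disjoint_translates)
    have zF: "z \<in> frontier \<Omega>" using z C by blast
    have u1: "norm (u z) = 1" using c[OF zF] by (simp add: outer_cone_def)
    have D: "compact {b - y |b y. b \<in> frontier \<Omega> \<inter> cball z (r z / 2) \<and> y \<in> K}"
      using comp K by (intro compact_differences compact_Int_closed) auto
    have "open ((\<lambda>x. x + y) -` \<Omega>)" for y
      using op by (intro open_vimage continuous_intros)
    moreover have "{x. \<forall>y\<in>R. x + y \<in> \<Omega>} = (\<Inter>y\<in>R. (\<lambda>x. x + y) -` \<Omega>)" by auto
    ultimately have "{x. \<forall>y\<in>R. x + y \<in> \<Omega>} \<in> sets borel"
      using R by (auto intro!: sets.countable_INT'')
    then show "N z \<in> sets borel" unfolding N_def by (rule sets.Int[OF _ borel_compact[OF D]])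
    show "bounded (N z)" unfolding N_def by (rule bounded_subset[OF compact_imp_bounded[OF D]]) blast
    show "r z / 4 > 0" using r[OF zF] by simp
    fix x s assume x: "x \<in> N z" and s: "0 < s" "s < r z / 4"
    then obtain b y where b: "b \<in> frontier \<Omega>" "b \<in> cball z (r z / 2)" and y: "y \<in> K" and xe: "x = b - y"
      unfolding N_def by blast
    have "s / 3 > 0" using s by simp
    then obtain y' where y': "y' \<in> R" "dist y' y < s / 3"
      using y unfolding K_def closure_approachable by blast
    define v where "v = s *\<^sub>R u z + (y' - y)"
    have nd: "norm (y' - y) < s / 3" using y' by (simp add: dist_norm)
    have nv: "norm v \<le> s + s / 3"
      using norm_triangle_ineq[of "s *\<^sub>R u z" "y' - y"] nd u1 s by (simp add: v_def)
    have "\<bar>(y' - y) \<bullet> u z\<bar> \<le> s / 3" using Cauchy_Schwarz_ineq2[of "y' - y" "u z"] u1 nd by simp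
    moreover have "u z \<bullet> u z = 1" using u1 by (simp add: norm_eq_1)
    ultimately have "1 / 2 * norm v \<le> v \<bullet> u z" using nv by (simp add: v_def inner_add_left)
    moreover have "b \<notin> \<Omega>" using b(1) op by (simp add: frontier_def interior_open)
    moreover have "b \<in> ball z (r z)" using b(2) r[OF zF] by auto
    moreover have "b + v \<in> ball z (r z)"
    proof -
      have "dist z (b + v) \<le> dist z b + norm v"
        using norm_triangle_ineq[of "b - z" v] by (simp add: dist_norm norm_minus_commute algebra_simps)
      then show ?thesis using nv s b(2) by simp
    qed
    ultimately have "b + v \<notin> \<Omega>" by (intro outer_coneD[OF c[OF zF]])
    then have "(x + s *\<^sub>R u z) + y' \<notin> \<Omega>" by (simp add: xe v_def algebra_simps)
    then show "x + s *\<^sub>R u z \<notin> N z" using y'(1) unfolding N_def by blast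
  qed
  then have "(\<Union>z\<in>C. N z) \<in> null_sets lborel"
    using C(2) by (intro null_sets_UN') (auto intro: countable_finite)
  moreover have "x \<in> (\<Union>z\<in>C. N z)" if x: "\<forall>y\<in>R. x + y \<in> \<Omega>"
    "\<forall>m::nat. \<exists>y\<in>R. infdist (x + y) (- \<Omega>) < inverse (real (Suc m))" for x
  proof -
    have "\<exists>y\<in>K. \<forall>y'\<in>K. infdist (x + y) (- \<Omega>) \<le> infdist (x + y') (- \<Omega>)"
      using R(3) by (intro continuous_attains_inf K continuous_intros) (auto simp: K_def)
    then obtain y where y: "y \<in> K" and min: "\<And>y'. y' \<in> K \<Longrightarrow> infdist (x + y) (- \<Omega>) \<le> infdist (x + y') (- \<Omega>)"
      by blast
    have "infdist (x + y) (- \<Omega>) = 0"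
    proof (rule ccontr)
      assume "infdist (x + y) (- \<Omega>) \<noteq> 0"
      then have "0 < infdist (x + y) (- \<Omega>)" using infdist_nonneg[of "x + y" "- \<Omega>"] by linarith
      then obtain m where m: "inverse (real (Suc m)) < infdist (x + y) (- \<Omega>)"
        using reals_Archimedean by blast
      obtain y' where "y' \<in> R" "infdist (x + y') (- \<Omega>) < inverse (real (Suc m))" using x(2) by blast
      with min[of y'] m show False using closure_subset[of R] by (auto simp: K_def)
    qed
    then have "x + y \<notin> \<Omega>"
      using op ne in_closed_iff_infdist_zero[of "- \<Omega>" "x + y"] by (simp add: closed_Compl)
    moreover have "x + y \<in> closure \<Omega>"
    proof -
      have "(+) x ` closure R \<subseteq> closure ((+) x ` R)" by (simp add: closure_translation)
      also have "\<dots> \<subseteq> closure \<Omega>" using x(1) by (intro closure_mono) auto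
      finally show ?thesis using y by (auto simp: K_def)
    qed
    ultimately have xF: "x + y \<in> frontier \<Omega>" using op by (simp add: frontier_def interior_open)
    then obtain z where z: "z \<in> C" "x + y \<in> ball z (r z / 2)" using C(3) by blast
    then have "x + y \<in> frontier \<Omega> \<inter> cball z (r z / 2)" using xF by auto
    moreover have "x = (x + y) - y" by simp
    ultimately have "x \<in> N z" unfolding N_def using x(1) y by blast
    then show ?thesis using z by blast
  qed
  ultimately show ?thesis by blast
qed

section \<open>Cadlag paths and exit times\<close>

text \<open>A countable dense subset of \<open>{0..t}\<close>, for \<open>t \<ge> 0\<close>, that contains the end point \<open>t\<close>, where right-continuity gives
  no information on the path in terms of other times.\<close>

definition sample_times :: "real \<Rightarrow> real set" where
  "sample_times t = (\<lambda>q. q * t) ` ({0..1} \<inter> \<rat>)"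

lemma countable_sample_times: "countable (sample_times t)"
  unfolding sample_times_def by (intro countable_image countable_Int2 countable_rat)

lemma sample_times_subset: "0 \<le> t \<Longrightarrow> sample_times t \<subseteq> {0..t}"
  by (auto simp: sample_times_def mult_left_le_one_le)

lemma zero_in_sample_times: "0 \<in> sample_times t"
  unfolding sample_times_def by (rule image_eqI[of _ _ 0]) auto

lemma cadlag_bounded:
  fixes f :: "real \<Rightarrow> 'a::euclidean_space"
  assumes f: "cadlag f"
  shows "bounded (f ` {0..t})"
proof -
  have "\<exists>U. open U \<and> s \<in> U \<and> bounded (f ` (U \<inter> {0..t}))" if s: "s \<in> {0..t}" for s
  proof -
    have "(f \<longlongrightarrow> f s) (at_right s)" using f s by (simp add: cadlag_def)
    then have "\<forall>\<^sub>F x in at_right s. dist (f x) (f s) < 1" by (rule tendstoD) simp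
    then obtain b where b: "s < b" "\<And>x. s < x \<Longrightarrow> x < b \<Longrightarrow> dist (f x) (f s) < 1"
      unfolding eventually_at_right_field by blast
    obtain a l where a: "a < s" "\<And>x. a < x \<Longrightarrow> x < s \<Longrightarrow> 0 \<le> x \<Longrightarrow> dist (f x) l < 1"
    proof (cases "s = 0")
      case True
      then show ?thesis using that[of "-1"] by auto
    next
      case False
      then have "0 < s" using s by simp
      then obtain l where "(f \<longlongrightarrow> l) (at_left s)" using f unfolding cadlag_def by blast
      then have "\<forall>\<^sub>F x in at_left s. dist (f x) l < 1" by (rule tendstoD) simp
      then show ?thesis using that unfolding eventually_at_left_field by blast
    qed
    have "f ` ({a<..<b} \<inter> {0..t}) \<subseteq> ball l 1 \<union> ball (f s) 1"
    proof (clarsimp, goal_cases)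
      case (1 x)
      then show ?case using a(2)[of x] b(2)[of x]
        by (cases x s rule: linorder_cases) (auto simp: dist_commute)
    qed
    then have "bounded (f ` ({a<..<b} \<inter> {0..t}))" by (rule bounded_subset[rotated]) simp
    then show ?thesis using a(1) b(1) by (intro exI[of _ "{a<..<b}"]) auto
  qed
  then obtain U where U: "\<And>s. s \<in> {0..t} \<Longrightarrow> open (U s)" "\<And>s. s \<in> {0..t} \<Longrightarrow> s \<in> U s"
    "\<And>s. s \<in> {0..t} \<Longrightarrow> bounded (f ` (U s \<inter> {0..t}))" by metis
  obtain C where C: "C \<subseteq> {0..t}" "finite C" "{0..t} \<subseteq> (\<Union>s\<in>C. U s)"
  proof (rule compactE_image[of "{0..t}" "{0..t}" U])
    show "{0..t} \<subseteq> (\<Union>s\<in>{0..t}. U s)" using U(2) by blast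
  qed (use U in auto)
  have "f ` {0..t} \<subseteq> (\<Union>s\<in>C. f ` (U s \<inter> {0..t}))" using C(3) by blast
  moreover have "bounded (\<Union>s\<in>C. f ` (U s \<inter> {0..t}))" using C U(3) by (intro bounded_UN) auto
  ultimately show ?thesis by (rule bounded_subset[rotated])
qed

lemma cadlag_in_closure_sampled:
  fixes f :: "real \<Rightarrow> 'a::metric_space"
  assumes f: "cadlag f" and s: "0 \<le> s" "s \<le> t"
  shows "f s \<in> closure (f ` sample_times t)"
proof (cases "s = t")
  case True
  have "t \<in> sample_times t" unfolding sample_times_def by (rule image_eqI[of _ _ 1]) auto
  then have "f t \<in> f ` sample_times t" by (rule imageI)
  then show ?thesis unfolding True by (rule subsetD[OF closure_subset])
next
  case False
  then have st: "s < t" "0 < t" using s by auto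
  show ?thesis unfolding closure_approachable
  proof (intro allI impI)
    fix e :: real assume "e > 0"
    have "(f \<longlongrightarrow> f s) (at_right s)" using f s by (simp add: cadlag_def)
    then have "\<forall>\<^sub>F x in at_right s. dist (f x) (f s) < e" using \<open>e > 0\<close> by (rule tendstoD)
    then obtain b where b: "s < b" "\<And>x. s < x \<Longrightarrow> x < b \<Longrightarrow> dist (f x) (f s) < e"
      unfolding eventually_at_right_field by blast
    have "s / t < min b t / t" using b st by (intro divide_strict_right_mono) auto
    then obtain q where q: "q \<in> \<rat>" "s / t < q" "q < min b t / t" using Rats_dense_in_real by blast
    have "s < q * t" "q * t < min b t" using q st by (auto simp: field_simps)
    moreover then have "q * t \<in> sample_times t" unfolding sample_times_def
      using q s st by (intro imageI) (auto simp: field_simps intro: order_trans[of 0 "s / t" q])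
    ultimately show "\<exists>y\<in>f ` sample_times t. dist y (f s) < e" using b(2) by auto
  qed
qed

lemma exit_time_gt_if_in:
  assumes "open \<Omega>" and f: "cadlag (\<lambda>t. X t \<omega>)" and t: "0 \<le> t" and stay: "\<And>s. 0 \<le> s \<Longrightarrow> s \<le> t \<Longrightarrow> X s \<omega> \<in> \<Omega>"
  shows "ereal t < exit_time X \<Omega> \<omega>"
proof -
  have "((\<lambda>t. X t \<omega>) \<longlongrightarrow> X t \<omega>) (at_right t)" using f t by (simp add: cadlag_def)
  then have "\<forall>\<^sub>F s in at_right t. X s \<omega> \<in> \<Omega>"
    using assms(1) stay[OF t order_refl] by (rule topological_tendstoD)
  then obtain b where b: "t < b" "\<And>s. t < s \<Longrightarrow> s < b \<Longrightarrow> X s \<omega> \<in> \<Omega>"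
    unfolding eventually_at_right_field by blast
  have "ereal b \<le> exit_time X \<Omega> \<omega>"
    unfolding exit_time_def
  proof (rule Inf_greatest, clarsimp)
    fix s assume "0 \<le> s" "X s \<omega> \<notin> \<Omega>"
    then show "b \<le> s" using b(2)[of s] stay[of s] by force
  qed
  then show ?thesis using b(1) by (meson ereal_less_eq(3) less_ereal.simps(1) order_less_le_trans)
qed

lemma in_if_exit_time_gt:
  assumes "ereal t < exit_time X \<Omega> \<omega>" "0 \<le> s" "s \<le> t"
  shows "X s \<omega> \<in> \<Omega>"
proof (rule ccontr)
  assume "X s \<omega> \<notin> \<Omega>"
  then have "exit_time X \<Omega> \<omega> \<le> ereal s" unfolding exit_time_def using assms by (intro Inf_lower) auto
  with assms show False by (meson ereal_less_eq(3) leD order_trans)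
qed

section \<open>Isotropic processes\<close>

lemma sets_Collect_countable_times:
  assumes "countable D" "D \<noteq> {}" "\<And>s. s \<in> D \<Longrightarrow> {w \<in> space M. Q s w} \<in> sets M"
  shows "{w \<in> space M. \<forall>s\<in>D. Q s w} \<in> sets M"
proof -
  have "(\<Inter>s\<in>D. {w \<in> space M. Q s w}) \<in> sets M" using assms by (intro sets.countable_INT') auto
  moreover have "(\<Inter>s\<in>D. {w \<in> space M. Q s w}) = {w \<in> space M. \<forall>s\<in>D. Q s w}" using assms(2) by auto
  ultimately show ?thesis by simp
qed

text \<open>Equality of the finite-dimensional distributions extends to events that refer to countably many
  times, by continuity from above.\<close>

lemma measure_countable_times_eq:
  fixes M M' :: "'a measure"
  assumes M: "finite_measure M" "finite_measure M'" and D: "countable D" "D \<noteq> {}"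
    and meas: "\<And>s. s \<in> D \<Longrightarrow> {w \<in> space M. Q s w} \<in> sets M" "\<And>s. s \<in> D \<Longrightarrow> {w \<in> space M'. Q' s w} \<in> sets M'"
    and eq: "\<And>J. finite J \<Longrightarrow> J \<subseteq> D \<Longrightarrow>
      measure M {w \<in> space M. \<forall>s\<in>J. Q s w} = measure M' {w \<in> space M'. \<forall>s\<in>J. Q' s w}"
  shows "measure M {w \<in> space M. \<forall>s\<in>D. Q s w} = measure M' {w \<in> space M'. \<forall>s\<in>D. Q' s w}"
proof -
  define J where "J n = from_nat_into D ` {..n}" for n
  have J: "finite (J n)" "J n \<noteq> {}" "J n \<subseteq> D" for n
    using from_nat_into[OF D(2)] by (auto simp: J_def)
  have mono: "m \<le> n \<Longrightarrow> J m \<subseteq> J n" for m n by (auto simp: J_def)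
  have UN: "(\<Union>n. J n) = D"
  proof
    show "D \<subseteq> (\<Union>n. J n)"
    proof
      fix s assume "s \<in> D"
      then have "s = from_nat_into D (to_nat_on D s)" using D by simp
      then show "s \<in> (\<Union>n. J n)" unfolding J_def by blast
    qed
  qed (use J in blast)
  have lim: "(\<lambda>n. measure N {w \<in> space N. \<forall>s\<in>J n. F s w}) \<longlonglongrightarrow> measure N {w \<in> space N. \<forall>s\<in>D. F s w}"
    if N: "finite_measure N" and F: "\<And>s. s \<in> D \<Longrightarrow> {w \<in> space N. F s w} \<in> sets N" for N :: "'a measure" and F
  proof -
    interpret finite_measure N by (rule N)
    have "(\<lambda>n. measure N {w \<in> space N. \<forall>s\<in>J n. F s w}) \<longlonglongrightarrow> measure N (\<Inter>n. {w \<in> space N. \<forall>s\<in>J n. F s w})"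
    proof (rule finite_Lim_measure_decseq)
      show "range (\<lambda>n. {w \<in> space N. \<forall>s\<in>J n. F s w}) \<subseteq> sets N"
      proof clarify
        fix n
        show "{w \<in> space N. \<forall>s\<in>J n. F s w} \<in> sets N"
          using J[of n] F by (intro sets_Collect_countable_times) (auto intro: countable_finite)
      qed
      show "decseq (\<lambda>n. {w \<in> space N. \<forall>s\<in>J n. F s w})"
        using mono unfolding decseq_def by blast
    qed
    also have "(\<Inter>n. {w \<in> space N. \<forall>s\<in>J n. F s w}) = {w \<in> space N. \<forall>s\<in>D. F s w}"
      using UN by blast
    finally show ?thesis .
  qed
  have "(\<lambda>n. measure M {w \<in> space M. \<forall>s\<in>J n. Q s w}) \<longlonglongrightarrow> measure M {w \<in> space M. \<forall>s\<in>D. Q s w}"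
    using M(1) meas(1) by (rule lim)
  moreover have "(\<lambda>n. measure M' {w \<in> space M'. \<forall>s\<in>J n. Q' s w}) \<longlonglongrightarrow> measure M' {w \<in> space M'. \<forall>s\<in>D. Q' s w}"
    using M(2) meas(2) by (rule lim)
  ultimately show ?thesis unfolding eq[OF J(1,3)] by (rule LIMSEQ_unique)
qed

lemma measure_completion_between:
  assumes "finite_measure M" and A: "A \<in> sets M" and B: "B \<in> sets M" and E: "A \<subseteq> E" "E \<subseteq> B"
    and eq: "measure M A = measure M B"
  shows "measure (completion M) E = measure M B"
proof -
  interpret finite_measure M by fact
  have "measure M (B - A) = 0" using A B E eq by (simp add: finite_measure_Diff)
  then have "B - A \<in> null_sets M" using A B by (intro null_setsI) (auto simp: emeasure_eq_measure)
  then have "B - A \<in> null_sets (completion M)" by (rule null_sets_completionI)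
  then have N: "E - A \<in> null_sets (completion M)" by (rule null_sets_completion_subset[rotated]) (use E in blast)
  have "E = A \<union> (E - A)" using E by blast
  then have "measure (completion M) E = measure (completion M) A"
    using measure_Un_null_set[OF _ N, of A] A by (metis sets_completionI_sets)
  then show ?thesis using A eq by simp
qed

lemma borel_measurable_lebesgue_AE_cong:
  fixes f g :: "'a::euclidean_space \<Rightarrow> real"
  assumes g: "g \<in> borel_measurable borel" and ae: "AE x in lborel. f x = g x"
  shows "f \<in> borel_measurable lebesgue"
proof (rule measurableI)
  fix A :: "real set" assume A: "A \<in> sets borel"
  have "AE x in lebesgue. x \<in> g -` A \<longleftrightarrow> x \<in> f -` A"
    using AE_completion[OF ae] by eventually_elim simp
  moreover have "g -` A \<in> sets lebesgue"
    using measurable_sets[OF g A] by (simp add: sets_completionI_sets)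
  ultimately show "f -` A \<inter> space lebesgue \<in> sets lebesgue"
    using completion.in_sets_AE[where A="g -` A" and B="f -` A" and M=lborel] by simp
qed simp

text \<open>Everything takes place on the probability space \<open>P 0\<close>, which is installed as a sublocale; the
  measures \<open>P x\<close> are related to it by translation invariance.\<close>

locale isotropic_process =
  fixes P :: "real^'n \<Rightarrow> 'w measure" and X :: "real \<Rightarrow> 'w \<Rightarrow> real^'n"
  assumes cadlag_process: "cadlag_process P X"
    and translation_invariant: "translation_invariant P X" and isotropic: "isotropic P X"
begin

sublocale prob_space "P 0"
  using cadlag_process by (simp add: cadlag_process_def)

lemma prob_space_P: "prob_space (P x)" and sets_P: "sets (P x) = sets (P 0)"
  and X_measurable: "0 \<le> s \<Longrightarrow> X s \<in> borel_measurable (P 0)"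
  and X_cadlag: "\<omega> \<in> space (P 0) \<Longrightarrow> cadlag (\<lambda>t. X t \<omega>)"
  and X_start: "AE \<omega> in P x. X 0 \<omega> = x"
  using cadlag_process by (auto simp: cadlag_process_def)

lemma space_P: "space (P x) = space (P 0)" using sets_P by (rule sets_eq_imp_space_eq)

text \<open>The positions at a countable dense set of times up to \<open>t\<close>.\<close>

definition sampled :: "real \<Rightarrow> 'w \<Rightarrow> (real^'n) set" where
  "sampled t \<omega> = (\<lambda>s. X s \<omega>) ` sample_times t"

text \<open>The running supremum along \<open>u\<close>, over the sample times only. For a cadlag path this is the
  supremum over all times (\<open>running_sup_eq_directional_sup\<close>).\<close>

definition directional_sup :: "real^'n \<Rightarrow> real \<Rightarrow> 'w \<Rightarrow> real" where
  "directional_sup u t \<omega> = (SUP y\<in>sampled t \<omega>. y \<bullet> u)"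

lemma countable_sampled: "countable (sampled t \<omega>)"
  unfolding sampled_def by (intro countable_image countable_sample_times)

lemma sampled_nonempty: "sampled t \<omega> \<noteq> {}"
  using zero_in_sample_times by (auto simp: sampled_def)

lemma bounded_path: "\<omega> \<in> space (P 0) \<Longrightarrow> bounded ((\<lambda>s. X s \<omega>) ` {0..t})"
  by (intro cadlag_bounded X_cadlag)

lemma bounded_sampled:
  assumes "\<omega> \<in> space (P 0)" "0 \<le> t"
  shows "bounded (sampled t \<omega>)"
  unfolding sampled_def
  by (rule bounded_subset[OF bounded_path[OF assms(1), of t]]) (intro image_mono sample_times_subset assms(2))

lemma bdd_above_inner:
  fixes S :: "(real^'n) set"
  assumes "bounded S"
  shows "bdd_above ((\<lambda>y. y \<bullet> u) ` S)"
proof -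
  obtain a where a: "\<And>y. y \<in> S \<Longrightarrow> norm y \<le> a" using assms by (auto simp: bounded_iff)
  have "y \<bullet> u \<le> a * norm u" if "y \<in> S" for y
    using norm_cauchy_schwarz[of y u] mult_right_mono[OF a[OF that], of "norm u"] by simp
  then show ?thesis by (intro bdd_aboveI[of _ "a * norm u"]) auto
qed

lemma inner_le_directional_sup:
  "\<omega> \<in> space (P 0) \<Longrightarrow> 0 \<le> t \<Longrightarrow> y \<in> sampled t \<omega> \<Longrightarrow> y \<bullet> u \<le> directional_sup u t \<omega>"
  unfolding directional_sup_def by (intro cSUP_upper bdd_above_inner bounded_sampled)

lemma directional_sup_le_iff:
  assumes "\<omega> \<in> space (P 0)" "0 \<le> t"
  shows "directional_sup u t \<omega> \<le> c \<longleftrightarrow> (\<forall>s\<in>sample_times t. X s \<omega> \<bullet> u \<le> c)"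
  unfolding directional_sup_def
  using bdd_above_inner[OF bounded_sampled[OF assms]] sampled_nonempty
  by (subst cSUP_le_iff) (auto simp: sampled_def)

lemma running_sup_eq_directional_sup:
  assumes \<omega>: "\<omega> \<in> space (P 0)" and t: "0 \<le> t"
  shows "running_sup X k t \<omega> = directional_sup (axis k 1) t \<omega>"
proof (rule antisym)
  have "X s \<omega> $ k \<le> directional_sup (axis k 1) t \<omega>" if s: "s \<in> {0..t}" for s
  proof -
    have "sampled t \<omega> \<subseteq> {y. y \<bullet> axis k 1 \<le> directional_sup (axis k 1) t \<omega>}"
      using inner_le_directional_sup[OF \<omega> t] by blast
    then have "closure (sampled t \<omega>) \<subseteq> {y. y \<bullet> axis k 1 \<le> directional_sup (axis k 1) t \<omega>}"
      by (rule closure_minimal) (intro closed_Collect_le continuous_intros)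
    then show ?thesis
      using cadlag_in_closure_sampled[OF X_cadlag[OF \<omega>]] s by (auto simp: sampled_def inner_axis)
  qed
  then show "running_sup X k t \<omega> \<le> directional_sup (axis k 1) t \<omega>"
    unfolding running_sup_def using t by (intro cSUP_least) auto
  have "bdd_above ((\<lambda>y. y \<bullet> axis k 1) ` ((\<lambda>s. X s \<omega>) ` {0..t}))"
    by (intro bdd_above_inner bounded_path \<omega>)
  then have "bdd_above ((\<lambda>s. X s \<omega> $ k) ` {0..t})" by (simp add: image_image inner_axis)
  then have "X s \<omega> $ k \<le> running_sup X k t \<omega>" if "s \<in> {0..t}" for s
    unfolding running_sup_def using that by (intro cSUP_upper)
  then show "directional_sup (axis k 1) t \<omega> \<le> running_sup X k t \<omega>"
    using sample_times_subset[OF t] by (subst directional_sup_le_iff[OF \<omega> t]) (auto simp: inner_axis)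
qed

lemma directional_sup_measurable:
  assumes t: "0 \<le> t"
  shows "directional_sup u t \<in> borel_measurable (P 0)"
proof -
  have "(\<lambda>\<omega>. SUP s\<in>sample_times t. X s \<omega> \<bullet> u) \<in> borel_measurable (P 0)"
  proof (rule borel_measurable_cSUP[OF countable_sample_times])
    fix s assume "s \<in> sample_times t"
    then have "0 \<le> s" using sample_times_subset[OF t] by auto
    then show "(\<lambda>\<omega>. X s \<omega> \<bullet> u) \<in> borel_measurable (P 0)"
      using X_measurable by (intro borel_measurable_inner) auto
  next
    fix \<omega> assume "\<omega> \<in> space (P 0)"
    from bdd_above_inner[OF bounded_sampled[OF this t]]
    show "bdd_above ((\<lambda>s. X s \<omega> \<bullet> u) ` sample_times t)" by (simp add: sampled_def image_image)
  qed
  then show ?thesis by (simp add: directional_sup_def[abs_def] sampled_def image_image)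
qed

lemma X_event:
  assumes "0 \<le> t" "s \<in> sample_times t" "A \<in> sets borel" "f \<in> borel_measurable borel"
  shows "{\<omega> \<in> space (P 0). f (X s \<omega>) \<in> A} \<in> sets (P 0)"
proof -
  have "0 \<le> s" using assms(1,2) sample_times_subset by force
  then have "(\<lambda>\<omega>. f (X s \<omega>)) \<in> borel_measurable (P 0)"
    using X_measurable assms(4) by (intro measurable_compose[of "X s" "P 0" borel f]) auto
  from measurable_sets[OF this assms(3)] show ?thesis by (simp add: vimage_def Int_def conj_commute)
qed

text \<open>An orthogonal matrix whose \<open>k\<close>-th row is \<open>u\<close> carries the component along \<open>u\<close> to the \<open>k\<close>-th
  coordinate.\<close>

lemma directional_sup_law:
  assumes u: "norm u = 1" and t: "0 \<le> t"
  shows "distr (P 0) borel (directional_sup u t) = distr (P 0) borel (directional_sup (axis k 1) t)"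
proof (rule cdf_unique)
  obtain A where A: "orthogonal_matrix A" "A *v axis k 1 = u"
    using orthogonal_matrix_exists_basis[OF u] .
  define U where "U = transpose A"
  have U: "orthogonal_matrix U" using A(1) by (simp add: U_def orthogonal_matrix_transpose)
  have Uk: "(U *v y) $ k = y \<bullet> u" for y
  proof -
    have "(U *v y) $ k = (y v* A) \<bullet> axis k 1" by (simp add: U_def inner_axis)
    also have "\<dots> = y \<bullet> u" by (simp only: dot_lmul_matrix A(2))
    finally show ?thesis .
  qed
  have "measure (P 0) {\<omega> \<in> space (P 0). directional_sup u t \<omega> \<le> c} =
      measure (P 0) {\<omega> \<in> space (P 0). directional_sup (axis k 1) t \<omega> \<le> c}" for c
  proof -
    have cl: "{y::real^'n. y $ k \<le> c} \<in> sets borel"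
      by (intro borel_closed closed_Collect_le continuous_intros)
    have "measure (P 0) {\<omega> \<in> space (P 0). \<forall>s\<in>sample_times t. X s \<omega> \<in> {y. y $ k \<le> c}} =
        measure (P 0) {\<omega> \<in> space (P 0). \<forall>s\<in>sample_times t. U *v X s \<omega> \<in> {y. y $ k \<le> c}}"
    proof (rule measure_countable_times_eq)
      show "finite_measure (P 0)" by unfold_locales
      show "finite_measure (P 0)" by unfold_locales
      show "{\<omega> \<in> space (P 0). X s \<omega> \<in> {y. y $ k \<le> c}} \<in> sets (P 0)" if "s \<in> sample_times t" for s
        using X_event[OF t that cl, of "\<lambda>x. x"] by simp
      show "{\<omega> \<in> space (P 0). U *v X s \<omega> \<in> {y. y $ k \<le> c}} \<in> sets (P 0)" if "s \<in> sample_times t" for s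
        using t that cl by (intro X_event) (auto intro!: borel_measurable_continuous_onI linear_continuous_on)
      fix J assume J: "finite J" "J \<subseteq> sample_times t"
      moreover have "J \<subseteq> {0..}" using J sample_times_subset[OF t] by auto
      ultimately show "measure (P 0) {\<omega> \<in> space (P 0). \<forall>s\<in>J. X s \<omega> \<in> {y. y $ k \<le> c}} =
        measure (P 0) {\<omega> \<in> space (P 0). \<forall>s\<in>J. U *v X s \<omega> \<in> {y. y $ k \<le> c}}"
        using isotropic[unfolded isotropic_def, rule_format, OF U J(1), of "\<lambda>_. {y. y $ k \<le> c}"] cl by blast
    qed (use countable_sample_times zero_in_sample_times in auto)
    moreover have "{\<omega> \<in> space (P 0). directional_sup u t \<omega> \<le> c} =
        {\<omega> \<in> space (P 0). \<forall>s\<in>sample_times t. U *v X s \<omega> \<in> {y. y $ k \<le> c}}"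
      using directional_sup_le_iff[OF _ t] by (auto simp: Uk)
    moreover have "{\<omega> \<in> space (P 0). directional_sup (axis k 1) t \<omega> \<le> c} =
        {\<omega> \<in> space (P 0). \<forall>s\<in>sample_times t. X s \<omega> \<in> {y. y $ k \<le> c}}"
      using directional_sup_le_iff[OF _ t] by (auto simp: inner_axis)
    ultimately show ?thesis by simp
  qed
  moreover have "cdf (distr (P 0) borel (directional_sup v t)) c =
      measure (P 0) {\<omega> \<in> space (P 0). directional_sup v t \<omega> \<le> c}" for v c
    using directional_sup_measurable[OF t]
    by (simp add: cdf_def2 measure_distr vimage_def Int_def conj_commute)
  ultimately show "cdf (distr (P 0) borel (directional_sup u t)) =
      cdf (distr (P 0) borel (directional_sup (axis k 1) t))" by (intro ext) simp
qed (use directional_sup_measurable[OF t] in \<open>auto intro!: real_distribution_distr\<close>)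

lemma directional_sup_expectation:
  assumes u: "norm u = 1" and t: "0 \<le> t" and f: "f \<in> borel_measurable borel"
  shows "integrable (P 0) (\<lambda>\<omega>. f (directional_sup u t \<omega>) :: real) \<longleftrightarrow>
      integrable (P 0) (\<lambda>\<omega>. f (running_sup X k t \<omega>))"
    and "(LINT \<omega>|P 0. f (directional_sup u t \<omega>)) = (LINT \<omega>|P 0. f (running_sup X k t \<omega>))"
proof -
  have r: "integrable (P 0) (\<lambda>\<omega>. f (running_sup X k t \<omega>)) =
      integrable (P 0) (\<lambda>\<omega>. f (directional_sup (axis k 1) t \<omega>))"
    by (intro Bochner_Integration.integrable_cong) (simp_all add: running_sup_eq_directional_sup t)
  have r': "(LINT \<omega>|P 0. f (running_sup X k t \<omega>)) = (LINT \<omega>|P 0. f (directional_sup (axis k 1) t \<omega>))"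
    by (intro Bochner_Integration.integral_cong) (simp_all add: running_sup_eq_directional_sup t)
  note m = directional_sup_measurable[OF t]
  show "integrable (P 0) (\<lambda>\<omega>. f (directional_sup u t \<omega>) :: real) \<longleftrightarrow>
      integrable (P 0) (\<lambda>\<omega>. f (running_sup X k t \<omega>))"
    unfolding r integrable_distr_eq[OF m f, symmetric] directional_sup_law[OF u t, of k] ..
  show "(LINT \<omega>|P 0. f (directional_sup u t \<omega>)) = (LINT \<omega>|P 0. f (running_sup X k t \<omega>))"
    unfolding r' integral_distr[OF m f, symmetric] directional_sup_law[OF u t, of k] ..
qed

end

section \<open>Heat loss as an expected volume\<close>

context isotropic_process
begin

lemma prob_countable_times_shift:
  assumes t: "0 \<le> t" and A: "A \<in> sets borel"
  shows "measure (P x) {\<omega> \<in> space (P 0). \<forall>s\<in>sample_times t. X s \<omega> \<in> A} =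
    measure (P 0) {\<omega> \<in> space (P 0). \<forall>s\<in>sample_times t. X s \<omega> + x \<in> A}"
proof -
  have "measure (P x) {\<omega> \<in> space (P x). \<forall>s\<in>sample_times t. X s \<omega> \<in> A} =
    measure (P 0) {\<omega> \<in> space (P 0). \<forall>s\<in>sample_times t. X s \<omega> + x \<in> A}"
  proof (rule measure_countable_times_eq)
    show "finite_measure (P x)" using prob_space_P[of x] by (simp add: prob_space_def)
    show "finite_measure (P 0)" by unfold_locales
    show "{\<omega> \<in> space (P x). X s \<omega> \<in> A} \<in> sets (P x)" if "s \<in> sample_times t" for s
      using X_event[OF t that A, of "\<lambda>x. x"] by (simp add: space_P[of x] sets_P[of x])
    show "{\<omega> \<in> space (P 0). X s \<omega> + x \<in> A} \<in> sets (P 0)" if "s \<in> sample_times t" for s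
      using t that A by (intro X_event) auto
    fix J assume J: "finite J" "J \<subseteq> sample_times t"
    moreover have "J \<subseteq> {0..}" using J sample_times_subset[OF t] by auto
    ultimately show "measure (P x) {\<omega> \<in> space (P x). \<forall>s\<in>J. X s \<omega> \<in> A} =
      measure (P 0) {\<omega> \<in> space (P 0). \<forall>s\<in>J. X s \<omega> + x \<in> A}"
      using translation_invariant[unfolded translation_invariant_def, rule_format, of J "\<lambda>_. A" x] A by blast
  qed (use countable_sample_times zero_in_sample_times in auto)
  then show ?thesis by (simp add: space_P[of x])
qed

lemma sampled_event:
  assumes t: "0 \<le> t" and A: "A \<in> sets borel"
  shows "{\<omega> \<in> space (P 0). \<forall>s\<in>sample_times t. X s \<omega> + x \<in> A} \<in> sets (P 0)"
  using X_event[OF t _ A, of _ "\<lambda>y. y + x"] countable_sample_times zero_in_sample_times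
  by (intro sets_Collect_countable_times) auto

text \<open>\<open>touches \<Omega> t x \<omega>\<close>: at the sample times, the path shifted by \<open>x\<close> is inside \<open>\<Omega>\<close>, but comes
  arbitrarily close to the complement.\<close>

definition touches :: "(real^'n) set \<Rightarrow> real \<Rightarrow> real^'n \<Rightarrow> 'w \<Rightarrow> bool" where
  "touches \<Omega> t x \<omega> \<longleftrightarrow> (\<forall>s\<in>sample_times t. X s \<omega> + x \<in> \<Omega>) \<and>
     (\<forall>m::nat. \<not> (\<forall>s\<in>sample_times t. X s \<omega> + x \<in> {y. inverse (real (Suc m)) \<le> infdist y (- \<Omega>)}))"

text \<open>The event that the exit time exceeds \<open>t\<close> contains the union over \<open>m\<close> of the events that the path
  keeps the distance \<open>1 / (m + 1)\<close> from the complement at the sample times, and is contained in the event that it stays in \<open>\<Omega>\<close> at the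
  sample times. If touching has probability 0, the completion measures the event in between.\<close>

lemma survival_probability_if_not_touching:
  assumes t: "0 \<le> t" and op: "open \<Omega>" and ae: "AE \<omega> in P 0. \<not> touches \<Omega> t x \<omega>"
  shows "measure (completion (P x)) {\<omega> \<in> space (P x). ereal t < exit_time X \<Omega> \<omega>} =
    measure (P 0) {\<omega> \<in> space (P 0). \<forall>s\<in>sample_times t. X s \<omega> + x \<in> \<Omega>}"
proof -
  define A where "A m = {y. inverse (real (Suc m)) \<le> infdist y (- \<Omega>)}" for m
  have clA: "closed (A m)" for m
    unfolding A_def by (intro closed_Collect_le continuous_intros)
  then have A: "A m \<in> sets borel" for m by (rule borel_closed)
  have AO: "A m \<subseteq> \<Omega>" for m
  proof
    fix y assume y: "y \<in> A m"
    show "y \<in> \<Omega>"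
    proof (rule ccontr)
      assume "y \<notin> \<Omega>"
      then have "infdist y (- \<Omega>) = 0" by simp
      moreover have "0 < inverse (real (Suc m))" by simp
      ultimately show False using y unfolding A_def by simp
    qed
  qed
  have Amono: "A m \<subseteq> A n" if "m \<le> n" for m n
  proof -
    have "inverse (real (Suc n)) \<le> inverse (real (Suc m))" using that by (intro le_imp_inverse_le) auto
    then show ?thesis unfolding A_def by (intro Collect_mono impI) (rule order_trans)
  qed
  have O: "\<Omega> \<in> sets borel" using op by simp
  \<comment> \<open>\<open>E B y\<close>: the path shifted by \<open>y\<close> stays in \<open>B\<close> at the sample times\<close>
  define E where "E B y = {\<omega> \<in> space (P 0). \<forall>s\<in>sample_times t. X s \<omega> + y \<in> B}" for B y
  have E: "E B y \<in> sets (P 0)" if "B \<in> sets borel" for B y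
    unfolding E_def using t that by (rule sampled_event)
  have Emono: "E B y \<subseteq> E B' y" if "B \<subseteq> B'" for B B' y unfolding E_def using that by blast
  have shift: "measure (P x) (E B 0) = measure (P 0) (E B x)" if "B \<in> sets borel" for B
    using prob_countable_times_shift[OF t that, of x] by (simp add: E_def)
  have inc: "incseq (\<lambda>m. E (A m) y)" for y using Emono Amono unfolding incseq_def by blast
  interpret Px: prob_space "P x" by (rule prob_space_P)
  have l1: "(\<lambda>m. measure (P x) (E (A m) 0)) \<longlonglongrightarrow> measure (P x) (\<Union>m. E (A m) 0)"
    using inc E[OF A] by (intro Px.finite_Lim_measure_incseq) (auto simp: sets_P[of x])
  have "(\<lambda>m. measure (P 0) (E (A m) x)) \<longlonglongrightarrow> measure (P 0) (\<Union>m. E (A m) x)"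
    using inc E[OF A] by (intro finite_Lim_measure_incseq) auto
  with l1 have "measure (P x) (\<Union>m. E (A m) 0) = measure (P 0) (\<Union>m. E (A m) x)"
    unfolding shift[OF A] by (rule LIMSEQ_unique)
  also have "\<dots> = measure (P 0) (E \<Omega> x)"
  proof (rule measure_eq_AE)
    show "AE \<omega> in P 0. \<omega> \<in> (\<Union>m. E (A m) x) \<longleftrightarrow> \<omega> \<in> E \<Omega> x"
      using ae
    proof eventually_elim
      case (elim \<omega>)
      have "\<omega> \<in> (\<Union>m. E (A m) x) \<Longrightarrow> \<omega> \<in> E \<Omega> x" using Emono[OF AO] by blast
      moreover have "\<omega> \<in> (\<Union>m. E (A m) x)" if "\<omega> \<in> E \<Omega> x"
        using elim that unfolding touches_def A_def[symmetric] by (auto simp: E_def)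
      ultimately show ?case by blast
    qed
  qed (use E[OF A] E[OF O] in auto)
  finally have eq: "measure (P x) (\<Union>m. E (A m) 0) = measure (P x) (E \<Omega> 0)"
    by (simp add: shift[OF O])
  have "measure (completion (P x)) {\<omega> \<in> space (P x). ereal t < exit_time X \<Omega> \<omega>} = measure (P x) (E \<Omega> 0)"
  proof (rule measure_completion_between[OF _ _ _ _ _ eq])
    show "finite_measure (P x)" by unfold_locales
    show "(\<Union>m. E (A m) 0) \<in> sets (P x)" using E[OF A] by (auto simp: sets_P[of x])
    show "E \<Omega> 0 \<in> sets (P x)" using E[OF O] by (simp add: sets_P[of x])
    show "(\<Union>m. E (A m) 0) \<subseteq> {\<omega> \<in> space (P x). ereal t < exit_time X \<Omega> \<omega>}"
    proof
      fix \<omega> assume "\<omega> \<in> (\<Union>m. E (A m) 0)"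
      then obtain m where \<omega>: "\<omega> \<in> space (P 0)" and m: "\<And>s. s \<in> sample_times t \<Longrightarrow> X s \<omega> \<in> A m"
        by (auto simp: E_def)
      have "closure ((\<lambda>s. X s \<omega>) ` sample_times t) \<subseteq> A m"
        using m clA by (intro closure_minimal) auto
      then have "X s \<omega> \<in> \<Omega>" if "0 \<le> s" "s \<le> t" for s
        using cadlag_in_closure_sampled[OF X_cadlag[OF \<omega>] that] AO by blast
      then have "ereal t < exit_time X \<Omega> \<omega>" by (intro exit_time_gt_if_in op X_cadlag[OF \<omega>] t)
      then show "\<omega> \<in> {\<omega> \<in> space (P x). ereal t < exit_time X \<Omega> \<omega>}" using \<omega> by (simp add: space_P[of x])
    qed
    show "{\<omega> \<in> space (P x). ereal t < exit_time X \<Omega> \<omega>} \<subseteq> E \<Omega> 0"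
    proof
      fix \<omega> assume "\<omega> \<in> {\<omega> \<in> space (P x). ereal t < exit_time X \<Omega> \<omega>}"
      then have "\<omega> \<in> space (P 0)" "ereal t < exit_time X \<Omega> \<omega>" by (auto simp: space_P[of x])
      moreover have "X s \<omega> \<in> \<Omega>" if "s \<in> sample_times t" for s
        using in_if_exit_time_gt[OF \<open>ereal t < exit_time X \<Omega> \<omega>\<close>] sample_times_subset[OF t] that by force
      ultimately show "\<omega> \<in> E \<Omega> 0" by (simp add: E_def)
    qed
  qed
  then show ?thesis using shift[OF O] by (simp add: E_def)
qed

lemma pair_event:
  assumes t: "0 \<le> t" and A: "A \<in> sets borel"
  shows "{w \<in> space (lborel \<Otimes>\<^sub>M P 0). \<forall>s\<in>sample_times t. X s (snd w) + fst w \<in> A} \<in> sets (lborel \<Otimes>\<^sub>M P 0)"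
proof (rule sets_Collect_countable_times[OF countable_sample_times])
  fix s assume "s \<in> sample_times t"
  then have "0 \<le> s" using sample_times_subset[OF t] by auto
  then have "(\<lambda>w. X s (snd w)) \<in> borel_measurable (lborel \<Otimes>\<^sub>M P 0)"
    by (intro measurable_compose[OF measurable_snd X_measurable])
  moreover have "fst \<in> borel_measurable (lborel \<Otimes>\<^sub>M P 0)" using measurable_fst[of lborel "P 0"] by simp
  ultimately have "(\<lambda>w. X s (snd w) + fst w) \<in> borel_measurable (lborel \<Otimes>\<^sub>M P 0)"
    by (rule borel_measurable_add)
  from measurable_sets[OF this A]
  show "{w \<in> space (lborel \<Otimes>\<^sub>M P 0). X s (snd w) + fst w \<in> A} \<in> sets (lborel \<Otimes>\<^sub>M P 0)"
    by (simp add: vimage_def Int_def conj_commute)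
qed (use zero_in_sample_times in auto)

lemma AE_not_touching:
  assumes t: "0 \<le> t" and op: "open \<Omega>" and bd: "bounded \<Omega>" and bdry: "C1_holder_boundary \<kappa> \<Omega>"
  shows "AE x in lborel. AE \<omega> in P 0. \<not> touches \<Omega> t x \<omega>"
proof -
  interpret pair_sigma_finite lborel "P 0" ..
  let ?L = "lborel \<Otimes>\<^sub>M P 0"
  have "{w \<in> space ?L. touches \<Omega> t (fst w) (snd w)} =
      {w \<in> space ?L. \<forall>s\<in>sample_times t. X s (snd w) + fst w \<in> \<Omega>} -
      (\<Union>m. {w \<in> space ?L. \<forall>s\<in>sample_times t. X s (snd w) + fst w \<in> {y. inverse (real (Suc m)) \<le> infdist y (- \<Omega>)}})"
    unfolding touches_def by blast
  moreover have "{y::real^'n. inverse (real (Suc m)) \<le> infdist y (- \<Omega>)} \<in> sets borel" for m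
    by (intro borel_closed closed_Collect_le continuous_intros)
  then have "(\<Union>m. {w \<in> space ?L. \<forall>s\<in>sample_times t. X s (snd w) + fst w \<in>
      {y. inverse (real (Suc m)) \<le> infdist y (- \<Omega>)}}) \<in> sets ?L"
    by (intro sets.countable_UN image_subsetI pair_event t)
  ultimately have "{w \<in> space ?L. touches \<Omega> t (fst w) (snd w)} \<in> sets ?L"
    using pair_event[OF t borel_open[OF op]] by (metis (no_types, lifting) sets.Diff)
  then have "{w \<in> space ?L. \<not> touches \<Omega> t (fst w) (snd w)} \<in> sets ?L"
    by (rule sets.sets_Collect_neg)
  moreover have "AE \<omega> in P 0. AE x in lborel. \<not> touches \<Omega> t x \<omega>"
  proof (rule AE_I2)
    fix \<omega> assume \<omega>: "\<omega> \<in> space (P 0)"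
    obtain N where N: "N \<in> null_sets lborel"
      and *: "\<And>x. (\<forall>y\<in>sampled t \<omega>. x + y \<in> \<Omega>) \<Longrightarrow>
        (\<forall>m::nat. \<exists>y\<in>sampled t \<omega>. infdist (x + y) (- \<Omega>) < inverse (real (Suc m))) \<Longrightarrow> x \<in> N"
      using touching_translates_null[OF op bd bdry countable_sampled bounded_sampled[OF \<omega> t] sampled_nonempty] by blast
    have "x \<in> N" if touch: "touches \<Omega> t x \<omega>" for x
    proof (rule *)
      show "\<forall>y\<in>sampled t \<omega>. x + y \<in> \<Omega>"
        using that by (auto simp: touches_def sampled_def add.commute)
      show "\<forall>m::nat. \<exists>y\<in>sampled t \<omega>. infdist (x + y) (- \<Omega>) < inverse (real (Suc m))"
      proof
        fix m :: nat
        obtain s where s: "s \<in> sample_times t" "\<not> inverse (real (Suc m)) \<le> infdist (X s \<omega> + x) (- \<Omega>)"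
          using touch unfolding touches_def by blast
        then show "\<exists>y\<in>sampled t \<omega>. infdist (x + y) (- \<Omega>) < inverse (real (Suc m))"
          unfolding sampled_def by (intro bexI[of _ "X s \<omega>"]) (auto simp: add.commute)
      qed
    qed
    then show "AE x in lborel. \<not> touches \<Omega> t x \<omega>"
      using N by (intro AE_I'[OF N]) auto
  qed
  ultimately show ?thesis by (subst AE_commute)
qed

lemma heat_loss_eq_expected_lost_volume:
  assumes t: "0 \<le> t" and op: "open \<Omega>" and bd: "bounded \<Omega>" and bdry: "C1_holder_boundary \<kappa> \<Omega>"
  shows "measure lebesgue \<Omega> - spectral_heat_content P X \<Omega> t =
      (LINT \<omega>|P 0. measure lborel (lost \<Omega> (sampled t \<omega>)))"
    and "integrable (P 0) (\<lambda>\<omega>. measure lborel (lost \<Omega> (sampled t \<omega>)))"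
proof -
  have sf: "sigma_finite_measure (P 0)" by unfold_locales
  interpret pair_sigma_finite lborel "P 0" ..
  let ?L = "lborel \<Otimes>\<^sub>M P 0"
  have O: "\<Omega> \<in> sets borel" using op by simp
  have fin: "emeasure lborel \<Omega> < \<infinity>" using emeasure_bounded_finite[OF bd] by simp
  \<comment> \<open>\<open>stay\<close> and \<open>S\<close> consist of the pairs of a starting point and a path: those that stay in \<open>\<Omega>\<close>, and
    those that start in \<open>\<Omega>\<close> and leave it\<close>
  define stay where "stay = {w \<in> space ?L. \<forall>s\<in>sample_times t. X s (snd w) + fst w \<in> \<Omega>}"
  have stay: "stay \<in> sets ?L" unfolding stay_def by (rule pair_event[OF t O])
  define S where "S = \<Omega> \<times> space (P 0) - stay"
  have cyl: "\<Omega> \<times> space (P 0) \<in> sets ?L" using O by auto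
  then have S: "S \<in> sets ?L" unfolding S_def using stay by (rule sets.Diff)
  have "emeasure ?L S \<le> emeasure ?L (\<Omega> \<times> space (P 0))"
    using cyl by (rule emeasure_mono[rotated]) (simp add: S_def)
  also have "\<dots> = emeasure lborel \<Omega> * emeasure (P 0) (space (P 0))"
    by (rule sigma_finite_measure.emeasure_pair_measure_Times[OF sf]) (simp_all add: op)
  also have "\<dots> = emeasure lborel \<Omega>" by (simp only: emeasure_space_1 mult_1_right)
  also note fin
  finally have iS: "integrable ?L (indicator S :: _ \<Rightarrow> real)"
    by (rule integrable_real_indicator[OF S])
  define f :: "real^'n \<Rightarrow> 'w \<Rightarrow> real" where "f x \<omega> = indicator S (x, \<omega>)" for x \<omega>
  have iF: "integrable ?L (case_prod f)" using iS by (simp add: f_def case_prod_beta')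
  define g where "g x = measure (P 0) {\<omega> \<in> space (P 0). \<forall>s\<in>sample_times t. X s \<omega> + x \<in> \<Omega>}" for x
  have inner2: "(LINT x|lborel. f x \<omega>) = measure lborel (lost \<Omega> (sampled t \<omega>))" if \<omega>: "\<omega> \<in> space (P 0)" for \<omega>
  proof -
    have "f x \<omega> = indicator (lost \<Omega> (sampled t \<omega>)) x" for x
      using \<omega> by (auto simp: f_def S_def stay_def lost_def sampled_def space_pair_measure indicator_def add.commute)
    then show ?thesis using lost_borel[OF op countable_sampled, of t \<omega>] by simp
  qed
  have gprod: "g x = (LINT \<omega>|P 0. indicator stay (x, \<omega>))" for x
  proof -
    have "(LINT \<omega>|P 0. indicator stay (x, \<omega>)) =
        (LINT \<omega>|P 0. indicator {\<omega> \<in> space (P 0). \<forall>s\<in>sample_times t. X s \<omega> + x \<in> \<Omega>} \<omega> :: real)"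
      by (intro Bochner_Integration.integral_cong refl) (auto simp: stay_def space_pair_measure indicator_def)
    then show ?thesis using sampled_event[OF t O, of x] by (simp add: g_def)
  qed
  have gm: "g \<in> borel_measurable borel"
    unfolding gprod[abs_def]
    using sigma_finite_measure.borel_measurable_lebesgue_integral[OF sf, of "\<lambda>x \<omega>. indicator stay (x, \<omega>) :: real" lborel] stay
    by (simp add: case_prod_beta')
  have g01: "0 \<le> g x" "g x \<le> 1" for x by (auto simp: g_def)
  have inner1: "(LINT \<omega>|P 0. f x \<omega>) = indicator \<Omega> x * (1 - g x)" for x
  proof (cases "x \<in> \<Omega>")
    case True
    have "(LINT \<omega>|P 0. f x \<omega>) = (LINT \<omega>|P 0. 1 - indicator {\<omega> \<in> space (P 0). \<forall>s\<in>sample_times t. X s \<omega> + x \<in> \<Omega>} \<omega> :: real)"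
      using True by (intro Bochner_Integration.integral_cong refl)
        (auto simp: f_def S_def stay_def space_pair_measure indicator_def)
    also have "\<dots> = 1 - g x"
      using sampled_event[OF t O, of x]
      by (subst Bochner_Integration.integral_diff)
        (auto simp: g_def prob_space less_top[symmetric] intro!: integrable_real_indicator)
    finally show ?thesis using True by simp
  next
    case False
    then show ?thesis by (simp add: f_def S_def)
  qed
  have ae: "AE x in lborel. measure (completion (P x)) {\<omega> \<in> space (P x). ereal t < exit_time X \<Omega> \<omega>} = g x"
    using AE_not_touching[OF t op bd bdry]
    by eventually_elim (simp add: g_def survival_probability_if_not_touching[OF t op])
  have "spectral_heat_content P X \<Omega> t = (LINT x:\<Omega>|lebesgue. g x)"
    unfolding spectral_heat_content_def set_lebesgue_integral_def
  proof (rule integral_cong_AE)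
    have "(\<lambda>x. measure (completion (P x)) {\<omega> \<in> space (P x). ereal t < exit_time X \<Omega> \<omega>}) \<in> borel_measurable lebesgue"
      using gm ae by (rule borel_measurable_lebesgue_AE_cong)
    moreover have "\<Omega> \<in> sets lebesgue" using O by simp
    ultimately show "(\<lambda>x. indicator \<Omega> x *\<^sub>R measure (completion (P x)) {\<omega> \<in> space (P x). ereal t < exit_time X \<Omega> \<omega>})
        \<in> borel_measurable lebesgue" by (intro borel_measurable_scaleR borel_measurable_indicator)
    show "(\<lambda>x. indicator \<Omega> x *\<^sub>R g x) \<in> borel_measurable lebesgue"
      using gm O by (intro measurable_completion) simp
    show "AE x in lebesgue. indicator \<Omega> x *\<^sub>R measure (completion (P x)) {\<omega> \<in> space (P x). ereal t < exit_time X \<Omega> \<omega>} =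
        indicator \<Omega> x *\<^sub>R g x"
      using AE_completion[OF ae] by eventually_elim simp
  qed
  also have "\<dots> = (LINT x|lborel. indicator \<Omega> x * g x)"
    using gm O by (subst set_integral_lebesgue_eq_lborel) (auto simp: set_lebesgue_integral_def)
  finally have Q: "spectral_heat_content P X \<Omega> t = (LINT x|lborel. indicator \<Omega> x * g x)" .
  have iO: "integrable lborel (indicator \<Omega> :: _ \<Rightarrow> real)"
    using O fin by (simp add: integrable_indicator_iff)
  have iOg: "integrable lborel (\<lambda>x. indicator \<Omega> x * g x)"
    using g01 gm O by (intro Bochner_Integration.integrable_bound[OF iO]) (auto simp: indicator_def)
  have "(LINT \<omega>|P 0. measure lborel (lost \<Omega> (sampled t \<omega>))) = (LINT \<omega>|P 0. LINT x|lborel. f x \<omega>)"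
    by (intro Bochner_Integration.integral_cong refl) (simp add: inner2)
  also have "\<dots> = (LINT x|lborel. LINT \<omega>|P 0. f x \<omega>)" using iF by (rule Fubini_integral)
  also have "\<dots> = (LINT x|lborel. indicator \<Omega> x - indicator \<Omega> x * g x)"
    unfolding inner1 by (simp add: right_diff_distrib)
  also have "\<dots> = measure lborel \<Omega> - spectral_heat_content P X \<Omega> t"
    using iO iOg O by (simp add: Q)
  finally show "measure lebesgue \<Omega> - spectral_heat_content P X \<Omega> t =
      (LINT \<omega>|P 0. measure lborel (lost \<Omega> (sampled t \<omega>)))" using O by simp
  have "integrable (P 0) (\<lambda>\<omega>. LINT x|lborel. f x \<omega>)" using integrable_snd[OF iF] .
  then show "integrable (P 0) (\<lambda>\<omega>. measure lborel (lost \<Omega> (sampled t \<omega>)))"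
    by (subst Bochner_Integration.integrable_cong[OF refl, of _ _ "\<lambda>\<omega>. LINT x|lborel. f x \<omega>"]) (simp_all add: inner2)
qed

end

section \<open>The expected lost volume for short times\<close>

lemma sum_powr_le_card_powr:
  fixes a :: "'i \<Rightarrow> real"
  assumes I: "finite I" and a: "\<And>i. i \<in> I \<Longrightarrow> 0 \<le> a i" and p: "0 \<le> p"
  shows "(\<Sum>i\<in>I. a i) powr p \<le> real (card I) powr p * (\<Sum>i\<in>I. a i powr p)"
proof (cases "I = {}")
  case False
  obtain j where j: "j \<in> I" "\<And>i. i \<in> I \<Longrightarrow> a i \<le> a j"
    using Max_in[of "a ` I"] Max_ge[of "a ` I"] I False by (metis (no_types, lifting) finite_imageI imageE imageI image_is_empty)
  have "(\<Sum>i\<in>I. a i) \<le> real (card I) * a j" using j(2) by (rule sum_bounded_above)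
  then have "(\<Sum>i\<in>I. a i) powr p \<le> (real (card I) * a j) powr p"
    using a p by (intro powr_mono2 sum_nonneg) auto
  also have "\<dots> = real (card I) powr p * a j powr p" using a[OF j(1)] by (simp add: powr_mult)
  also have "a j powr p \<le> (\<Sum>i\<in>I. a i powr p)"
    using j(1) I by (intro member_le_sum) auto
  finally show ?thesis by (simp add: mult_left_mono)
qed simp

context isotropic_process
begin

text \<open>A bound on the distance from the origin up to time \<open>t\<close> for paths started there, as a sum of
  running suprema along the coordinate directions.\<close>

definition radius :: "real \<Rightarrow> 'w \<Rightarrow> real" where
  "radius t \<omega> = (\<Sum>(b, \<sigma>)\<in>Basis \<times> {1, -1}. directional_sup (\<sigma> *\<^sub>R b) t \<omega>)"

lemma zero_in_sampled: "X 0 \<omega> = 0 \<Longrightarrow> 0 \<in> sampled t \<omega>"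
  unfolding sampled_def using zero_in_sample_times by force

lemma directional_sup_nonneg:
  assumes "\<omega> \<in> space (P 0)" "X 0 \<omega> = 0" "0 \<le> t"
  shows "0 \<le> directional_sup u t \<omega>"
  using inner_le_directional_sup[OF assms(1,3) zero_in_sampled[OF assms(2)]] by simp

lemma sampled_subset_cball_radius:
  assumes \<omega>: "\<omega> \<in> space (P 0)" "X 0 \<omega> = 0" and t: "0 \<le> t"
  shows "sampled t \<omega> \<subseteq> cball 0 (radius t \<omega>)"
proof
  fix y assume y: "y \<in> sampled t \<omega>"
  have "norm y \<le> (\<Sum>b\<in>Basis. \<bar>y \<bullet> b\<bar>)" by (rule norm_le_l1)
  also have "\<dots> \<le> (\<Sum>b\<in>Basis. \<Sum>\<sigma>\<in>{1, -1}. directional_sup (\<sigma> *\<^sub>R b) t \<omega>)"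
  proof (rule sum_mono)
    fix b :: "real^'n"
    show "\<bar>y \<bullet> b\<bar> \<le> (\<Sum>\<sigma>\<in>{1, -1}. directional_sup (\<sigma> *\<^sub>R b) t \<omega>)"
      using inner_le_directional_sup[OF \<omega>(1) t y, of b] inner_le_directional_sup[OF \<omega>(1) t y, of "- b"]
        directional_sup_nonneg[OF \<omega> t, of b] directional_sup_nonneg[OF \<omega> t, of "- b"]
      by (simp add: abs_if)
  qed
  also have "\<dots> = radius t \<omega>" unfolding radius_def by (rule sum.cartesian_product)
  finally show "y \<in> cball 0 (radius t \<omega>)" by simp
qed

lemma AE_start_0: "AE \<omega> in P 0. \<omega> \<in> space (P 0) \<and> X 0 \<omega> = 0"
  using X_start[of 0] AE_space by eventually_elim simp

lemma directional_sup_integrable: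
  assumes p: "1 < p" and t: "0 \<le> t" and int: "integrable (P 0) (\<lambda>\<omega>. running_sup X k t \<omega> powr p)"
    and u: "norm u = 1"
  shows "integrable (P 0) (\<lambda>\<omega>. directional_sup u t \<omega> powr p)" "integrable (P 0) (directional_sup u t)"
proof -
  show ip: "integrable (P 0) (\<lambda>\<omega>. directional_sup u t \<omega> powr p)"
    using directional_sup_expectation(1)[OF u t, of "\<lambda>x. x powr p" k] int by simp
  have "integrable (P 0) (\<lambda>\<omega>. 1 + directional_sup u t \<omega> powr p)" using ip by simp
  then show "integrable (P 0) (directional_sup u t)"
  proof (rule Bochner_Integration.integrable_bound)
    show "AE \<omega> in P 0. norm (directional_sup u t \<omega>) \<le> norm (1 + directional_sup u t \<omega> powr p)"
      using AE_start_0
    proof eventually_elim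
      case (elim \<omega>)
      then have nn: "0 \<le> directional_sup u t \<omega>" using t by (intro directional_sup_nonneg) auto
      have "directional_sup u t \<omega> \<le> 1 + directional_sup u t \<omega> powr p"
      proof (cases "directional_sup u t \<omega> \<le> 1")
        case False
        then have "directional_sup u t \<omega> powr 1 \<le> directional_sup u t \<omega> powr p"
          using p by (intro powr_mono) auto
        then show ?thesis using nn by simp
      qed (use powr_ge_zero[of "directional_sup u t \<omega>" p] in linarith)
      then show ?case using nn by simp
    qed
  qed (rule directional_sup_measurable[OF t])
qed

lemma running_sup_powr_integrable:
  assumes t: "0 \<le> t" "t \<le> T" and p: "1 < p"
    and int: "integrable (P 0) (\<lambda>\<omega>. running_sup X k T \<omega> powr p)"
  shows "integrable (P 0) (\<lambda>\<omega>. running_sup X k t \<omega> powr p)"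
proof -
  have T: "0 \<le> T" using t by simp
  have "integrable (P 0) (\<lambda>\<omega>. directional_sup (axis k 1) t \<omega> powr p)"
  proof (rule Bochner_Integration.integrable_bound[OF int])
    show "(\<lambda>\<omega>. directional_sup (axis k 1) t \<omega> powr p) \<in> borel_measurable (P 0)"
      using directional_sup_measurable[OF t(1)] by simp
    show "AE \<omega> in P 0. norm (directional_sup (axis k 1) t \<omega> powr p) \<le> norm (running_sup X k T \<omega> powr p)"
      using AE_start_0
    proof eventually_elim
      case (elim \<omega>)
      then have \<omega>: "\<omega> \<in> space (P 0)" by simp
      have "bdd_above ((\<lambda>y. y \<bullet> axis k 1) ` ((\<lambda>s. X s \<omega>) ` {0..T}))"
        by (intro bdd_above_inner bounded_path \<omega>)
      then have "bdd_above ((\<lambda>s. X s \<omega> $ k) ` {0..T})" by (simp add: image_image inner_axis)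
      then have "running_sup X k t \<omega> \<le> running_sup X k T \<omega>"
        unfolding running_sup_def using t by (intro cSUP_subset_mono) auto
      moreover have "0 \<le> directional_sup (axis k 1) t \<omega>"
        using elim t by (intro directional_sup_nonneg) auto
      ultimately show ?case using p by (auto simp: running_sup_eq_directional_sup[OF \<omega> t(1)] intro!: powr_mono2)
    qed
  qed
  then show ?thesis
    using t(1) p directional_sup_expectation(1)[of "axis k 1" t "\<lambda>x. x powr p" k] by simp
qed

text \<open>The estimate for the lost volume, integrated over the paths. By isotropy, all suprema
  \<open>directional_sup v t\<close> with unit vectors \<open>v\<close> have the same moments.\<close>

lemma expected_lost_volume_estimate:
  fixes \<Omega> :: "(real^'n) set" and \<epsilon> S :: real
  assumes patches: "boundary_patches \<Omega> \<epsilon> \<delta> n \<zeta> z u r" and p: "1 < p"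
    and bdry: "C1_holder_boundary \<kappa> \<Omega>"
  defines "S \<equiv> boundary_patches.total_flux \<Omega> n \<zeta> u"
  shows "\<exists>C\<ge>0. \<forall>t\<ge>0. integrable (P 0) (\<lambda>\<omega>. running_sup X k t \<omega> powr p) \<longrightarrow>
    \<bar>(measure lebesgue \<Omega> - spectral_heat_content P X \<Omega> t) - S * (LINT \<omega>|P 0. running_sup X k t \<omega>)\<bar>
      \<le> 4 * real CARD('n) * \<epsilon> * (S + 1) * (LINT \<omega>|P 0. running_sup X k t \<omega>)
        + C * (LINT \<omega>|P 0. running_sup X k t \<omega> powr p)"
proof -
  interpret B: boundary_patches \<Omega> \<epsilon> \<delta> n \<zeta> z u r by (rule patches)
  have S0: "0 \<le> S" unfolding S_def by (rule B.total_flux_nonneg)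
  obtain C where C: "C \<ge> 0" and est: "\<And>R \<rho>. countable R \<Longrightarrow> 0 \<in> R \<Longrightarrow> R \<subseteq> cball 0 \<rho> \<Longrightarrow>
    \<bar>measure lborel (lost \<Omega> R) - (\<Sum>i<n. (SUP y\<in>R. y \<bullet> u i) * flux \<Omega> (\<zeta> i) (u i))\<bar>
      \<le> 2 * \<epsilon> * (S + 1) * \<rho> + C * \<rho> powr p"
    using B.measure_lost_estimate[OF p] unfolding S_def by blast
  \<comment> \<open>the radius is the sum of the running suprema along the \<open>2 * CARD('n)\<close> unit vectors \<open>dir i\<close>\<close>
  define I where "I = (Basis :: (real^'n) set) \<times> {1, -1 :: real}"
  define dir where "dir i = snd i *\<^sub>R fst i" for i :: "(real^'n) \<times> real"
  have fI: "finite I" by (simp add: I_def)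
  have cI: "card I = 2 * CARD('n)" by (simp add: I_def)
  have ndir: "norm (dir i) = 1" if "i \<in> I" for i using that by (auto simp: I_def dir_def)
  have rad: "radius t \<omega> = (\<Sum>i\<in>I. directional_sup (dir i) t \<omega>)" for t \<omega>
    unfolding radius_def I_def dir_def by (simp add: case_prod_beta')
  define C' where "C' = C * (real (card I) powr p * card I)"
  have C': "C' \<ge> 0" using C by (simp add: C'_def)
  show ?thesis
  proof (intro exI[of _ C'] conjI allI impI C')
    fix t :: real assume t: "0 \<le> t" and int: "integrable (P 0) (\<lambda>\<omega>. running_sup X k t \<omega> powr p)"
    define m where "m = (LINT \<omega>|P 0. running_sup X k t \<omega>)"
    define mp where "mp = (LINT \<omega>|P 0. running_sup X k t \<omega> powr p)"
    note idp = directional_sup_integrable(1)[OF p t int] and id = directional_sup_integrable(2)[OF p t int]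
    have Ed: "(LINT \<omega>|P 0. directional_sup v t \<omega>) = m" if "norm v = 1" for v
      using directional_sup_expectation(2)[OF that t, of "\<lambda>x. x" k] by (simp add: m_def)
    have Edp: "(LINT \<omega>|P 0. directional_sup v t \<omega> powr p) = mp" if "norm v = 1" for v
      using directional_sup_expectation(2)[OF that t, of "\<lambda>x. x powr p" k] by (simp add: mp_def)
    define V where "V \<omega> = measure lborel (lost \<Omega> (sampled t \<omega>))" for \<omega>
    define H where "H \<omega> = (\<Sum>i<n. directional_sup (u i) t \<omega> * flux \<Omega> (\<zeta> i) (u i))" for \<omega>
    have iV: "integrable (P 0) V" unfolding V_def
      by (rule heat_loss_eq_expected_lost_volume(2)[OF t B.op B.bd bdry])
    have iH: "integrable (P 0) H" unfolding H_def
      using id B.norm_u(1) by (intro Bochner_Integration.integrable_sum integrable_mult_left) auto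
    have EH: "(LINT \<omega>|P 0. H \<omega>) = S * m"
    proof -
      have "(LINT \<omega>|P 0. H \<omega>) = (\<Sum>i<n. LINT \<omega>|P 0. directional_sup (u i) t \<omega> * flux \<Omega> (\<zeta> i) (u i))"
        unfolding H_def using id B.norm_u(1)
        by (intro Bochner_Integration.integral_sum integrable_mult_left) auto
      also have "\<dots> = (\<Sum>i<n. m * flux \<Omega> (\<zeta> i) (u i))"
        using Ed B.norm_u(1) by (intro sum.cong refl) simp
      finally show ?thesis by (simp add: S_def B.total_flux_def sum_distrib_left mult.commute)
    qed
    define G where "G \<omega> = 2 * \<epsilon> * (S + 1) * (\<Sum>i\<in>I. directional_sup (dir i) t \<omega>) +
      C * (real (card I) powr p * (\<Sum>i\<in>I. directional_sup (dir i) t \<omega> powr p))" for \<omega>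
    have iG: "integrable (P 0) G" unfolding G_def
      using id idp ndir by (intro Bochner_Integration.integrable_add integrable_mult_right
        Bochner_Integration.integrable_sum) auto
    have EG: "(LINT \<omega>|P 0. G \<omega>) = 4 * real CARD('n) * \<epsilon> * (S + 1) * m + C' * mp"
    proof -
      have "(LINT \<omega>|P 0. G \<omega>) = 2 * \<epsilon> * (S + 1) * (\<Sum>i\<in>I. LINT \<omega>|P 0. directional_sup (dir i) t \<omega>) +
        C * (real (card I) powr p * (\<Sum>i\<in>I. LINT \<omega>|P 0. directional_sup (dir i) t \<omega> powr p))"
        unfolding G_def using id idp ndir by (simp add: Bochner_Integration.integral_sum)
      also have "\<dots> = 2 * \<epsilon> * (S + 1) * (\<Sum>i\<in>I. m) + C * (real (card I) powr p * (\<Sum>i\<in>I. mp))"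
        using Ed Edp ndir by simp
      finally show ?thesis by (simp add: cI C'_def algebra_simps)
    qed
    have "AE \<omega> in P 0. \<bar>V \<omega> - H \<omega>\<bar> \<le> G \<omega>"
      using AE_start_0
    proof eventually_elim
      case (elim \<omega>)
      then have \<omega>: "\<omega> \<in> space (P 0)" "X 0 \<omega> = 0" by auto
      have "\<bar>V \<omega> - H \<omega>\<bar> \<le> 2 * \<epsilon> * (S + 1) * radius t \<omega> + C * radius t \<omega> powr p"
        unfolding V_def H_def directional_sup_def
        by (intro est countable_sampled zero_in_sampled sampled_subset_cball_radius \<omega> t)
      also have "radius t \<omega> powr p \<le> real (card I) powr p * (\<Sum>i\<in>I. directional_sup (dir i) t \<omega> powr p)"
        unfolding rad using p by (intro sum_powr_le_card_powr fI directional_sup_nonneg \<omega> t) auto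
      finally show ?case using C unfolding G_def rad by (simp add: mult_left_mono)
    qed
    then have "(LINT \<omega>|P 0. \<bar>V \<omega> - H \<omega>\<bar>) \<le> (LINT \<omega>|P 0. G \<omega>)"
      using iV iH iG by (intro integral_mono_AE) auto
    moreover have "\<bar>LINT \<omega>|P 0. V \<omega> - H \<omega>\<bar> \<le> (LINT \<omega>|P 0. \<bar>V \<omega> - H \<omega>\<bar>)"
      by (rule integral_abs_bound)
    moreover have "(LINT \<omega>|P 0. V \<omega> - H \<omega>) = (LINT \<omega>|P 0. V \<omega>) - S * m"
      using iV iH by (simp add: EH)
    moreover have "(LINT \<omega>|P 0. V \<omega>) = measure lebesgue \<Omega> - spectral_heat_content P X \<Omega> t"
      unfolding V_def by (rule heat_loss_eq_expected_lost_volume(1)[OF t B.op B.bd bdry, symmetric])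
    ultimately show "\<bar>(measure lebesgue \<Omega> - spectral_heat_content P X \<Omega> t) - S * (LINT \<omega>|P 0. running_sup X k t \<omega>)\<bar>
      \<le> 4 * real CARD('n) * \<epsilon> * (S + 1) * (LINT \<omega>|P 0. running_sup X k t \<omega>)
        + C' * (LINT \<omega>|P 0. running_sup X k t \<omega> powr p)"
      unfolding EG m_def[symmetric] mp_def[symmetric] by simp
  qed
qed

lemma expected_running_sup_nonneg:
  assumes "0 \<le> t"
  shows "0 \<le> (LINT \<omega>|P 0. running_sup X k t \<omega>)"
proof (rule integral_nonneg_AE)
  show "AE \<omega> in P 0. 0 \<le> running_sup X k t \<omega>"
    using AE_start_0
    by eventually_elim (simp add: running_sup_eq_directional_sup assms directional_sup_nonneg)
qed

end

section \<open>Asymptotics of the heat content\<close>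

theorem proposition1p3:
  fixes \<Omega> :: "(real^'n) set"
    and P :: "real^'n \<Rightarrow> 'w measure"
    and X :: "real \<Rightarrow> 'w \<Rightarrow> real^'n"
    and k :: 'n
    and T p :: real
  assumes "open \<Omega>" and "bounded \<Omega>" and "C1_holder_boundary 1 \<Omega>"
    and "cadlag_process P X" and "translation_invariant P X" and "isotropic P X"
    and "T > 0" and "p > 1"
    and "integrable (P 0) (\<lambda>\<omega>. running_sup X k T \<omega> powr p)"
    and "\<forall>\<^sub>F t in at_right 0. (LINT \<omega>|P 0. running_sup X k t \<omega>) \<noteq> 0"
    and "((\<lambda>t. (LINT \<omega>|P 0. running_sup X k t \<omega> powr p) / (LINT \<omega>|P 0. running_sup X k t \<omega>))
            \<longlongrightarrow> 0) (at_right 0)"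
  shows "((\<lambda>t. ereal ((measure lebesgue \<Omega> - spectral_heat_content P X \<Omega> t) /
                       (LINT \<omega>|P 0. running_sup X k t \<omega>)))
            \<longlongrightarrow> perimeter \<Omega>) (at_right 0)"
proof -
  interpret isotropic_process P X by unfold_locales fact+
  define d where "d = real CARD('n)"
  have d: "d \<ge> 1" by (simp add: d_def Suc_leI)
  define m where "m t = (LINT \<omega>|P 0. running_sup X k t \<omega>)" for t
  define mp where "mp t = (LINT \<omega>|P 0. running_sup X k t \<omega> powr p)" for t
  define q where "q t = (measure lebesgue \<Omega> - spectral_heat_content P X \<Omega> t) / m t" for t
  have patches: "\<exists>S C. 0 \<le> S \<and> 0 \<le> C \<and> ereal S \<le> perimeter \<Omega> \<and> perimeter \<Omega> \<le> ereal ((1 + 2 * d * \<epsilon>) * S) \<and>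
      (\<forall>t. 0 < t \<longrightarrow> t \<le> T \<longrightarrow> m t \<noteq> 0 \<longrightarrow> \<bar>q t - S\<bar> \<le> 4 * d * \<epsilon> * (S + 1) + C * (mp t / m t))"
    if eps: "0 < \<epsilon>" "\<epsilon> \<le> 1 / 2" for \<epsilon>
  proof -
    obtain \<delta> n \<zeta> z u r where B: "boundary_patches \<Omega> \<epsilon> \<delta> n \<zeta> z u r"
      using boundary_patches_exist[OF assms(1-3) eps] by blast
    define S where "S = boundary_patches.total_flux \<Omega> n \<zeta> u"
    obtain C where C: "C \<ge> 0" and est: "\<And>t. t \<ge> 0 \<Longrightarrow> integrable (P 0) (\<lambda>\<omega>. running_sup X k t \<omega> powr p) \<Longrightarrow>
      \<bar>(measure lebesgue \<Omega> - spectral_heat_content P X \<Omega> t) - S * m t\<bar> \<le> 4 * d * \<epsilon> * (S + 1) * m t + C * mp t"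
      using expected_lost_volume_estimate[OF B assms(8,3), of k] unfolding S_def m_def mp_def d_def by blast
    have "\<bar>q t - S\<bar> \<le> 4 * d * \<epsilon> * (S + 1) + C * (mp t / m t)" if t: "0 < t" "t \<le> T" "m t \<noteq> 0" for t
    proof -
      have mt: "m t > 0" using expected_running_sup_nonneg[of t k] t by (simp add: m_def)
      have int: "integrable (P 0) (\<lambda>\<omega>. running_sup X k t \<omega> powr p)"
        using t assms(8,9) by (intro running_sup_powr_integrable[of t T]) auto
      have "\<bar>q t - S\<bar> = \<bar>(measure lebesgue \<Omega> - spectral_heat_content P X \<Omega> t) - S * m t\<bar> / m t"
      proof -
        have "q t - S = ((measure lebesgue \<Omega> - spectral_heat_content P X \<Omega> t) - S * m t) / m t"
          using mt by (simp add: q_def diff_divide_distrib)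
        then show ?thesis using mt by (simp add: abs_divide)
      qed
      also have "\<dots> \<le> (4 * d * \<epsilon> * (S + 1) * m t + C * mp t) / m t"
        using est[OF less_imp_le[OF t(1)] int] mt by (intro divide_right_mono) auto
      also have "\<dots> = 4 * d * \<epsilon> * (S + 1) + C * (mp t / m t)" using mt by (simp add: field_simps)
      finally show ?thesis .
    qed
    then show ?thesis
      using boundary_patches.total_flux_nonneg[OF B] boundary_patches.total_flux_le_perimeter[OF B]
        boundary_patches.perimeter_le_total_flux[OF B] C
      unfolding S_def d_def by blast
  qed
  \<comment> \<open>a single value of \<open>\<epsilon>\<close> already shows that the perimeter is finite\<close>
  obtain \<pi> where \<pi>: "perimeter \<Omega> = ereal \<pi>" "0 \<le> \<pi>"
  proof -
    obtain S where "0 \<le> S" "ereal S \<le> perimeter \<Omega>" "perimeter \<Omega> \<le> ereal ((1 + 2 * d * (1 / 2)) * S)"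
      using patches[of "1 / 2"] by auto
    then show ?thesis using that by (cases "perimeter \<Omega>") auto
  qed
  have "(q \<longlongrightarrow> \<pi>) (at_right 0)"
  proof (rule tendstoI)
    fix e :: real assume e: "e > 0"
    \<comment> \<open>\<open>\<epsilon> * K\<close> bounds the distance of the quotient from \<open>S\<close>, apart from the \<open>p\<close>-th moments, plus the
      distance of \<open>S\<close> from the perimeter\<close>
    define K where "K = 4 * d * (\<pi> + 1) + 2 * d * \<pi>"
    have K: "K \<ge> 0" using d \<pi>(2) by (simp add: K_def)
    define \<epsilon> where "\<epsilon> = min (1 / 2) (e / (2 * (K + 1)))"
    have eps: "0 < \<epsilon>" using e K by (simp add: \<epsilon>_def)
    have eps2: "\<epsilon> \<le> 1 / 2" unfolding \<epsilon>_def by (rule min.cobounded1)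
    have "\<epsilon> * K \<le> e / (2 * (K + 1)) * K"
      using K unfolding \<epsilon>_def by (intro mult_right_mono min.cobounded2)
    also have "\<dots> < e / 2" using e K by (simp add: field_simps)
    finally have epsK: "\<epsilon> * K < e / 2" .
    obtain S C where S: "0 \<le> S" "S \<le> \<pi>" "\<pi> \<le> (1 + 2 * d * \<epsilon>) * S" and C: "0 \<le> C"
      and est: "\<And>t. 0 < t \<Longrightarrow> t \<le> T \<Longrightarrow> m t \<noteq> 0 \<Longrightarrow> \<bar>q t - S\<bar> \<le> 4 * d * \<epsilon> * (S + 1) + C * (mp t / m t)"
      using patches[OF eps eps2] unfolding \<pi>(1) by auto
    have "2 * d * \<epsilon> * S \<le> 2 * d * \<epsilon> * \<pi>" using S(2) d eps by (intro mult_left_mono) auto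
    then have SP: "\<bar>S - \<pi>\<bar> \<le> 2 * d * \<epsilon> * \<pi>" using S by (simp add: algebra_simps)
    have SP2: "4 * d * \<epsilon> * (S + 1) \<le> 4 * d * \<epsilon> * (\<pi> + 1)" using S(2) d eps by (intro mult_left_mono) auto
    have eq: "4 * d * \<epsilon> * (\<pi> + 1) + 2 * d * \<epsilon> * \<pi> = \<epsilon> * K" by (simp add: K_def algebra_simps)
    have "e / (2 * (C + 1)) > 0" using e C by simp
    with assms(11) have "\<forall>\<^sub>F t in at_right 0. dist (mp t / m t) 0 < e / (2 * (C + 1))"
      unfolding m_def mp_def by (rule tendstoD)
    moreover have "\<forall>\<^sub>F t in at_right 0. m t \<noteq> 0" using assms(10) by (simp add: m_def)
    moreover have "\<forall>\<^sub>F t in at_right 0. 0 < t \<and> t \<le> T"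
      using assms(7) unfolding eventually_at_right_field by (intro exI[of _ T]) auto
    ultimately show "\<forall>\<^sub>F t in at_right 0. dist (q t) \<pi> < e"
    proof eventually_elim
      case (elim t)
      have "mp t / m t \<le> e / (2 * (C + 1))"
        using elim(1) abs_ge_self[of "mp t / m t"] unfolding dist_real_def by linarith
      then have "C * (mp t / m t) \<le> C * (e / (2 * (C + 1)))" using C by (rule mult_left_mono)
      also have "\<dots> \<le> e / 2" using e C by (simp add: field_simps)
      finally have "C * (mp t / m t) \<le> e / 2" .
      moreover have "\<bar>q t - S\<bar> \<le> 4 * d * \<epsilon> * (S + 1) + C * (mp t / m t)" using elim by (intro est) auto
      ultimately show ?case using SP SP2 eq epsK unfolding dist_real_def by linarith
    qed
  qed
  then show ?thesis unfolding \<pi>(1) q_def m_def by (rule tendsto_ereal)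
qed

end
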